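(* Let $d\ge3$ and let $\mathbf f$ be a nonzero box-simple vector field on $\mathbb{R}^d$. Then the magnetic potential of $\mathbf f$ does not vanish identically on the complement of its support: $$P_{\mathrm{supp}(\mathbf f)^{c}\leftarrow\mathrm{supp}(\mathbf f)}(\mathbf f)\neq0 .$$ Moreover, if $\Omega\subset\mathbb{R}^d$ is a bounded, connected and simply connected Lipschitz domain that contains $\mathrm{supp}(\mathbf f)$, then in the Helmholtz-Hodge decomposition $$L^2(\Omega;\mathbb{R}^d)=\nabla H^1_0(\Omega)\oplus\nabla\mathscr{H}(\Omega)\oplus H_{\mathrm{div},0}(\Omega)$$ the harmonic gradient component (the component in $\nabla\mathscr{H}(\Omega)$) of $\mathbf f$ is nonzero.
   Context: A vector field $\mathbf f:\mathbb{R}^d\to\mathbb{R}^d$ is box-simple if it has the form $\mathbf f=\sum_{i=1}^N\mathbf v_i\chi_{\omega_i}$ (up to null sets) with finitely many vectors $\mathbf v_i\in\mathbb{R}^d$ and bounded rectangular parallelepipeds $\omega_i$ with edges parallel to the coordinate axes ($\chi_A$ is the characteristic function of $A$). When $\mathbf f$ is nonzero, the $\omega_i$ are tacitly taken to be nonempty and open and the $\mathbf v_i$ nonzero, so that $\mathrm{supp}(\mathbf f)=\bigcup_i\overline{\omega_i}$. For $A\subset\mathbb{R}^d$, $A^c:=\mathbb{R}^d\setminus\overline A$. With $N(x)=\frac{1}{(d-2)\omega_d}|x|^{2-d}$, where $\omega_d$ is the area of the unit sphere in $\mathbb{R}^d$, the magnetic potential is $P_{\mathrm{supp}(\mathbf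 f)^{c}\leftarrow\mathrm{supp}(\mathbf f)}(\mathbf f)(x)=\int_{\mathrm{supp}(\mathbf f)}\nabla N(x-y)\cdot\mathbf f(y)\,dy$ for $x\in \mathrm{supp}(\mathbf f)^c$. A Lipschitz domain is a connected open set with compact boundary that is locally, after a rigid motion, the graph of a Lipschitz function. For bounded $\Omega$, $\mathscr{H}(\Omega)$ is the space of harmonic functions in $H^1(\Omega)$, $\nabla\mathscr{H}(\Omega)$ and $\nabla H_0^1(\Omega)$ are the spaces of gradients, and $H_{\mathrm{div},0}(\Omega)$ is the $L^2$-closure of the divergence-free fields in $C_0^\infty(\Omega;\mathbb{R}^d)$. The displayed sum is an orthogonal direct sum in $L^2(\Omega;\mathbb{R}^d)$. *)

theory Defs
  imports "HOL-Analysis.Analysis"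
begin

text \<open>
  Integrals and null sets refer to the complete measure \<^const>\<open>lebesgue\<close>, because a field that is only
  specified up to null sets need not be Borel measurable.
\<close>

section \<open>Box-simple vector fields\<close>

definition box_simple :: "('a::euclidean_space \<Rightarrow> 'a) \<Rightarrow> bool" where
  "box_simple f \<longleftrightarrow>
     (\<exists>N. \<exists>v a b :: nat \<Rightarrow> 'a.
        (\<forall>i<N. v i \<noteq> 0 \<and> box (a i) (b i) \<noteq> {}) \<and>
        (AE x in lebesgue. f x = (\<Sum>i<N. indicator (box (a i) (b i)) x *\<^sub>R v i)))"

text \<open>The essential support. It depends only on the class of \<open>f\<close> up to null sets and is closed.\<close>

definition ess_supp :: "('a::euclidean_space \<Rightarrow> 'b::zero) \<Rightarrow> 'a set" where
  "ess_supp f = {x. \<forall>U. open U \<and> x \<in> U \<longrightarrow> \<not> (AE y in lebesgue. y \<in> U \<longrightarrow> f y = 0)}"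

text \<open>
  For a representation by pairwise disjoint boxes, which every box-simple field has, the essential
  support is the union of the closed boxes. If the boxes overlap, then the summands may cancel and the
  union may be strictly larger.
\<close>

lemma ess_supp_box_simple:
  fixes f :: "'a::euclidean_space \<Rightarrow> 'a"
    and N :: nat
  assumes f: "AE x in lebesgue. f x = (\<Sum>i<N. indicator (box (a i) (b i)) x *\<^sub>R v i)"
    and v: "\<And>i. i < N \<Longrightarrow> v i \<noteq> 0"
    and disj: "\<And>i j. i < N \<Longrightarrow> j < N \<Longrightarrow> i \<noteq> j \<Longrightarrow> box (a i) (b i) \<inter> box (a j) (b j) = {}"
  shows "ess_supp f = (\<Union>i<N. closure (box (a i) (b i)))"
proof (intro equalityI subsetI)
  fix x assume x: "x \<in> ess_supp f"
  show "x \<in> (\<Union>i<N. closure (box (a i) (b i)))"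
  proof (rule ccontr)
    assume nx: "x \<notin> (\<Union>i<N. closure (box (a i) (b i)))"
    let ?U = "- (\<Union>i<N. closure (box (a i) (b i)))"
    have op: "open ?U" by (auto intro!: open_Compl closed_UN simp del: closure_box)
    have "AE y in lebesgue. y \<in> ?U \<longrightarrow> f y = 0"
      using f
    proof eventually_elim
      case (elim y)
      show ?case
      proof
        assume y: "y \<in> ?U"
        then have "y \<notin> box (a i) (b i)" if "i < N" for i
          using that closure_subset[of "box (a i) (b i)"] by blast
        then show "f y = 0" using elim by simp
      qed
    qed
    with x op nx show False unfolding ess_supp_def by blast
  qed
next
  fix x assume "x \<in> (\<Union>i<N. closure (box (a i) (b i)))"
  then obtain i where i: "i < N" and x: "x \<in> closure (box (a i) (b i))" by auto
  show "x \<in> ess_supp f"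
    unfolding ess_supp_def
  proof (intro CollectI allI impI notI, elim conjE)
    fix U assume U: "open U" "x \<in> U" and ae: "AE y in lebesgue. y \<in> U \<longrightarrow> f y = 0"
    have ne: "U \<inter> box (a i) (b i) \<noteq> {}"
      using U x open_Int_closure_eq_empty by blast
    have "AE y in lebesgue. y \<notin> U \<inter> box (a i) (b i)"
      using ae f
    proof eventually_elim
      case (elim y)
      show ?case
      proof
        assume y: "y \<in> U \<inter> box (a i) (b i)"
        have "(\<Sum>j<N. indicator (box (a j) (b j)) y *\<^sub>R v j) = (\<Sum>j<N. if j = i then v i else 0)"
          using y disj[OF i] by (intro sum.cong refl) (auto simp: indicator_def)
        also have "\<dots> = v i" using i by simp
        finally show False using elim y v[OF i] by auto
      qed
    qed
    moreover have "U \<inter> box (a i) (b i) \<in> sets lebesgue"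
      using U(1) by (simp add: lmeasurable_open open_Int borel_open sets_completionI_sets)
    ultimately have "negligible (U \<inter> box (a i) (b i))"
      by (simp only: negligible_iff_null_sets AE_iff_null_sets)
    with ne show False
      using open_not_negligible[OF open_Int[OF U(1) open_box]] by metis
  qed
qed

section \<open>Differential operators\<close>

definition partial :: "'a::euclidean_space \<Rightarrow> ('a \<Rightarrow> 'b::real_normed_vector) \<Rightarrow> 'a \<Rightarrow> 'b" where
  "partial b u x = frechet_derivative u (at x) b"

definition grad :: "('a::euclidean_space \<Rightarrow> real) \<Rightarrow> 'a \<Rightarrow> 'a" where
  "grad u x = (\<Sum>b\<in>Basis. partial b u x *\<^sub>R b)"

definition divergence :: "('a::euclidean_space \<Rightarrow> 'a) \<Rightarrow> 'a \<Rightarrow> real" where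
  "divergence F x = (\<Sum>b\<in>Basis. partial b F x \<bullet> b)"

definition laplacian :: "('a::euclidean_space \<Rightarrow> real) \<Rightarrow> 'a \<Rightarrow> real" where
  "laplacian u x = (\<Sum>b\<in>Basis. partial b (partial b u) x)"

section \<open>The magnetic potential\<close>

text \<open>The area of the unit sphere is the dimension times the volume of the unit ball.\<close>

definition newton_kernel :: "'a::euclidean_space \<Rightarrow> real" where
  "newton_kernel x =
     norm x powr (2 - real DIM('a)) /
     ((real DIM('a) - 2) * (real DIM('a) * unit_ball_vol (real DIM('a))))"

text \<open>Considered only at points \<open>x\<close> outside \<^term>\<open>ess_supp f\<close>.\<close>

definition magnetic_potential :: "('a::euclidean_space \<Rightarrow> 'a) \<Rightarrow> 'a \<Rightarrow> real" where
  "magnetic_potential f x = (LINT y:ess_supp f|lebesgue. grad newton_kernel (x - y) \<bullet> f y)"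

section \<open>Lipschitz domains\<close>

text \<open>
  Near each boundary point, in the rigidly moved coordinates \<open>z = A y + c\<close>, the domain is the part
  above the graph \<open>z\<^sub>e = \<phi>(z')\<close>, where \<open>z'\<close> is the projection of \<open>z\<close> to the coordinate hyperplane
  orthogonal to \<open>e\<close>.
\<close>

definition lipschitz_domain :: "'a::euclidean_space set \<Rightarrow> bool" where
  "lipschitz_domain \<Omega> \<longleftrightarrow>
     open \<Omega> \<and> connected \<Omega> \<and> compact (frontier \<Omega>) \<and>
     (\<forall>x\<in>frontier \<Omega>. \<exists>U A c e \<phi> L.
        open U \<and> x \<in> U \<and> orthogonal_transformation A \<and> e \<in> Basis \<and>
        L-lipschitz_on {z. z \<bullet> e = 0} (\<phi> :: 'a \<Rightarrow> real) \<and>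
        (\<forall>y\<in>U. y \<in> \<Omega> \<longleftrightarrow>
           (let z = A y + c in \<phi> (z - (z \<bullet> e) *\<^sub>R e) < z \<bullet> e)))"

section \<open>Function spaces\<close>

text \<open>
  Elements of the spaces below are everywhere defined representatives; only their values on \<open>\<Omega>\<close> matter,
  and apart from harmonic functions and test functions only up to null sets.
\<close>

definition L2 :: "'a::euclidean_space set \<Rightarrow> ('a \<Rightarrow> 'b::euclidean_space) set" where
  "L2 \<Omega> = {u. set_borel_measurable lebesgue \<Omega> u \<and>
              set_integrable lebesgue \<Omega> (\<lambda>x. (norm (u x))\<^sup>2)}"

definition L2_tendsto ::
  "'a::euclidean_space set \<Rightarrow> (nat \<Rightarrow> 'a \<Rightarrow> 'b::euclidean_space) \<Rightarrow> ('a \<Rightarrow> 'b) \<Rightarrow> bool" where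
  "L2_tendsto \<Omega> u v \<longleftrightarrow> (\<lambda>n. LINT x:\<Omega>|lebesgue. (norm (u n x - v x))\<^sup>2) \<longlonglongrightarrow> 0"

definition smooth :: "('a::euclidean_space \<Rightarrow> 'b::real_normed_vector) \<Rightarrow> bool" where
  "smooth \<phi> \<longleftrightarrow> (\<forall>bs\<in>lists Basis. foldr partial bs \<phi> differentiable_on UNIV)"

definition test_functions ::
  "'a::euclidean_space set \<Rightarrow> ('a \<Rightarrow> 'b::real_normed_vector) set" where
  "test_functions \<Omega> =
     {\<phi>. smooth \<phi> \<and> compact (closure {x. \<phi> x \<noteq> 0}) \<and> closure {x. \<phi> x \<noteq> 0} \<subseteq> \<Omega>}"

definition weak_gradient ::
  "'a::euclidean_space set \<Rightarrow> ('a \<Rightarrow> real) \<Rightarrow> ('a \<Rightarrow> 'a) \<Rightarrow> bool" where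
  "weak_gradient \<Omega> u G \<longleftrightarrow>
     (\<forall>\<phi>\<in>test_functions \<Omega>. \<forall>b\<in>Basis.
        (LINT x:\<Omega>|lebesgue. u x * partial b \<phi> x) = - (LINT x:\<Omega>|lebesgue. (G x \<bullet> b) * \<phi> x))"

definition H1 :: "'a::euclidean_space set \<Rightarrow> ('a \<Rightarrow> real) set" where
  "H1 \<Omega> = {u \<in> L2 \<Omega>. \<exists>G\<in>L2 \<Omega>. weak_gradient \<Omega> u G}"

text \<open>The \<open>H\<^sup>1\<close>-closure of the test functions.\<close>

definition H1_0 :: "'a::euclidean_space set \<Rightarrow> ('a \<Rightarrow> real) set" where
  "H1_0 \<Omega> =
     {u \<in> L2 \<Omega>. \<exists>G\<in>L2 \<Omega>. weak_gradient \<Omega> u G \<and>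
        (\<exists>\<phi>. range \<phi> \<subseteq> test_functions \<Omega> \<and>
             L2_tendsto \<Omega> \<phi> u \<and> L2_tendsto \<Omega> (\<lambda>n. grad (\<phi> n)) G)}"

definition harmonic_on :: "'a::euclidean_space set \<Rightarrow> ('a \<Rightarrow> real) \<Rightarrow> bool" where
  "harmonic_on \<Omega> u \<longleftrightarrow>
     (\<forall>x\<in>\<Omega>. u differentiable at x) \<and>
     (\<forall>b\<in>Basis. \<forall>x\<in>\<Omega>. partial b u differentiable at x) \<and>
     (\<forall>b\<in>Basis. \<forall>c\<in>Basis. continuous_on \<Omega> (partial c (partial b u))) \<and>
     (\<forall>x\<in>\<Omega>. laplacian u x = 0)"

definition harmonic_H1 :: "'a::euclidean_space set \<Rightarrow> ('a \<Rightarrow> real) set" where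
  "harmonic_H1 \<Omega> = {u \<in> H1 \<Omega>. harmonic_on \<Omega> u}"

definition gradients ::
  "'a::euclidean_space set \<Rightarrow> ('a \<Rightarrow> real) set \<Rightarrow> ('a \<Rightarrow> 'a) set" where
  "gradients \<Omega> S = {G \<in> L2 \<Omega>. \<exists>u\<in>S. weak_gradient \<Omega> u G}"

definition H_div_0 :: "'a::euclidean_space set \<Rightarrow> ('a \<Rightarrow> 'a) set" where
  "H_div_0 \<Omega> =
     {w \<in> L2 \<Omega>. \<exists>\<phi>. range \<phi> \<subseteq> test_functions \<Omega> \<and>
        (\<forall>n x. divergence (\<phi> n) x = 0) \<and> L2_tendsto \<Omega> \<phi> w}"

text \<open>
  \<open>g\<close>, \<open>h\<close>, \<open>w\<close> are the components of \<open>f\<close> in the orthogonal direct sum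
  \<open>\<nabla>H\<^sup>1\<^sub>0 \<oplus> \<nabla>\<H> \<oplus> H\<^sub>d\<^sub>i\<^sub>v\<^sub>,\<^sub>0\<close>; they are determined up to null sets.
\<close>

definition helmholtz_hodge_decomposition ::
  "'a::euclidean_space set \<Rightarrow> ('a \<Rightarrow> 'a) \<Rightarrow> ('a \<Rightarrow> 'a) \<Rightarrow> ('a \<Rightarrow> 'a) \<Rightarrow> ('a \<Rightarrow> 'a) \<Rightarrow> bool" where
  "helmholtz_hodge_decomposition \<Omega> f g h w \<longleftrightarrow>
     g \<in> gradients \<Omega> (H1_0 \<Omega>) \<and> h \<in> gradients \<Omega> (harmonic_H1 \<Omega>) \<and> w \<in> H_div_0 \<Omega> \<and>
     (AE x in lebesgue. x \<in> \<Omega> \<longrightarrow> f x = g x + h x + w x)"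

end

theory Submission
  imports Defs
begin

text \<open>
  Test the field against the gradients of the harmonic exponentials \<open>y \<mapsto> exp (\<zeta> \<cdot> y)\<close>, where
  \<open>\<zeta> = a + i b\<close> with real \<open>a \<bottom> b\<close> of equal length, so that \<open>\<zeta> \<cdot> \<zeta> = 0\<close>. Such a test is a moment
  \<open>\<integral> (\<zeta> \<cdot> f(y)) exp (\<zeta> \<cdot> y) dy\<close>, and the proof has two halves: a box-simple field all of whose moments
  vanish is zero, and the negation of either conclusion makes all moments vanish.

  For the first half, the integral of an exponential over a box is, up to the common factor
  \<open>1 / \<Prod>\<^sub>k \<zeta>\<^sub>k\<close>, an alternating sum over the vertices of the box. Collecting equal vertices turns the
  moment into \<open>\<Sum>\<^sub>p (\<zeta> \<cdot> c\<^sub>p) exp (\<zeta> \<cdot> p)\<close>. For a generic direction \<open>a\<close> the numbers \<open>a \<cdot> p\<close> are pairwise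
  different; replacing \<open>\<zeta>\<close> by \<open>t \<zeta>\<close> with \<open>t \<rightarrow> \<infinity>\<close> separates the terms by their growth, hence
  \<open>\<zeta> \<cdot> c\<^sub>p = 0\<close> for every \<open>p\<close>. As \<open>b\<close> may be any vector orthogonal to \<open>a\<close> of the right length, \<open>c\<^sub>p = 0\<close>.
  The same vertex expansion writes the field almost everywhere as a combination of indicators of
  orthants with corners \<open>p\<close> and coefficients \<open>c\<^sub>p\<close>, so the field is zero
  (\<open>box_field_eq_0_if_exp_moments_0\<close>).

  For the second half, suppose first that the potential vanishes off the support. Multiply the
  exponential by a cutoff that is 1 on a large ball. The Laplacian \<open>L\<close> of the product lives far away
  from the support, and Green's identity represents the gradient of the exponential on the support as
  a superposition of the dipole kernels \<open>\<nabla>N(x - \<cdot>)\<close> with density \<open>L(x)\<close>. Integrating against the field and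
  exchanging the integrals expresses the moment through values of the potential at points \<open>x\<close> far away,
  all of which are zero (\<open>exp_moment_eq_0_if_potential_eq_0\<close>). The singularity of the kernel is smoothed
  near the origin; this changes the representation only by a scalar factor, since exponentials are
  eigenfunctions of every convolution, and the factor is nonzero.

  If instead the harmonic component vanishes, then the field is a sum of an \<open>L\<^sup>2\<close> limit of gradients of
  test functions and an \<open>L\<^sup>2\<close> limit of divergence-free test fields. Integration by parts shows that both
  are orthogonal to the gradient of every smooth function that is harmonic on the whole space
  (\<open>integral_grad_harmonic_eq_0_if_no_harmonic_component\<close>), in particular to those of the real and
  imaginary parts of the exponentials.
\<close>

section \<open>Directional derivatives and integration by parts\<close>

text \<open>
  Only one direction at a time enters the integrations by parts, so differentiability along lines is
  enough; this reduces all derivative computations to one real variable.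
\<close>

definition has_dir_deriv ::
  "'a::real_normed_vector \<Rightarrow> ('a \<Rightarrow> 'b::real_normed_vector) \<Rightarrow> ('a \<Rightarrow> 'b) \<Rightarrow> bool" where
  "has_dir_deriv c F D \<longleftrightarrow> (\<forall>x. ((\<lambda>t. F (x + t *\<^sub>R c)) has_vector_derivative D x) (at 0))"

lemma has_dir_derivD:
  assumes "has_dir_deriv c F D"
  shows "((\<lambda>t. F (x + t *\<^sub>R c)) has_vector_derivative D (x + s *\<^sub>R c)) (at s within S)"
proof -
  have "((\<lambda>t. F ((x + s *\<^sub>R c) + t *\<^sub>R c)) has_vector_derivative D (x + s *\<^sub>R c)) (at (s - s))"
    using assms by (simp add: has_dir_deriv_def)
  then have "(((\<lambda>t. F ((x + s *\<^sub>R c) + t *\<^sub>R c)) \<circ> (\<lambda>t. t - s)) has_vector_derivative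
      1 *\<^sub>R D (x + s *\<^sub>R c)) (at s)"
    by (intro vector_diff_chain_at) (auto intro!: derivative_eq_intros)
  then show ?thesis
    by (auto simp: o_def algebra_simps intro: has_vector_derivative_at_within)
qed

lemma integrable_continuous_bounded_support:
  fixes F :: "'a::euclidean_space \<Rightarrow> 'b::euclidean_space"
  assumes "continuous_on UNIV F" and "\<And>x. norm x > r \<Longrightarrow> F x = 0"
  shows "integrable lborel F"
proof -
  have "integrable lborel (\<lambda>x. indicator (cball 0 r) x *\<^sub>R F x)"
    using assms(1) by (intro borel_integrable_compact) (auto intro: continuous_on_subset)
  also have "(\<lambda>x. indicator (cball 0 r) x *\<^sub>R F x) = F"
    using assms(2) by (auto simp: indicator_def fun_eq_iff not_le)
  finally show ?thesis .
qed

lemma continuous_bounded_support_bound: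
  fixes F :: "'a::euclidean_space \<Rightarrow> 'b::real_normed_vector"
  assumes "continuous_on UNIV F" and "\<And>x. norm x > r \<Longrightarrow> F x = 0"
  obtains B where "B > 0" "\<And>x. norm (F x) \<le> B"
proof -
  have "compact (F ` cball 0 r)"
    using assms(1) by (intro compact_continuous_image) (auto intro: continuous_on_subset)
  then have "bounded (F ` cball 0 r)" by (rule compact_imp_bounded)
  then obtain B where B: "B > 0" "\<forall>y\<in>F ` cball 0 r. norm y \<le> B"
    unfolding bounded_pos by blast
  have "norm (F x) \<le> B" for x
  proof (cases "norm x \<le> r")
    case True
    then show ?thesis using B(2) by simp
  next
    case False
    then show ?thesis using B(1) assms(2)[of x] by simp
  qed
  with B(1) show ?thesis using that by blast
qed

lemma has_dir_deriv_eq_0_outside: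
  fixes F D :: "'a::real_normed_vector \<Rightarrow> 'b::real_normed_vector"
  assumes d: "has_dir_deriv c F D" and supp: "\<And>x. norm x > r \<Longrightarrow> F x = 0" and x: "norm x > r"
  shows "D x = 0"
proof -
  have "((\<lambda>t. norm (x + t *\<^sub>R c)) \<longlongrightarrow> norm (x + 0 *\<^sub>R c)) (at 0)"
    by (intro tendsto_intros)
  then have "\<forall>\<^sub>F t in at 0. norm (x + t *\<^sub>R c) > r"
    using x by (intro order_tendstoD) auto
  then have ev: "\<forall>\<^sub>F t in nhds 0. F (x + t *\<^sub>R c) = 0"
    unfolding eventually_nhds_conv_at using supp x by (auto elim!: eventually_mono)
  have "((\<lambda>t. F (x + t *\<^sub>R c)) has_vector_derivative D x) (at 0)"
    using d by (simp add: has_dir_deriv_def)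
  then have "((\<lambda>t. 0) has_vector_derivative D x) (at (0::real))"
    by (rule has_vector_derivative_cong_ev[THEN iffD1, rotated 2]) (use ev supp[OF x] in auto)
  then show ?thesis
    by (rule vector_derivative_unique_at[OF _ has_vector_derivative_const])
qed

text \<open>
  By translation invariance the difference quotients of \<open>F\<close> in direction \<open>c\<close> have integral zero. They
  are bounded, because \<open>F\<close> is Lipschitz along \<open>c\<close>, and live on a common ball, so dominated convergence
  applies.
\<close>

lemma integral_dir_deriv_eq_0:
  fixes F D :: "'a::euclidean_space \<Rightarrow> 'b::euclidean_space"
  assumes d: "has_dir_deriv c F D" and F: "continuous_on UNIV F" and D: "continuous_on UNIV D"
    and supp: "\<And>x. norm x > r \<Longrightarrow> F x = 0"
  shows "(LINT x|lborel. D x) = 0"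
proof -
  have suppD: "D x = 0" if "norm x > r" for x
    by (rule has_dir_deriv_eq_0_outside[OF d supp that])
  obtain B where B: "B > 0" "\<And>x. norm (D x) \<le> B"
    using continuous_bounded_support_bound[OF D suppD] by blast
  have intF: "integrable lborel F"
    by (rule integrable_continuous_bounded_support[OF F supp])
  define t where "t = (\<lambda>n::nat. 1 / real (Suc n))"
  have t: "0 < t n" "t n \<le> 1" for n by (auto simp: t_def)
  have t0: "t \<longlonglongrightarrow> 0" unfolding t_def by (rule LIMSEQ_Suc[OF lim_1_over_n])
  define s where "s = (\<lambda>n x. (1 / t n) *\<^sub>R (F (x + t n *\<^sub>R c) - F x))"
  have lip: "norm (F (x + h *\<^sub>R c) - F x) \<le> B * h" if "h > 0" for x h
  proof -
    have "norm ((\<lambda>t. F (x + t *\<^sub>R c)) h - (\<lambda>t. F (x + t *\<^sub>R c)) 0) \<le> B * norm (h - 0)"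
    proof (rule differentiable_bound[where S="{0..h}" and f'="\<lambda>\<tau> k. k *\<^sub>R D (x + \<tau> *\<^sub>R c)"])
      fix \<tau> show "((\<lambda>t. F (x + t *\<^sub>R c)) has_derivative (\<lambda>k. k *\<^sub>R D (x + \<tau> *\<^sub>R c))) (at \<tau> within {0..h})"
        using has_dir_derivD[OF d, of x \<tau>] by (simp add: has_vector_derivative_def)
      show "onorm (\<lambda>k. k *\<^sub>R D (x + \<tau> *\<^sub>R c)) \<le> B"
      proof (rule onorm_bound)
        show "norm (k *\<^sub>R D (x + \<tau> *\<^sub>R c)) \<le> B * norm k" for k :: real
          using mult_left_mono[OF B(2), of "\<bar>k\<bar>" "x + \<tau> *\<^sub>R c"] by (simp add: mult.commute)
      qed (use B(1) in simp)
    qed (use that in auto)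
    then show ?thesis using that by simp
  qed
  have cont_s: "continuous_on UNIV (s n)" for n
    unfolding s_def using F
    by (intro continuous_intros continuous_on_compose2[OF F]) auto
  have "(\<lambda>n. LINT x|lborel. s n x) \<longlonglongrightarrow> (LINT x|lborel. D x)"
  proof (rule integral_dominated_convergence[where w="\<lambda>x. B * indicator (cball 0 (r + norm c)) x"])
    show "integrable lborel (\<lambda>x. B * indicator (cball 0 (r + norm c)) x)"
      using emeasure_bounded_finite[OF bounded_cball, of 0 "r + norm c"]
      by (intro integrable_mult_right integrable_real_indicator) simp_all
    show "AE x in lborel. (\<lambda>n. s n x) \<longlonglongrightarrow> D x"
    proof (rule AE_I2)
      fix x
      have "((\<lambda>h. norm (F (x + h *\<^sub>R c) - F x - h *\<^sub>R D x) / norm h) \<longlongrightarrow> 0) (at 0)"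
        using d unfolding has_dir_deriv_def has_vector_derivative_def has_derivative_at by simp
      then have "((\<lambda>h. norm ((1 / h) *\<^sub>R (F (x + h *\<^sub>R c) - F x) - D x)) \<longlongrightarrow> 0) (at 0)"
      proof (rule Lim_transform_eventually)
        have "norm (F (x + h *\<^sub>R c) - F x - h *\<^sub>R D x) / norm h =
            norm ((1 / h) *\<^sub>R (F (x + h *\<^sub>R c) - F x) - D x)" if "h \<noteq> 0" for h
        proof -
          have "norm ((1 / h) *\<^sub>R (F (x + h *\<^sub>R c) - F x - h *\<^sub>R D x)) =
              norm (F (x + h *\<^sub>R c) - F x - h *\<^sub>R D x) / norm h"
            by simp
          then show ?thesis using that by (simp only: scaleR_diff_right) simp
        qed
        then show "\<forall>\<^sub>F h in at 0. norm (F (x + h *\<^sub>R c) - F x - h *\<^sub>R D x) / norm h =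
            norm ((1 / h) *\<^sub>R (F (x + h *\<^sub>R c) - F x) - D x)"
          by (auto simp: eventually_at intro!: exI[of _ 1])
      qed
      then have "((\<lambda>h. (1 / h) *\<^sub>R (F (x + h *\<^sub>R c) - F x)) \<longlongrightarrow> D x) (at 0)"
        by (simp add: tendsto_iff dist_norm)
      then have "(\<lambda>n. (1 / t n) *\<^sub>R (F (x + t n *\<^sub>R c) - F x)) \<longlonglongrightarrow> D x"
        by (rule filterlim_compose) (use t0 t(1) in \<open>simp add: filterlim_at less_imp_neq[symmetric]\<close>)
      then show "(\<lambda>n. s n x) \<longlonglongrightarrow> D x" by (simp add: s_def)
    qed
    show "AE x in lborel. norm (s n x) \<le> B * indicator (cball 0 (r + norm c)) x" for n
    proof (rule AE_I2)
      fix x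
      show "norm (s n x) \<le> B * indicator (cball 0 (r + norm c)) x"
      proof (cases "norm x \<le> r + norm c")
        case True
        have "norm (F (x + t n *\<^sub>R c) - F x) / t n \<le> B"
          using lip[OF t(1)] t(1) by (simp add: pos_divide_le_eq)
        then show ?thesis using True t(1)[of n] by (simp add: s_def)
      next
        case False
        have "norm (t n *\<^sub>R c) \<le> norm c" using t[of n] by (simp add: mult_left_le_one_le)
        moreover have "norm x \<le> norm (x + t n *\<^sub>R c) + norm (t n *\<^sub>R c)"
          by (metis add_diff_cancel_right' norm_triangle_ineq4)
        ultimately have "norm (x + t n *\<^sub>R c) > r" "norm x > r" using False norm_ge_zero[of c] by linarith+
        then show ?thesis using supp False by (simp add: s_def)
      qed
    qed
  qed (simp_all add: borel_measurable_continuous_onI[OF cont_s] borel_measurable_continuous_onI[OF D])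
  moreover have "(LINT x|lborel. s n x) = 0" for n
  proof -
    have distr: "distr lborel borel (\<lambda>x. x + t n *\<^sub>R c) = lborel"
      using lborel_distr_plus[of "t n *\<^sub>R c"] by (subst add.commute) simp
    have Fm: "F \<in> borel_measurable borel" using F by (rule borel_measurable_continuous_onI)
    have "integrable lborel (\<lambda>x. F (x + t n *\<^sub>R c))"
      using integrable_distr_eq[of "\<lambda>x. x + t n *\<^sub>R c" lborel borel F] Fm distr intF by simp
    moreover have "(LINT x|lborel. F (x + t n *\<^sub>R c)) = (LINT x|lborel. F x)"
      using integral_distr[of "\<lambda>x. x + t n *\<^sub>R c" lborel borel F] Fm distr by simp
    ultimately show ?thesis using intF by (simp add: s_def)
  qed
  ultimately show ?thesis by (simp add: LIMSEQ_const_iff)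
qed

section \<open>Exponential moments of box fields\<close>

definition vertex :: "'a::euclidean_space \<Rightarrow> 'a \<Rightarrow> 'a set \<Rightarrow> 'a" where
  "vertex l u S = (\<Sum>k\<in>Basis. (if k \<in> S then u \<bullet> k else l \<bullet> k) *\<^sub>R k)"

text \<open>
  With \<open>E k s\<close> an antiderivative of an exponential this evaluates integrals over boxes; with \<open>E k s\<close>
  the indicator of \<open>y \<bullet> k < s\<close> it evaluates the indicator function of a box.
\<close>

lemma prod_diff_vertices:
  fixes E :: "'a::euclidean_space \<Rightarrow> real \<Rightarrow> 'c::comm_ring_1"
  shows "(\<Prod>k\<in>Basis. E k (u \<bullet> k) - E k (l \<bullet> k)) =
    (\<Sum>S\<in>Pow Basis. (-1) ^ card (Basis - S) * (\<Prod>k\<in>Basis. E k (vertex l u S \<bullet> k)))"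
proof -
  have "(\<Prod>k\<in>Basis. E k (u \<bullet> k) - E k (l \<bullet> k)) = (\<Prod>k\<in>Basis. E k (u \<bullet> k) + (-1) * E k (l \<bullet> k))"
    by simp
  also have "\<dots> = (\<Sum>S\<in>Pow Basis. (\<Prod>k\<in>S. E k (u \<bullet> k)) * (\<Prod>k\<in>Basis - S. (-1) * E k (l \<bullet> k)))"
    by (rule prod_add) simp
  also have "\<dots> = (\<Sum>S\<in>Pow Basis. (-1) ^ card (Basis - S) * (\<Prod>k\<in>Basis. E k (vertex l u S \<bullet> k)))"
  proof (rule sum.cong[OF refl])
    fix S :: "'a set" assume S: "S \<in> Pow Basis"
    have "(\<Prod>k\<in>Basis. E k (vertex l u S \<bullet> k)) =
        (\<Prod>k\<in>Basis. if k \<in> S then E k (u \<bullet> k) else E k (l \<bullet> k))"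
      by (intro prod.cong) (auto simp: vertex_def)
    also have "\<dots> = (\<Prod>k\<in>S. E k (u \<bullet> k)) * (\<Prod>k\<in>Basis - S. E k (l \<bullet> k))"
      using S by (subst prod.If_cases) (auto simp: Int_absorb1 Diff_eq)
    finally show "(\<Prod>k\<in>S. E k (u \<bullet> k)) * (\<Prod>k\<in>Basis - S. (-1) * E k (l \<bullet> k)) =
        (-1) ^ card (Basis - S) * (\<Prod>k\<in>Basis. E k (vertex l u S \<bullet> k))"
      by (simp add: prod.distrib mult_ac del: mult_minus1 mult_minus1_right mult_minus_left mult_minus_right)
  qed
  finally show ?thesis .
qed

definition grid_vertices :: "nat \<Rightarrow> (nat \<Rightarrow> 'a::euclidean_space) \<Rightarrow> (nat \<Rightarrow> 'a) \<Rightarrow> 'a set" where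
  "grid_vertices N l u = (\<lambda>(i, S). vertex (l i) (u i) S) ` ({..<N} \<times> Pow Basis)"

text \<open>
  Several boxes may share a vertex. The coefficient collects all their signed contributions; the
  exponents in the exponential sums below are then pairwise different.
\<close>

definition vertex_coeff ::
  "nat \<Rightarrow> (nat \<Rightarrow> 'a::euclidean_space) \<Rightarrow> (nat \<Rightarrow> 'a) \<Rightarrow> (nat \<Rightarrow> 'a) \<Rightarrow> 'a \<Rightarrow> 'a" where
  "vertex_coeff N v l u p =
     (\<Sum>(i, S)\<in>{j \<in> {..<N} \<times> Pow Basis. (\<lambda>(i, S). vertex (l i) (u i) S) j = p}.
        (-1) ^ card (Basis - S) *\<^sub>R v i)"

lemma finite_grid_vertices: "finite (grid_vertices N l u)"
  by (simp add: grid_vertices_def)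

text \<open>
  The map \<open>V\<close> is \<open>\<zeta> \<cdot> _\<close> for the exponential moments and a coordinate for the values of the field.
  Both expansions thus have the same coefficients, which is what transfers their vanishing from the
  moments to the field.
\<close>

lemma sum_boxes_eq_sum_vertices:
  fixes v l u :: "nat \<Rightarrow> 'a::euclidean_space" and N :: nat
    and V :: "'a \<Rightarrow> 'c::{comm_ring_1,real_algebra_1}"
  assumes V: "linear V"
  shows "(\<Sum>i<N. V (v i) * (\<Prod>k\<in>Basis. E k (u i \<bullet> k) - E k (l i \<bullet> k))) =
    (\<Sum>p\<in>grid_vertices N l u. V (vertex_coeff N v l u p) * (\<Prod>k\<in>Basis. E k (p \<bullet> k)))"
proof -
  define J where "J = {..<N} \<times> Pow (Basis :: 'a set)"
  define P where "P = (\<lambda>(i, S). vertex (l i) (u i) S)"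
  define W where "W = (\<lambda>(i, S::'a set). (-1) ^ card (Basis - S) *\<^sub>R v i)"
  have J: "finite J" by (simp add: J_def)
  have sgn: "(-1) ^ m * x = ((-1) ^ m :: real) *\<^sub>R x" for m and x :: 'c
    by (cases "even m") auto
  have "(\<Sum>i<N. V (v i) * (\<Prod>k\<in>Basis. E k (u i \<bullet> k) - E k (l i \<bullet> k))) =
      (\<Sum>i<N. \<Sum>S\<in>Pow Basis. V (W (i, S)) * (\<Prod>k\<in>Basis. E k (P (i, S) \<bullet> k)))"
    unfolding prod_diff_vertices sum_distrib_left
    by (intro sum.cong refl) (simp add: W_def P_def linear_scale[OF V] sgn)
  also have "\<dots> = (\<Sum>j\<in>J. V (W j) * (\<Prod>k\<in>Basis. E k (P j \<bullet> k)))"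
    unfolding J_def by (simp add: sum.cartesian_product)
  also have "\<dots> = (\<Sum>p\<in>P ` J. \<Sum>j\<in>{j \<in> J. P j = p}. V (W j) * (\<Prod>k\<in>Basis. E k (P j \<bullet> k)))"
    using J by (rule sum.image_gen)
  also have "\<dots> = (\<Sum>p\<in>P ` J. V (vertex_coeff N v l u p) * (\<Prod>k\<in>Basis. E k (p \<bullet> k)))"
    unfolding vertex_coeff_def J_def[symmetric] P_def[symmetric] W_def[symmetric]
      linear_sum[OF V] sum_distrib_right by (intro sum.cong refl) auto
  finally show ?thesis
    by (simp add: grid_vertices_def J_def P_def)
qed

lemma lborel_integral_prod:
  fixes f :: "'a::euclidean_space \<Rightarrow> real \<Rightarrow> 'c::{real_normed_field,banach,second_countable_topology}"
  assumes f: "\<And>k. k \<in> Basis \<Longrightarrow> integrable lborel (f k)"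
  shows "integrable lborel (\<lambda>y. \<Prod>k\<in>Basis. f k (y \<bullet> k))"
    and "(LINT y|lborel. (\<Prod>k\<in>Basis. f k (y \<bullet> k))) = (\<Prod>k\<in>Basis. LINT t|lborel. f k t)"
proof -
  interpret product_sigma_finite "\<lambda>k::'a. lborel :: real measure"
    by unfold_locales
  let ?g = "\<lambda>x. \<Sum>k\<in>Basis. x k *\<^sub>R (k::'a)"
  have [measurable]: "f k \<in> borel_measurable borel" if "k \<in> Basis" for k
    using f[OF that] by auto
  have m: "(\<lambda>y::'a. \<Prod>k\<in>Basis. f k (y \<bullet> k)) \<in> borel_measurable borel"
    by measurable
  have g: "?g \<in> (\<Pi>\<^sub>M k\<in>(Basis::'a set). lborel) \<rightarrow>\<^sub>M borel"
    by measurable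
  have eq: "(\<Prod>k\<in>Basis. f k (?g x \<bullet> k)) = (\<Prod>k\<in>Basis. f k (x k))" for x
    by (intro prod.cong) auto
  show "integrable lborel (\<lambda>y. \<Prod>k\<in>Basis. f k (y \<bullet> k))"
    unfolding lborel_eq[where 'a='a] using product_integrable_prod[of Basis f] f
    by (subst integrable_distr_eq[OF g m]) (simp add: eq)
  show "(LINT y|lborel. (\<Prod>k\<in>Basis. f k (y \<bullet> k))) = (\<Prod>k\<in>Basis. LINT t|lborel. f k t)"
    unfolding lborel_eq[where 'a='a] using product_integral_prod[of Basis f] f
    by (subst integral_distr[OF g m]) (simp add: eq)
qed

lemma integral_exp_interval:
  fixes z :: complex and l u :: real
  assumes z: "z \<noteq> 0" and lu: "l \<le> u"
  shows "integrable lborel (\<lambda>t. indicator {l<..<u} t *\<^sub>R exp (z * of_real t))"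
    and "(LINT t|lborel. indicator {l<..<u} t *\<^sub>R exp (z * of_real t)) =
      exp (z * of_real u) / z - exp (z * of_real l) / z"
proof -
  have "has_bochner_integral lborel (\<lambda>t. indicator {l..u} t *\<^sub>R exp (z * of_real t))
      (exp (z * of_real u) / z - exp (z * of_real l) / z)"
  proof (rule has_bochner_integral_FTC_Icc[OF lu])
    fix t :: real
    have "((\<lambda>w. exp (z * w) / z) has_field_derivative exp (z * of_real t)) (at (of_real t))"
      using z by (auto intro!: derivative_eq_intros)
    from has_vector_derivative_real_field[OF this]
    show "((\<lambda>t. exp (z * of_real t) / z) has_vector_derivative exp (z * of_real t)) (at t within {l..u})"
      by (rule has_vector_derivative_at_within)
  qed (intro continuous_intros)
  moreover have "AE t in lborel. indicator {l..u} t *\<^sub>R exp (z * of_real t) =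
      indicator {l<..<u} t *\<^sub>R exp (z * of_real t)"
    using AE_lborel_singleton[of l] AE_lborel_singleton[of u]
    by eventually_elim (auto simp: indicator_def)
  ultimately have "has_bochner_integral lborel (\<lambda>t. indicator {l<..<u} t *\<^sub>R exp (z * of_real t))
      (exp (z * of_real u) / z - exp (z * of_real l) / z)"
    by (subst has_bochner_integral_cong_AE[symmetric]) (auto intro!: borel_measurable_continuous_onI continuous_intros borel_measurable_scaleR)
  then show "integrable lborel (\<lambda>t. indicator {l<..<u} t *\<^sub>R exp (z * of_real t))"
    "(LINT t|lborel. indicator {l<..<u} t *\<^sub>R exp (z * of_real t)) =
      exp (z * of_real u) / z - exp (z * of_real l) / z"
    by (auto simp: has_bochner_integral_iff)
qed

text \<open>
  Divide by the exponential with the largest growth rate among those with nonzero coefficient: as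
  \<open>t \<rightarrow> \<infinity>\<close>, all other terms disappear and its coefficient remains.
\<close>

lemma exp_sum_eq_0_imp_coeffs_0:
  fixes c \<alpha> :: "'p \<Rightarrow> complex"
  assumes fin: "finite \<Lambda>" and inj: "inj_on (\<lambda>p. Re (\<alpha> p)) \<Lambda>"
    and eq: "\<And>t::real. t > 0 \<Longrightarrow> (\<Sum>p\<in>\<Lambda>. c p * exp (of_real t * \<alpha> p)) = 0"
    and p: "p \<in> \<Lambda>"
  shows "c p = 0"
proof (rule ccontr)
  assume "c p \<noteq> 0"
  define L where "L = {p \<in> \<Lambda>. c p \<noteq> 0}"
  have L: "finite L" "L \<noteq> {}" using fin p \<open>c p \<noteq> 0\<close> by (auto simp: L_def)
  then obtain q where q: "q \<in> L" and "Re (\<alpha> q) = Max ((\<lambda>p. Re (\<alpha> p)) ` L)"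
    by (metis (mono_tags, lifting) Max_in empty_is_image finite_imageI imageE)
  then have qmax: "Re (\<alpha> p) \<le> Re (\<alpha> q)" if "p \<in> L" for p
    using L that by simp
  then have less: "Re (\<alpha> p) < Re (\<alpha> q)" if "p \<in> L" "p \<noteq> q" for p
    using that inj q by (force simp: L_def inj_on_def order.order_iff_strict)
  have "((\<lambda>t. \<Sum>p\<in>L. c p * exp (of_real t * (\<alpha> p - \<alpha> q))) \<longlongrightarrow> (\<Sum>p\<in>L. if p = q then c q else 0)) at_top"
  proof (rule tendsto_sum)
    fix p assume p: "p \<in> L"
    show "((\<lambda>t. c p * exp (of_real t * (\<alpha> p - \<alpha> q))) \<longlongrightarrow> (if p = q then c q else 0)) at_top"
    proof (cases "p = q")
      case False
      define r where "r = Re (\<alpha> q) - Re (\<alpha> p)"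
      have r: "r > 0" using less[OF p False] by (simp add: r_def)
      have "((\<lambda>t. exp (- (t * r))) \<longlongrightarrow> 0) at_top"
      proof (rule filterlim_compose[OF exp_at_bot])
        show "filterlim (\<lambda>t. - (t * r)) at_bot at_top"
          using r by (intro filterlim_uminus_at_bot_at_top[THEN filterlim_compose]
              filterlim_at_top_mult_tendsto_pos[OF tendsto_const _ filterlim_ident])
      qed
      then have "((\<lambda>t. norm (exp (of_real t * (\<alpha> p - \<alpha> q)))) \<longlongrightarrow> 0) at_top"
        by (simp add: r_def algebra_simps)
      then have "((\<lambda>t. c p * exp (of_real t * (\<alpha> p - \<alpha> q))) \<longlongrightarrow> c p * 0) at_top"
        by (rule tendsto_mult_left[OF tendsto_norm_zero_cancel])
      then show ?thesis using False by simp
    qed auto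
  qed
  moreover have "\<forall>\<^sub>F t in at_top. (\<Sum>p\<in>L. c p * exp (of_real t * (\<alpha> p - \<alpha> q))) = 0"
    using eventually_gt_at_top[of "0::real"]
  proof eventually_elim
    case (elim t)
    have "(\<Sum>p\<in>L. c p * exp (of_real t * (\<alpha> p - \<alpha> q))) =
        (\<Sum>p\<in>L. c p * exp (of_real t * \<alpha> p)) * exp (- (of_real t * \<alpha> q))"
      unfolding sum_distrib_right
      by (intro sum.cong refl) (simp add: right_diff_distrib exp_diff exp_minus field_simps)
    also have "(\<Sum>p\<in>L. c p * exp (of_real t * \<alpha> p)) = (\<Sum>p\<in>\<Lambda>. c p * exp (of_real t * \<alpha> p))"
      using fin by (intro sum.mono_neutral_left) (auto simp: L_def)
    finally show ?case using eq[OF elim] by simp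
  qed
  ultimately have "((\<lambda>t::real. 0) \<longlongrightarrow> (\<Sum>p\<in>L. if p = q then c q else 0)) at_top"
    by (rule Lim_transform_eventually)
  then have "(\<Sum>p\<in>L. if p = q then c q else 0) = 0"
    by (simp add: tendsto_const_iff)
  then show False using q L by (simp add: L_def)
qed

text \<open>
  Finitely many hyperplanes are a null set.
\<close>

lemma exists_not_orthogonal:
  fixes W :: "'a::euclidean_space set"
  assumes "finite W" "0 \<notin> W"
  obtains a where "\<And>w. w \<in> W \<Longrightarrow> a \<bullet> w \<noteq> 0"
proof -
  have "negligible (\<Union>w\<in>W. {a. w \<bullet> a = 0})"
    using assms by (intro negligible_Union) (auto intro!: negligible_hyperplane)
  then have "(\<Union>w\<in>W. {a. w \<bullet> a = 0}) \<noteq> UNIV"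
    using non_negligible_UNIV by metis
  then obtain a where "a \<notin> (\<Union>w\<in>W. {a. w \<bullet> a = 0})" by blast
  then show ?thesis using that[of a] by (auto simp: inner_commute)
qed

text \<open>
  The complex linear form \<open>y \<mapsto> \<zeta> \<cdot> y\<close> with \<open>\<zeta> = a + i b\<close>, represented by its real and imaginary part.
  Its values on the basis are the components of \<open>\<zeta>\<close>.
\<close>

definition cform :: "'a::euclidean_space \<Rightarrow> 'a \<Rightarrow> 'a \<Rightarrow> complex" where
  "cform a b y = Complex (a \<bullet> y) (b \<bullet> y)"

lemma linear_cform: "linear (cform a b)"
  by (intro linearI) (auto simp: cform_def inner_simps complex_eq_iff)

lemma cform_expand: "cform a b y = (\<Sum>k\<in>Basis. of_real (y \<bullet> k) * cform a b k)"
proof -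
  have "cform a b (\<Sum>k\<in>Basis. (y \<bullet> k) *\<^sub>R k) = (\<Sum>k\<in>Basis. (y \<bullet> k) *\<^sub>R cform a b k)"
    by (simp add: linear_sum[OF linear_cform] linear_scale[OF linear_cform])
  then show ?thesis by (simp add: euclidean_representation scaleR_conv_of_real)
qed

lemma continuous_on_cform [continuous_intros]:
  "continuous_on S f \<Longrightarrow> continuous_on S (\<lambda>x. cform a b (f x))"
  unfolding cform_def Complex_eq by (intro continuous_intros)

definition box_field ::
  "nat \<Rightarrow> (nat \<Rightarrow> 'a::euclidean_space) \<Rightarrow> (nat \<Rightarrow> 'a) \<Rightarrow> (nat \<Rightarrow> 'a) \<Rightarrow> 'a \<Rightarrow> 'a" where
  "box_field N v l u y = (\<Sum>i<N. indicator (box (l i) (u i)) y *\<^sub>R v i)"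

lemma integral_exp_box:
  fixes l u :: "'a::euclidean_space"
  assumes lu: "\<And>k. k \<in> Basis \<Longrightarrow> l \<bullet> k \<le> u \<bullet> k"
    and nz: "\<And>k. k \<in> Basis \<Longrightarrow> cform a b k \<noteq> 0"
  defines "E \<equiv> \<lambda>k s. exp (cform a b k * of_real s) / cform a b k"
  shows "integrable lborel (\<lambda>y. indicator (box l u) y *\<^sub>R exp (cform a b y))"
    and "(LINT y|lborel. indicator (box l u) y *\<^sub>R exp (cform a b y)) =
      (\<Prod>k\<in>Basis. E k (u \<bullet> k) - E k (l \<bullet> k))"
proof -
  define f where "f = (\<lambda>k t. indicator {l \<bullet> k<..<u \<bullet> k} t *\<^sub>R exp (cform a b k * of_real t))"
  have eq: "indicator (box l u) y *\<^sub>R exp (cform a b y) = (\<Prod>k\<in>Basis. f k (y \<bullet> k))" for y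
  proof -
    have "(\<Prod>k\<in>Basis. f k (y \<bullet> k)) =
        (\<Prod>k\<in>Basis. indicator {l \<bullet> k<..<u \<bullet> k} (y \<bullet> k)) *\<^sub>R (\<Prod>k\<in>Basis. exp (cform a b k * of_real (y \<bullet> k)))"
      by (simp add: f_def scaleR_conv_of_real prod.distrib)
    also have "(\<Prod>k\<in>Basis. exp (cform a b k * of_real (y \<bullet> k))) = exp (cform a b y)"
      by (subst cform_expand[of a b y]) (simp add: exp_sum mult.commute)
    also have "(\<Prod>k\<in>Basis. indicator {l \<bullet> k<..<u \<bullet> k} (y \<bullet> k)) = (indicator (box l u) y :: real)"
    proof (cases "y \<in> box l u")
      case True
      then show ?thesis by (auto simp: box_def intro!: prod.neutral)
    next
      case False
      then obtain k where "k \<in> Basis" "y \<bullet> k \<notin> {l \<bullet> k<..<u \<bullet> k}" by (auto simp: box_def)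
      then have "\<exists>k\<in>Basis. indicator {l \<bullet> k<..<u \<bullet> k} (y \<bullet> k) = (0::real)"
        by (intro bexI[of _ k]) auto
      then show ?thesis using False by (simp add: prod_zero)
    qed
    finally show ?thesis by simp
  qed
  have int: "integrable lborel (f k)" if "k \<in> Basis" for k
    unfolding f_def by (rule integral_exp_interval) (use lu nz that in auto)
  show "integrable lborel (\<lambda>y. indicator (box l u) y *\<^sub>R exp (cform a b y))"
    unfolding eq by (rule lborel_integral_prod) (rule int)
  have "(LINT y|lborel. indicator (box l u) y *\<^sub>R exp (cform a b y)) = (\<Prod>k\<in>Basis. LINT t|lborel. f k t)"
    unfolding eq by (rule lborel_integral_prod) (rule int)
  also have "\<dots> = (\<Prod>k\<in>Basis. E k (u \<bullet> k) - E k (l \<bullet> k))"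
    unfolding f_def E_def by (intro prod.cong refl integral_exp_interval) (use lu nz in auto)
  finally show "(LINT y|lborel. indicator (box l u) y *\<^sub>R exp (cform a b y)) =
      (\<Prod>k\<in>Basis. E k (u \<bullet> k) - E k (l \<bullet> k))" .
qed

lemma integral_box_field_exp:
  fixes v l u :: "nat \<Rightarrow> 'a::euclidean_space"
  assumes lu: "\<And>i k. i < N \<Longrightarrow> k \<in> Basis \<Longrightarrow> l i \<bullet> k \<le> u i \<bullet> k"
    and nz: "\<And>k. k \<in> Basis \<Longrightarrow> cform a b k \<noteq> 0"
  shows "(LINT y|lborel. cform a b (box_field N v l u y) * exp (cform a b y)) =
    (\<Sum>p\<in>grid_vertices N l u. cform a b (vertex_coeff N v l u p) * exp (cform a b p)) /
      (\<Prod>k\<in>Basis. cform a b k)"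
proof -
  let ?Z = "cform a b"
  define E where "E = (\<lambda>k s. exp (?Z k * of_real s) / ?Z k)"
  have "?Z (box_field N v l u y) * exp (?Z y) =
      (\<Sum>i<N. ?Z (v i) * (indicator (box (l i) (u i)) y *\<^sub>R exp (?Z y)))" for y
    unfolding box_field_def linear_sum[OF linear_cform] linear_scale[OF linear_cform] sum_distrib_right
    by (intro sum.cong) (auto simp: scaleR_conv_of_real)
  note eq = this
  have "(LINT y|lborel. ?Z (box_field N v l u y) * exp (?Z y)) =
      (\<Sum>i<N. ?Z (v i) * (\<Prod>k\<in>Basis. E k (u i \<bullet> k) - E k (l i \<bullet> k)))"
  proof -
    have "(LINT y|lborel. ?Z (box_field N v l u y) * exp (?Z y)) =
        (\<Sum>i<N. LINT y|lborel. ?Z (v i) * (indicator (box (l i) (u i)) y *\<^sub>R exp (?Z y)))"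
      unfolding eq using integral_exp_box(1)[OF lu nz]
      by (intro Bochner_Integration.integral_sum integrable_mult_right) auto
    also have "\<dots> = (\<Sum>i<N. ?Z (v i) * (\<Prod>k\<in>Basis. E k (u i \<bullet> k) - E k (l i \<bullet> k)))"
      unfolding E_def using integral_exp_box(2)[OF lu nz]
      by (intro sum.cong refl) (simp only: integral_mult_right_zero lessThan_iff)
    finally show ?thesis .
  qed
  also have "\<dots> = (\<Sum>p\<in>grid_vertices N l u. ?Z (vertex_coeff N v l u p) * (\<Prod>k\<in>Basis. E k (p \<bullet> k)))"
    by (rule sum_boxes_eq_sum_vertices[OF linear_cform])
  also have "\<dots> = (\<Sum>p\<in>grid_vertices N l u. ?Z (vertex_coeff N v l u p) * (exp (?Z p) / (\<Prod>k\<in>Basis. ?Z k)))"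
  proof (intro sum.cong refl arg_cong2[where f="(*)"])
    fix p
    have "(\<Prod>k\<in>Basis. exp (?Z k * of_real (p \<bullet> k))) = exp (?Z p)"
      by (subst cform_expand[of a b p]) (simp add: exp_sum mult.commute)
    then show "(\<Prod>k\<in>Basis. E k (p \<bullet> k)) = exp (?Z p) / (\<Prod>k\<in>Basis. ?Z k)"
      by (simp add: E_def prod_dividef)
  qed
  finally show ?thesis by (simp add: sum_divide_distrib)
qed

text \<open>
  Off the null set of points that share a coordinate with a lower corner, the indicator of
  \<open>l \<bullet> k < y \<bullet> k < u \<bullet> k\<close> is the difference of the indicators of \<open>y \<bullet> k < u \<bullet> k\<close> and of
  \<open>y \<bullet> k < l \<bullet> k\<close>.
\<close>

lemma box_field_eq_sum_vertices:
  fixes v l u :: "nat \<Rightarrow> 'a::euclidean_space"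
  assumes lu: "\<And>i k. i < N \<Longrightarrow> k \<in> Basis \<Longrightarrow> l i \<bullet> k \<le> u i \<bullet> k"
  shows "AE y in lborel. box_field N v l u y =
    (\<Sum>p\<in>grid_vertices N l u. (\<Prod>k\<in>Basis. if y \<bullet> k < p \<bullet> k then 1 else 0) *\<^sub>R vertex_coeff N v l u p)"
proof -
  have "AE y in lborel. \<forall>i\<in>{..<N}. \<forall>k\<in>Basis. y \<bullet> k \<noteq> l i \<bullet> k"
  proof (intro AE_finite_allI)
    fix i k assume k: "k \<in> (Basis :: 'a set)"
    have "negligible {y. k \<bullet> y = l i \<bullet> k}"
      using k by (intro negligible_hyperplane) auto
    then have "AE y in lebesgue. \<not> (k \<bullet> y = l i \<bullet> k)"
      unfolding negligible_iff_null_sets by (auto dest: AE_not_in)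
    then show "AE y in lborel. y \<bullet> k \<noteq> l i \<bullet> k"
      by (simp add: AE_completion_iff inner_commute)
  qed auto
  then show ?thesis
  proof eventually_elim
    case (elim y)
    define E where "E = (\<lambda>k s. if y \<bullet> k < s then 1 else 0 :: real)"
    have ind: "indicator (box (l i) (u i)) y = (\<Prod>k\<in>Basis. E k (u i \<bullet> k) - E k (l i \<bullet> k))"
      if i: "i < N" for i
    proof (cases "y \<in> box (l i) (u i)")
      case True
      then have "(\<Prod>k\<in>Basis. E k (u i \<bullet> k) - E k (l i \<bullet> k)) = 1"
        by (intro prod.neutral) (auto simp: box_def E_def dest!: bspec)
      then show ?thesis using True by simp
    next
      case False
      then obtain k where k: "k \<in> Basis" "\<not> (l i \<bullet> k < y \<bullet> k \<and> y \<bullet> k < u i \<bullet> k)"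
        by (auto simp: box_def)
      moreover have "y \<bullet> k \<noteq> l i \<bullet> k" "l i \<bullet> k \<le> u i \<bullet> k" using elim i k lu by auto
      ultimately have "E k (u i \<bullet> k) - E k (l i \<bullet> k) = 0" by (auto simp: E_def)
      then have "(\<Prod>k\<in>Basis. E k (u i \<bullet> k) - E k (l i \<bullet> k)) = 0"
        using k(1) by (intro prod_zero) auto
      then show ?thesis using False by simp
    qed
    have "box_field N v l u y \<bullet> e = (\<Sum>p\<in>grid_vertices N l u.
        (\<Prod>k\<in>Basis. E k (p \<bullet> k)) *\<^sub>R vertex_coeff N v l u p) \<bullet> e" for e
    proof -
      have V: "linear (\<lambda>x. x \<bullet> e)" by (simp add: linearI inner_simps)
      have "box_field N v l u y \<bullet> e = (\<Sum>i<N. (v i \<bullet> e) * (\<Prod>k\<in>Basis. E k (u i \<bullet> k) - E k (l i \<bullet> k)))"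
        unfolding box_field_def inner_sum_left using ind by (intro sum.cong) auto
      also have "\<dots> = (\<Sum>p\<in>grid_vertices N l u. (vertex_coeff N v l u p \<bullet> e) * (\<Prod>k\<in>Basis. E k (p \<bullet> k)))"
        by (rule sum_boxes_eq_sum_vertices[OF V])
      finally show ?thesis by (simp add: inner_sum_left mult.commute)
    qed
    then show ?case unfolding E_def by (rule vector_eq_rdot[THEN iffD1, OF allI])
  qed
qed

text \<open>
  In dimension one no nonzero isotropic \<open>\<zeta>\<close> exists, hence the hypothesis on the dimension. The
  direction \<open>a\<close> is chosen generically: it separates the vertices, and its coordinates are nonzero, so
  that the box integrals have no vanishing denominators.
\<close>

lemma box_field_eq_0_if_exp_moments_0:
  fixes v l u :: "nat \<Rightarrow> 'a::euclidean_space"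
  assumes dim: "DIM('a) \<ge> 2"
    and lu: "\<And>i k. i < N \<Longrightarrow> k \<in> Basis \<Longrightarrow> l i \<bullet> k \<le> u i \<bullet> k"
    and moments: "\<And>a b. a \<bullet> b = 0 \<Longrightarrow> norm a = norm b \<Longrightarrow>
      (LINT y|lborel. cform a b (box_field N v l u y) * exp (cform a b y)) = 0"
  shows "AE y in lborel. box_field N v l u y = 0"
proof -
  let ?\<Lambda> = "grid_vertices N l u" and ?c = "vertex_coeff N v l u"
  \<comment> \<open>A generic direction is one that is not orthogonal to any of these vectors.\<close>
  let ?W = "(\<lambda>(p, q). p - q) ` {(p, q) \<in> ?\<Lambda> \<times> ?\<Lambda>. p \<noteq> q} \<union> Basis"
  have finW: "finite ?W"
    by (intro finite_UnI finite_imageI finite_Basis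
        finite_subset[OF _ finite_cartesian_product[OF finite_grid_vertices finite_grid_vertices]]) auto
  have zW: "0 \<notin> ?W" by auto
  obtain a where a: "\<And>w. w \<in> ?W \<Longrightarrow> a \<bullet> w \<noteq> 0"
    by (rule exists_not_orthogonal[OF finW zW]) (rule that, assumption)
  have ak: "a \<bullet> k \<noteq> 0" if "k \<in> Basis" for k by (rule a) (use that in simp)
  have inj: "inj_on (\<lambda>p. a \<bullet> p) ?\<Lambda>"
  proof (rule inj_onI)
    fix p q assume pq: "p \<in> ?\<Lambda>" "q \<in> ?\<Lambda>" "a \<bullet> p = a \<bullet> q"
    show "p = q"
    proof (rule ccontr)
      assume "p \<noteq> q"
      then have "p - q \<in> ?W" using pq by force
      from a[OF this] pq show False by (simp add: inner_diff_right)
    qed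
  qed
  have Zc: "cform a b (?c p) = 0" if p: "p \<in> ?\<Lambda>" and b: "a \<bullet> b = 0" "norm a = norm b" for p b
  proof (rule exp_sum_eq_0_imp_coeffs_0[where c="\<lambda>p. cform a b (?c p)" and \<alpha>="cform a b", OF finite_grid_vertices _ _ p])
    show "inj_on (\<lambda>p. Re (cform a b p)) ?\<Lambda>" using inj by (simp add: cform_def)
    fix t :: real assume t: "t > 0"
    have sc: "cform (t *\<^sub>R a) (t *\<^sub>R b) y = of_real t * cform a b y" for y
      by (simp add: cform_def complex_eq_iff)
    have nz: "cform (t *\<^sub>R a) (t *\<^sub>R b) k \<noteq> 0" if "k \<in> Basis" for k
      using ak[OF that] t by (simp add: cform_def complex_eq_iff)
    have h1: "(LINT y|lborel. cform (t *\<^sub>R a) (t *\<^sub>R b) (box_field N v l u y) * exp (cform (t *\<^sub>R a) (t *\<^sub>R b) y)) = 0"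
      using b by (intro moments) auto
    have h2: "(LINT y|lborel. cform (t *\<^sub>R a) (t *\<^sub>R b) (box_field N v l u y) * exp (cform (t *\<^sub>R a) (t *\<^sub>R b) y)) =
        (\<Sum>p\<in>?\<Lambda>. cform (t *\<^sub>R a) (t *\<^sub>R b) (?c p) * exp (cform (t *\<^sub>R a) (t *\<^sub>R b) p)) /
          (\<Prod>k\<in>Basis. cform (t *\<^sub>R a) (t *\<^sub>R b) k)"
      by (rule integral_box_field_exp[OF lu nz])
    have h3: "(\<Prod>k\<in>Basis. cform (t *\<^sub>R a) (t *\<^sub>R b) k) \<noteq> 0"
      using nz by (simp add: prod_zero_iff)
    have "(\<Sum>p\<in>?\<Lambda>. cform (t *\<^sub>R a) (t *\<^sub>R b) (?c p) * exp (cform (t *\<^sub>R a) (t *\<^sub>R b) p)) = 0"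
      using trans[OF h2[symmetric] h1] h3 by (simp only: divide_eq_0_iff simp_thms)
    then have "of_real t * (\<Sum>p\<in>?\<Lambda>. cform a b (?c p) * exp (of_real t * cform a b p)) = 0"
      by (simp add: sc sum_distrib_left mult.assoc)
    then show "(\<Sum>p\<in>?\<Lambda>. cform a b (?c p) * exp (of_real t * cform a b p)) = 0" using t by simp
  qed
  have c0: "?c p = 0" if p: "p \<in> ?\<Lambda>" for p
  proof (rule ccontr)
    assume nz: "?c p \<noteq> 0"
    obtain k :: 'a where "k \<in> Basis" using SOME_Basis by blast
    with ak have "a \<noteq> 0" by auto
    show False
    proof (cases "a \<bullet> ?c p = 0")
      case True
      \<comment> \<open>As \<open>?c p\<close> is orthogonal to \<open>a\<close>, it may itself serve as imaginary part of \<open>\<zeta>\<close>.\<close>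
      define b where "b = (norm a / norm (?c p)) *\<^sub>R ?c p"
      have "cform a b (?c p) = 0"
        using True nz by (intro Zc p) (auto simp: b_def)
      then have "b \<bullet> ?c p = 0" by (simp add: cform_def complex_eq_iff)
      then show False using nz \<open>a \<noteq> 0\<close> by (simp add: b_def)
    next
      case False
      obtain b0 where b0: "b0 \<noteq> 0" "a \<bullet> b0 = 0"
        using orthogonal_to_vector_exists[OF dim, of a] by (auto simp: orthogonal_def)
      have "cform a ((norm a / norm b0) *\<^sub>R b0) (?c p) = 0"
        using b0 by (intro Zc p) auto
      then show False using False by (simp add: cform_def complex_eq_iff)
    qed
  qed
  have "AE y in lborel. box_field N v l u y =
      (\<Sum>p\<in>?\<Lambda>. (\<Prod>k\<in>Basis. if y \<bullet> k < p \<bullet> k then 1 else 0) *\<^sub>R ?c p)"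
    by (rule box_field_eq_sum_vertices) (rule lu)
  then show ?thesis by eventually_elim (simp add: c0)
qed

section \<open>Radial profiles\<close>

lemma has_real_derivative_glue:
  fixes P Q P' Q' :: "real \<Rightarrow> real"
  assumes P: "\<And>s. s \<le> d \<Longrightarrow> (P has_real_derivative P' s) (at s)"
    and Q: "\<And>s. s \<ge> d \<Longrightarrow> (Q has_real_derivative Q' s) (at s)"
    and eq: "P d = Q d" "P' d = Q' d"
  shows "((\<lambda>s. if s < d then P s else Q s) has_real_derivative (if s < d then P' s else Q' s)) (at s)"
proof -
  have "((\<lambda>s. if s \<in> {..<d} then P s else Q s) has_vector_derivative
      (if s \<in> {..<d} then P' s else Q' s)) (at s within UNIV)"
  proof (rule has_vector_derivative_If_within_closures[where T="{d..}"])
    assume "s \<in> {..<d} \<union> closure {..<d} \<inter> closure {d..}"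
    then have "s \<le> d" by auto
    from P[OF this] show "(P has_vector_derivative P' s) (at s within {..<d} \<union> closure {..<d} \<inter> closure {d..})"
      by (simp add: has_real_derivative_iff_has_vector_derivative has_vector_derivative_at_within)
  next
    assume "s \<in> {d..} \<union> closure {..<d} \<inter> closure {d..}"
    then have "s \<ge> d" by auto
    from Q[OF this] show "(Q has_vector_derivative Q' s) (at s within {d..} \<union> closure {..<d} \<inter> closure {d..})"
      by (simp add: has_real_derivative_iff_has_vector_derivative has_vector_derivative_at_within)
  qed (use eq in \<open>auto dest: antisym\<close>)
  then show ?thesis
    by (simp add: has_real_derivative_iff_has_vector_derivative)
qed

lemma has_real_derivative_pos_part_power:
  fixes t :: real
  shows "((\<lambda>t. max 0 t ^ (n + 2)) has_real_derivative real (n + 2) * max 0 t ^ (n + 1)) (at t)"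
proof -
  have "((\<lambda>s. if s < 0 then 0 else s ^ (n + 2)) has_real_derivative
      (if t < 0 then 0 else real (n + 2) * t ^ (n + 1))) (at t)"
  proof (rule has_real_derivative_glue)
    show "((\<lambda>s. s ^ (n + 2)) has_real_derivative real (n + 2) * s ^ (n + 1)) (at s)" for s :: real
      using DERIV_pow[of "n + 2" s] by simp
  qed auto
  moreover have "(\<lambda>s::real. if s < 0 then 0 else s ^ (n + 2)) = (\<lambda>s. max 0 s ^ (n + 2))"
    by (auto simp: fun_eq_iff)
  ultimately show ?thesis by (auto split: if_splits)
qed

text \<open>
  With \<open>c(t) = max 0 t ^ 3\<close>, which is twice continuously differentiable, the cutoff is
  \<open>c (1 - c (s - r))\<close>.
\<close>

lemma exists_radial_cutoff:
  fixes r :: real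
  obtains e e' e'' :: "real \<Rightarrow> real" where
    "\<And>s. (e has_real_derivative e' s) (at s)"
    "\<And>s. (e' has_real_derivative e'' s) (at s)"
    "continuous_on UNIV e''"
    "\<And>s. s \<le> r \<Longrightarrow> e s = 1 \<and> e' s = 0 \<and> e'' s = 0"
    "\<And>s. s \<ge> r + 1 \<Longrightarrow> e s = 0"
proof
  let ?q = "\<lambda>s. max 0 (s - r) ^ 3" and ?q' = "\<lambda>s. 3 * max 0 (s - r) ^ 2"
  define e where "e = (\<lambda>s. max 0 (1 - ?q s) ^ 3)"
  define e' where "e' = (\<lambda>s. - (3 * max 0 (1 - ?q s) ^ 2 * ?q' s))"
  define e'' where "e'' = (\<lambda>s. 6 * max 0 (1 - ?q s) * ?q' s ^ 2 - 3 * max 0 (1 - ?q s) ^ 2 * (6 * max 0 (s - r)))"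
  have p3: "((\<lambda>t::real. max 0 t ^ 3) has_real_derivative 3 * max 0 t ^ 2) (at t)" for t :: real
    using has_real_derivative_pos_part_power[of 1 t] by (simp add: eval_nat_numeral)
  have p2: "((\<lambda>t::real. max 0 t ^ 2) has_real_derivative 2 * max 0 t) (at t)" for t :: real
    using has_real_derivative_pos_part_power[of 0 t] by (simp add: eval_nat_numeral)
  have q: "(?q has_real_derivative ?q' s) (at s)" for s
    by (rule DERIV_chain2[OF p3, THEN DERIV_cong]) (auto intro!: derivative_eq_intros)
  have q': "(?q' has_real_derivative 6 * max 0 (s - r)) (at s)" for s
    by (rule DERIV_cong, rule DERIV_cmult, rule DERIV_chain2[OF p2]) (auto intro!: derivative_eq_intros)
  have iq: "((\<lambda>s. 1 - ?q s) has_real_derivative - ?q' s) (at s)" for s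
    using DERIV_diff[OF DERIV_const q, of 1 s] by simp
  show "(e has_real_derivative e' s) (at s)" for s
    unfolding e_def e'_def by (rule DERIV_cong, rule DERIV_chain2[OF p3 iq]) simp
  have "((\<lambda>s. max 0 (1 - ?q s) ^ 2) has_real_derivative 2 * max 0 (1 - ?q s) * - ?q' s) (at s)" for s
    by (rule DERIV_chain2[OF p2 iq])
  note D = DERIV_minus[OF DERIV_mult[OF DERIV_cmult[OF this, of 3] q']]
  show "(e' has_real_derivative e'' s) (at s)" for s
    unfolding e'_def by (rule DERIV_cong, rule D) (simp add: e''_def power2_eq_square algebra_simps)
  show "continuous_on UNIV e''"
    unfolding e''_def by (intro continuous_intros)
  show "e s = 1 \<and> e' s = 0 \<and> e'' s = 0" if "s \<le> r" for s
    using that by (simp add: e_def e'_def e''_def)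
  show "e s = 0" if "s \<ge> r + 1" for s
  proof -
    have "1 \<le> max 0 (s - r) ^ 3" using that by (intro one_le_power) auto
    then show ?thesis by (simp add: e_def)
  qed
qed

text \<open>
  Below \<open>d\<close> the power \<open>s powr (- n / 2)\<close> is replaced by its second order Taylor polynomial at \<open>d\<close>. In
  dimension \<open>n\<close> the field \<open>z \<mapsto> p (z \<bullet> z) z\<close> has divergence \<open>2 s p'(s) + n p(s)\<close> with \<open>s = z \<bullet> z\<close>, which
  is zero for the pure power. For the Taylor polynomial it is a positive multiple of \<open>(s / d - 1)\<^sup>2\<close>, so
  the smoothed point charge has a density of constant sign. The fifth property is the derivative of
  this divergence for \<open>s \<ge> d\<close>.
\<close>

lemma exists_regularized_power:
  fixes n d :: real
  assumes n: "n > 0" and d: "d > 0"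
  obtains p p' p'' :: "real \<Rightarrow> real" and K where
    "\<And>s. (p has_real_derivative p' s) (at s)"
    "\<And>s. (p' has_real_derivative p'' s) (at s)"
    "continuous_on UNIV p''"
    "\<And>s. s \<ge> d \<Longrightarrow> p s = s powr (- n / 2)"
    "\<And>s. s \<ge> d \<Longrightarrow> 2 * s * p'' s + (2 + n) * p' s = 0"
    "\<And>s. 2 * s * p' s + n * p s = (if s < d then K * (s / d - 1)\<^sup>2 else 0)" "K > 0"
proof -
  define k where "k = d powr (- n / 2)"
  define m where "m = n / 2"
  have k: "k > 0" and m: "m > 0" "n = 2 * m" using d n by (auto simp: k_def m_def)
  define P where "P = (\<lambda>s. k * (1 - m * (s / d - 1) + m * (m + 1) / 2 * (s / d - 1)\<^sup>2))"
  define P' where "P' = (\<lambda>s. k * (- m / d + m * (m + 1) / d * (s / d - 1)))"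
  define p where "p = (\<lambda>s. if s < d then P s else s powr (- m))"
  define p' where "p' = (\<lambda>s. if s < d then P' s else - m * s powr (- m - 1))"
  define p'' where "p'' = (\<lambda>s. if s < d then k * (m * (m + 1) / d\<^sup>2) else m * (m + 1) * s powr (- m - 2))"
  have pw: "s * s powr (- m - 1) = s powr (- m)" "s * s powr (- m - 2) = s powr (- m - 1)" if "s > 0" for s
  proof -
    have "1 + (- m - 1) = - m" "1 + (- m - 2) = - m - 1" by auto
    then show "s * s powr (- m - 1) = s powr (- m)" "s * s powr (- m - 2) = s powr (- m - 1)"
      using that by (simp_all only: powr_mult_base less_imp_le)
  qed
  have kd: "d powr (- m) = k" "d powr (- m - 1) = k / d" "d powr (- m - 2) = k / d\<^sup>2"
    using pw[OF d] d by (auto simp: k_def m_def field_simps power2_eq_square)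
  show ?thesis
  proof
    show "(p has_real_derivative p' s) (at s)" for s
      unfolding p_def p'_def
    proof (rule has_real_derivative_glue)
      show "(P has_real_derivative P' s) (at s)" for s
        unfolding P_def P'_def using d
        by (auto intro!: derivative_eq_intros simp: field_simps power2_eq_square power4_eq_xxxx)
      show "((\<lambda>s. s powr (- m)) has_real_derivative - m * s powr (- m - 1)) (at s)" if "s \<ge> d" for s
        using that d by (intro has_real_derivative_powr) simp
    qed (use d in \<open>auto simp: P_def P'_def kd\<close>)
    show "(p' has_real_derivative p'' s) (at s)" for s
      unfolding p'_def p''_def
    proof (rule has_real_derivative_glue)
      show "(P' has_real_derivative k * (m * (m + 1) / d\<^sup>2)) (at s)" for s
        unfolding P'_def using d by (auto intro!: derivative_eq_intros simp: field_simps power2_eq_square)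
      show "((\<lambda>s. - m * s powr (- m - 1)) has_real_derivative m * (m + 1) * s powr (- m - 2)) (at s)"
        if "s \<ge> d" for s
        using DERIV_cmult[OF has_real_derivative_powr, of s "- m" "- m - 1"] that d
        by (simp add: algebra_simps)
    qed (use d in \<open>auto simp: P'_def kd\<close>)
    have "continuous_on ({..d} \<union> {d..}) p''"
      unfolding p''_def
    proof (rule continuous_on_cases)
      show "continuous_on {..d} (\<lambda>s. k * (m * (m + 1) / d\<^sup>2))" by simp
      show "continuous_on {d..} (\<lambda>s. m * (m + 1) * s powr (- m - 2))"
        using d by (intro continuous_intros) auto
    qed (use d kd in auto)
    moreover have "{..d} \<union> {d..} = UNIV" by auto
    ultimately show "continuous_on UNIV p''" by simp
    show "p s = s powr (- n / 2)" if "s \<ge> d" for s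
      using that by (simp add: p_def m_def)
    show "2 * s * p'' s + (2 + n) * p' s = 0" if "s \<ge> d" for s
    proof -
      have "2 * s * p'' s = 2 * m * (m + 1) * (s * s powr (- m - 2))"
        using that by (simp add: p''_def)
      also have "s * s powr (- m - 2) = s powr (- m - 1)"
        using that d by (intro pw) auto
      finally have "2 * s * p'' s = 2 * m * (m + 1) * s powr (- m - 1)" .
      then show ?thesis using that by (simp add: p'_def m(2) algebra_simps)
    qed
    show "2 * s * p' s + n * p s = (if s < d then (k * m * (m + 1) * (m + 2)) * (s / d - 1)\<^sup>2 else 0)" for s
    proof (cases "s < d")
      case True
      define \<sigma> where "\<sigma> = s / d - 1"
      have s: "s = d * (1 + \<sigma>)" using d by (simp add: \<sigma>_def field_simps)
      have e1: "2 * s * P' s = 2 * (1 + \<sigma>) * (k * (- m + m * (m + 1) * \<sigma>))"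
        unfolding P'_def \<sigma>_def[symmetric] using d by (simp add: s field_simps)
      have e2: "P s = k * (1 - m * \<sigma> + m * (m + 1) / 2 * \<sigma>\<^sup>2)"
        by (simp add: P_def \<sigma>_def)
      have "2 * s * P' s + n * P s = (k * m * (m + 1) * (m + 2)) * \<sigma>\<^sup>2"
        unfolding e1 e2 m(2) by (simp add: power2_eq_square algebra_simps)
      then show ?thesis using True by (simp add: p_def p'_def \<sigma>_def)
    next
      case False
      then show ?thesis using pw(1)[of s] d by (simp add: p_def p'_def m(2))
    qed
    show "k * m * (m + 1) * (m + 2) > 0" using k m by simp
  qed
qed

section \<open>Green's identity\<close>

lemma has_dir_deriv_mult:
  fixes F G :: "'a::real_normed_vector \<Rightarrow> 'b::real_normed_algebra"
  assumes "has_dir_deriv c F F'" "has_dir_deriv c G G'"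
  shows "has_dir_deriv c (\<lambda>x. F x * G x) (\<lambda>x. F x * G' x + F' x * G x)"
  unfolding has_dir_deriv_def
proof
  fix x
  show "((\<lambda>t. F (x + t *\<^sub>R c) * G (x + t *\<^sub>R c)) has_vector_derivative F x * G' x + F' x * G x) (at 0)"
    using has_vector_derivative_mult[of "\<lambda>t. F (x + t *\<^sub>R c)" "F' x" 0 UNIV "\<lambda>t. G (x + t *\<^sub>R c)" "G' x"] assms
    by (simp add: has_dir_deriv_def)
qed

lemma has_dir_deriv_add:
  assumes "has_dir_deriv c F F'" "has_dir_deriv c G G'"
  shows "has_dir_deriv c (\<lambda>x. F x + G x) (\<lambda>x. F' x + G' x)"
  using assms by (auto simp: has_dir_deriv_def intro!: has_vector_derivative_add)

lemma has_dir_deriv_diff: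
  assumes "has_dir_deriv c F F'" "has_dir_deriv c G G'"
  shows "has_dir_deriv c (\<lambda>x. F x - G x) (\<lambda>x. F' x - G' x)"
  using assms by (auto simp: has_dir_deriv_def intro!: has_vector_derivative_diff)

lemma has_dir_deriv_of_real:
  assumes "has_dir_deriv c F F'"
  shows "has_dir_deriv c (\<lambda>x. complex_of_real (F x)) (\<lambda>x. complex_of_real (F' x))"
  using assms by (auto simp: has_dir_deriv_def has_real_derivative_iff_has_vector_derivative
      intro!: has_vector_derivative_of_real)

lemma has_dir_deriv_const: "has_dir_deriv c (\<lambda>x. k) (\<lambda>x. 0)"
  by (simp add: has_dir_deriv_def)

lemma has_dir_deriv_cmult:
  fixes F :: "'a::real_normed_vector \<Rightarrow> 'b::real_normed_algebra"
  assumes "has_dir_deriv c F F'"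
  shows "has_dir_deriv c (\<lambda>x. k * F x) (\<lambda>x. k * F' x)"
  using has_dir_deriv_mult[OF has_dir_deriv_const assms, of k] by simp

lemma has_dir_deriv_inner:
  fixes b c :: "'a::real_inner"
  shows "has_dir_deriv c (\<lambda>x. x \<bullet> b) (\<lambda>x. c \<bullet> b)"
  unfolding has_dir_deriv_def
  by (auto simp: inner_simps has_real_derivative_iff_has_vector_derivative[symmetric]
      intro!: derivative_eq_intros)

lemma has_dir_deriv_radial:
  fixes c :: "'a::real_inner"
  assumes "\<And>s. (e has_real_derivative e' s) (at s)"
  shows "has_dir_deriv c (\<lambda>x. e (x \<bullet> x)) (\<lambda>x. 2 * (x \<bullet> c) * e' (x \<bullet> x))"
  unfolding has_dir_deriv_def has_real_derivative_iff_has_vector_derivative[symmetric]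
proof
  fix x
  have "((\<lambda>t. (x + t *\<^sub>R c) \<bullet> (x + t *\<^sub>R c)) has_real_derivative 2 * (x \<bullet> c)) (at 0)"
    by (auto simp: inner_simps inner_commute intro!: derivative_eq_intros)
  from DERIV_chain2[OF _ this, of e "e' (x \<bullet> x)"] assms
  show "((\<lambda>t. e ((x + t *\<^sub>R c) \<bullet> (x + t *\<^sub>R c))) has_real_derivative 2 * (x \<bullet> c) * e' (x \<bullet> x)) (at 0)"
    by (simp add: mult.commute)
qed

lemma has_dir_deriv_exp_cform:
  "has_dir_deriv c (\<lambda>x. exp (cform a b x)) (\<lambda>x. cform a b c * exp (cform a b x))"
  unfolding has_dir_deriv_def
proof
  fix x
  have "((\<lambda>w. exp (cform a b x + w * cform a b c)) has_field_derivative
      cform a b c * exp (cform a b x)) (at (of_real 0))"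
    by (auto intro!: derivative_eq_intros)
  from has_vector_derivative_real_field[OF this]
  show "((\<lambda>t. exp (cform a b (x + t *\<^sub>R c))) has_vector_derivative cform a b c * exp (cform a b x)) (at 0)"
    by (simp add: linear_add[OF linear_cform] linear_scale[OF linear_cform] scaleR_conv_of_real)
qed

lemma has_dir_deriv_shift:
  assumes "has_dir_deriv c F F'"
  shows "has_dir_deriv c (\<lambda>x. F (x - y)) (\<lambda>x. F' (x - y))"
proof -
  have "x + t *\<^sub>R c - y = (x - y) + t *\<^sub>R c" for x and t :: real by simp
  then show ?thesis using assms by (simp only: has_dir_deriv_def) simp
qed

text \<open>
  Green's identity involves the pure second derivatives only, so the mixed ones are left out.
\<close>

definition has_laplacian ::
  "('a::euclidean_space \<Rightarrow> complex) \<Rightarrow> ('a \<Rightarrow> complex) \<Rightarrow> bool" where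
  "has_laplacian \<phi> L \<longleftrightarrow> continuous_on UNIV \<phi> \<and>
     (\<exists>\<phi>1 \<phi>2. (\<forall>c\<in>Basis. has_dir_deriv c \<phi> (\<phi>1 c) \<and> has_dir_deriv c (\<phi>1 c) (\<phi>2 c) \<and>
        continuous_on UNIV (\<phi>1 c) \<and> continuous_on UNIV (\<phi>2 c)) \<and> L = (\<lambda>x. \<Sum>c\<in>Basis. \<phi>2 c x))"

lemma has_laplacianI:
  assumes "continuous_on UNIV \<phi>"
    and "\<And>c. c \<in> Basis \<Longrightarrow> has_dir_deriv c \<phi> (Fd c)"
    and "\<And>c. c \<in> Basis \<Longrightarrow> has_dir_deriv c (Fd c) (Fdd c)"
    and "\<And>c. c \<in> Basis \<Longrightarrow> continuous_on UNIV (Fd c)"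
    and "\<And>c. c \<in> Basis \<Longrightarrow> continuous_on UNIV (Fdd c)"
    and "\<And>x. (\<Sum>c\<in>Basis. Fdd c x) = L x"
  shows "has_laplacian \<phi> L"
  unfolding has_laplacian_def using assms by (intro conjI exI[of _ Fd] exI[of _ Fdd]) auto

text \<open>
  For each basis direction the field \<open>G \<phi>' - G' \<phi>\<close> has compact support, so its derivative
  \<open>G \<phi>'' - G'' \<phi>\<close> integrates to zero.
\<close>

lemma green_identity:
  fixes G \<phi> :: "'a::euclidean_space \<Rightarrow> complex"
  assumes G: "has_laplacian G LG" and \<phi>: "has_laplacian \<phi> L" and supp: "\<And>x. norm x > r \<Longrightarrow> \<phi> x = 0"
  shows "(LINT x|lborel. G x * L x) = (LINT x|lborel. LG x * \<phi> x)"
proof -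
  obtain G1 G2 where G1: "\<And>c. c \<in> Basis \<Longrightarrow> has_dir_deriv c G (G1 c)"
    and G2: "\<And>c. c \<in> Basis \<Longrightarrow> has_dir_deriv c (G1 c) (G2 c)"
    and cG: "continuous_on UNIV G" "\<And>c. c \<in> Basis \<Longrightarrow> continuous_on UNIV (G1 c)"
      "\<And>c. c \<in> Basis \<Longrightarrow> continuous_on UNIV (G2 c)"
    and LG: "LG = (\<lambda>x. \<Sum>c\<in>Basis. G2 c x)"
    using G unfolding has_laplacian_def by blast
  obtain \<phi>1 \<phi>2 where \<phi>1: "\<And>c. c \<in> Basis \<Longrightarrow> has_dir_deriv c \<phi> (\<phi>1 c)"
    and \<phi>2: "\<And>c. c \<in> Basis \<Longrightarrow> has_dir_deriv c (\<phi>1 c) (\<phi>2 c)"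
    and c\<phi>: "continuous_on UNIV \<phi>" "\<And>c. c \<in> Basis \<Longrightarrow> continuous_on UNIV (\<phi>1 c)"
      "\<And>c. c \<in> Basis \<Longrightarrow> continuous_on UNIV (\<phi>2 c)"
    and L: "L = (\<lambda>x. \<Sum>c\<in>Basis. \<phi>2 c x)"
    using \<phi> unfolding has_laplacian_def by blast
  have s1: "\<phi>1 c x = 0" if "c \<in> Basis" "norm x > r" for c x
    by (rule has_dir_deriv_eq_0_outside[OF \<phi>1[OF that(1)] supp that(2)])
  have s2: "\<phi>2 c x = 0" if "c \<in> Basis" "norm x > r" for c x
    by (rule has_dir_deriv_eq_0_outside[OF \<phi>2[OF that(1)] s1[OF that(1)] that(2)])
  have i1: "integrable lborel (\<lambda>x. G x * \<phi>2 c x)" if "c \<in> Basis" for c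
    using cG(1) c\<phi>(3)[OF that] s2[OF that]
    by (intro integrable_continuous_bounded_support[where r=r] continuous_intros) auto
  have i2: "integrable lborel (\<lambda>x. G2 c x * \<phi> x)" if "c \<in> Basis" for c
    using cG(3)[OF that] c\<phi>(1) supp
    by (intro integrable_continuous_bounded_support[where r=r] continuous_intros) auto
  have eq: "(LINT x|lborel. G x * \<phi>2 c x) = (LINT x|lborel. G2 c x * \<phi> x)" if c: "c \<in> Basis" for c
  proof -
    have "has_dir_deriv c (\<lambda>x. G x * \<phi>1 c x - G1 c x * \<phi> x)
        (\<lambda>x. (G x * \<phi>2 c x + G1 c x * \<phi>1 c x) - (G1 c x * \<phi>1 c x + G2 c x * \<phi> x))"
      by (intro has_dir_deriv_diff has_dir_deriv_mult G1 G2 \<phi>1 \<phi>2 c)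
    then have "has_dir_deriv c (\<lambda>x. G x * \<phi>1 c x - G1 c x * \<phi> x) (\<lambda>x. G x * \<phi>2 c x - G2 c x * \<phi> x)"
      by simp
    then have "(LINT x|lborel. G x * \<phi>2 c x - G2 c x * \<phi> x) = 0"
      by (rule integral_dir_deriv_eq_0[where r=r])
         (use cG(1) cG(2,3)[OF c] c\<phi>(1) c\<phi>(2,3)[OF c] supp s1[OF c] in
           \<open>auto intro!: continuous_intros\<close>)
    then show ?thesis using i1[OF c] i2[OF c] by simp
  qed
  show ?thesis
    unfolding L LG sum_distrib_left sum_distrib_right using i1 i2 eq
    by (simp add: Bochner_Integration.integral_sum)
qed

lemma sum_inner_Basis_sq: "(\<Sum>c\<in>Basis. (x \<bullet> c) * ((x \<bullet> c) * k)) = (x \<bullet> x) * (k::real)" for x :: "'a::euclidean_space"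
  by (simp add: euclidean_inner[of x x] sum_distrib_right mult.assoc)

text \<open>
  These are the components of the field \<open>p (z \<bullet> z) z\<close> at \<open>z = x - y\<close>. Their Laplacian is the
  derivative in direction \<open>b\<close> of the divergence of that field.
\<close>

lemma has_laplacian_mult_radial:
  fixes p p' p'' :: "real \<Rightarrow> real" and b y :: "'a::euclidean_space"
  assumes b: "b \<in> Basis"
    and p: "\<And>s. (p has_real_derivative p' s) (at s)"
    and p': "\<And>s. (p' has_real_derivative p'' s) (at s)"
    and p'': "continuous_on UNIV p''"
  shows "has_laplacian (\<lambda>x. of_real (((x - y) \<bullet> b) * p ((x - y) \<bullet> (x - y))))
    (\<lambda>x. of_real (2 * ((x - y) \<bullet> b) * (2 * ((x - y) \<bullet> (x - y)) * p'' ((x - y) \<bullet> (x - y)) +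
       (2 + real DIM('a)) * p' ((x - y) \<bullet> (x - y)))))"
proof -
  define G1 where "G1 = (\<lambda>c z. (z \<bullet> b) * (2 * (z \<bullet> c) * p' (z \<bullet> z)) + (c \<bullet> b) * p (z \<bullet> z))"
  define G2 where "G2 = (\<lambda>c z. ((z \<bullet> b) * (2 * (z \<bullet> c) * (2 * (z \<bullet> c) * p'' (z \<bullet> z)) + 2 * (c \<bullet> c) * p' (z \<bullet> z)) +
      (c \<bullet> b) * (2 * (z \<bullet> c) * p' (z \<bullet> z))) + (c \<bullet> b) * (2 * (z \<bullet> c) * p' (z \<bullet> z)))"
  have cont: "continuous_on UNIV p" "continuous_on UNIV p'"
    by (rule DERIV_continuous_on[OF has_field_derivative_at_within[OF p]],
        rule DERIV_continuous_on[OF has_field_derivative_at_within[OF p']])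
  note ci = continuous_intros continuous_on_compose2[OF cont(1)] continuous_on_compose2[OF cont(2)]
    continuous_on_compose2[OF p'']
  have d1: "has_dir_deriv c (\<lambda>z. (z \<bullet> b) * p (z \<bullet> z)) (G1 c)" for c
    unfolding G1_def by (intro has_dir_deriv_mult has_dir_deriv_inner has_dir_deriv_radial p)
  have d2: "has_dir_deriv c (G1 c) (G2 c)" for c
    unfolding G1_def G2_def
    by (intro has_dir_deriv_add has_dir_deriv_cmult has_dir_deriv_mult has_dir_deriv_inner has_dir_deriv_radial p p')
  have sum: "(\<Sum>c\<in>Basis. G2 c z) = 2 * (z \<bullet> b) * (2 * (z \<bullet> z) * p'' (z \<bullet> z) + (2 + real DIM('a)) * p' (z \<bullet> z))" for z
  proof -
    have "(\<Sum>c\<in>Basis. G2 c z) = (\<Sum>c\<in>Basis. (z \<bullet> c) * ((z \<bullet> c) * (4 * (z \<bullet> b) * p'' (z \<bullet> z)))) +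
        (\<Sum>c\<in>(Basis::'a set). 2 * (z \<bullet> b) * p' (z \<bullet> z)) +
        (\<Sum>c\<in>Basis. if c = b then 4 * (z \<bullet> b) * p' (z \<bullet> z) else 0)"
      unfolding sum.distrib[symmetric] using b
      by (intro sum.cong refl) (auto simp: G2_def inner_Basis algebra_simps)
    also have "\<dots> = 2 * (z \<bullet> b) * (2 * (z \<bullet> z) * p'' (z \<bullet> z) + (2 + real DIM('a)) * p' (z \<bullet> z))"
      using b by (simp add: sum_inner_Basis_sq algebra_simps)
    finally show ?thesis .
  qed
  show ?thesis
  proof (rule has_laplacianI[where Fd="\<lambda>c x. of_real (G1 c (x - y))" and Fdd="\<lambda>c x. of_real (G2 c (x - y))"])
    show "has_dir_deriv c (\<lambda>x. complex_of_real ((x - y) \<bullet> b * p ((x - y) \<bullet> (x - y)))) (\<lambda>x. of_real (G1 c (x - y)))" for c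
      by (intro has_dir_deriv_of_real) (rule has_dir_deriv_shift[OF d1])
    show "has_dir_deriv c (\<lambda>x. complex_of_real (G1 c (x - y))) (\<lambda>x. of_real (G2 c (x - y)))" for c
      by (intro has_dir_deriv_of_real has_dir_deriv_shift d2)
    show "(\<Sum>c\<in>Basis. complex_of_real (G2 c (x - y))) = of_real (2 * ((x - y) \<bullet> b) * (2 * ((x - y) \<bullet> (x - y)) * p'' ((x - y) \<bullet> (x - y)) +
       (2 + real DIM('a)) * p' ((x - y) \<bullet> (x - y))))" for x
      unfolding of_real_sum[symmetric] sum ..
  qed (auto simp: G1_def G2_def intro!: ci)
qed

text \<open>
  This is \<open>\<zeta> \<cdot> \<zeta> = 0\<close>, which makes \<open>exp (\<zeta> \<cdot> y)\<close> harmonic.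
\<close>

lemma cform_isotropic:
  assumes "a \<bullet> b = 0" "norm a = norm b"
  shows "(\<Sum>c\<in>Basis. cform a b c * cform a b c) = 0"
proof -
  have "(\<Sum>c\<in>Basis. cform a b c * cform a b c) = of_real (a \<bullet> a - b \<bullet> b) + 2 * \<i> * of_real (a \<bullet> b)"
    by (simp add: complex_eq_iff cform_def euclidean_inner[of a a] euclidean_inner[of b b]
        euclidean_inner[of a b] sum_subtractf sum.distrib mult.commute sum_distrib_left)
  then show ?thesis using assms by (simp add: norm_eq)
qed

lemma exists_cutoff_exp:
  fixes a b :: "'a::euclidean_space"
  assumes ab: "a \<bullet> b = 0" "norm a = norm b" and r: "r \<ge> 0"
  obtains \<phi> L r' where "has_laplacian \<phi> L" "continuous_on UNIV L"
    "\<And>x. norm x \<le> r \<Longrightarrow> \<phi> x = exp (cform a b x)" "\<And>x. norm x \<le> r \<Longrightarrow> L x = 0"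
    "\<And>x. norm x > r' \<Longrightarrow> \<phi> x = 0" "\<And>x. norm x > r' \<Longrightarrow> L x = 0"
proof -
  let ?u = "\<lambda>x. exp (cform a b x)" and ?Z = "cform a b"
  obtain e e' e'' :: "real \<Rightarrow> real" where e:
    "\<And>s. (e has_real_derivative e' s) (at s)"
    "\<And>s. (e' has_real_derivative e'' s) (at s)"
    "continuous_on UNIV e''"
    "\<And>s. s \<le> r\<^sup>2 \<Longrightarrow> e s = 1 \<and> e' s = 0 \<and> e'' s = 0"
    "\<And>s. s \<ge> r\<^sup>2 + 1 \<Longrightarrow> e s = 0"
    using exists_radial_cutoff[of "r\<^sup>2"] by blast
  have cont: "continuous_on UNIV e" "continuous_on UNIV e'"
    by (rule DERIV_continuous_on[OF has_field_derivative_at_within[OF e(1)]],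
        rule DERIV_continuous_on[OF has_field_derivative_at_within[OF e(2)]])
  note ci = continuous_intros continuous_on_compose2[OF cont(1)] continuous_on_compose2[OF cont(2)]
    continuous_on_compose2[OF e(3)]
  define \<phi> where "\<phi> = (\<lambda>x. of_real (e (x \<bullet> x)) * ?u x)"
  define h1 where "h1 = (\<lambda>c x::'a. 2 * (x \<bullet> c) * e' (x \<bullet> x))"
  define h2 where "h2 = (\<lambda>c x::'a. 2 * (x \<bullet> c) * (2 * (x \<bullet> c) * e'' (x \<bullet> x)) + 2 * (c \<bullet> c) * e' (x \<bullet> x))"
  define \<phi>1 where "\<phi>1 = (\<lambda>c x. of_real (e (x \<bullet> x)) * (?Z c * ?u x) + of_real (h1 c x) * ?u x)"
  define \<phi>2 where "\<phi>2 = (\<lambda>c x. (of_real (e (x \<bullet> x)) * (?Z c * (?Z c * ?u x)) + of_real (h1 c x) * (?Z c * ?u x)) +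
      (of_real (h1 c x) * (?Z c * ?u x) + of_real (h2 c x) * ?u x))"
  define L where "L = (\<lambda>x. \<Sum>c\<in>Basis. \<phi>2 c x)"
  have dh1: "has_dir_deriv c (\<lambda>x. e (x \<bullet> x)) (h1 c)" for c
    unfolding h1_def by (intro has_dir_deriv_radial e)
  have dh2: "has_dir_deriv c (h1 c) (h2 c)" for c
    unfolding h1_def h2_def
    by (intro has_dir_deriv_mult has_dir_deriv_cmult has_dir_deriv_inner has_dir_deriv_radial e)
  have cL: "continuous_on UNIV L"
    unfolding L_def \<phi>2_def h1_def h2_def by (auto intro!: ci)
  have lap: "has_laplacian \<phi> L"
  proof (rule has_laplacianI[where Fd=\<phi>1 and Fdd=\<phi>2])
    show "has_dir_deriv c \<phi> (\<phi>1 c)" for c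
      unfolding \<phi>_def \<phi>1_def by (intro has_dir_deriv_mult has_dir_deriv_of_real has_dir_deriv_exp_cform dh1)
    show "has_dir_deriv c (\<phi>1 c) (\<phi>2 c)" for c
      unfolding \<phi>1_def \<phi>2_def
      by (intro has_dir_deriv_add has_dir_deriv_mult has_dir_deriv_cmult has_dir_deriv_of_real has_dir_deriv_exp_cform dh1 dh2)
  qed (auto simp: L_def \<phi>_def \<phi>1_def \<phi>2_def h1_def h2_def intro!: ci)
  have in_ball: "e (x \<bullet> x) = 1 \<and> e' (x \<bullet> x) = 0 \<and> e'' (x \<bullet> x) = 0" if "norm x \<le> r" for x :: 'a
    using that e(4)[of "x \<bullet> x"] by (simp add: power2_norm_eq_inner[symmetric] power_mono)
  have out: "\<phi> x = 0" if "norm x > r + 1" for x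
  proof -
    have "(norm x)\<^sup>2 \<ge> (r + 1)\<^sup>2" using that r by (intro power_mono) auto
    moreover have "(r + 1)\<^sup>2 \<ge> r\<^sup>2 + 1" using r by (simp add: power2_eq_square algebra_simps)
    ultimately show ?thesis using e(5)[of "x \<bullet> x"] by (simp add: \<phi>_def power2_norm_eq_inner[symmetric])
  qed
  have d: "has_dir_deriv c \<phi> (\<phi>1 c)" "has_dir_deriv c (\<phi>1 c) (\<phi>2 c)" for c
    unfolding \<phi>_def \<phi>1_def \<phi>2_def
    by (intro has_dir_deriv_add has_dir_deriv_mult has_dir_deriv_cmult has_dir_deriv_of_real has_dir_deriv_exp_cform dh1 dh2)+
  show ?thesis
  proof
    show "\<phi> x = ?u x" if "norm x \<le> r" for x using in_ball[OF that] by (simp add: \<phi>_def)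
    show "L x = 0" if "norm x \<le> r" for x
    proof -
      have "L x = (\<Sum>c\<in>Basis. (?Z c * ?Z c) * ?u x)"
        unfolding L_def by (intro sum.cong refl) (simp add: \<phi>2_def h1_def h2_def in_ball[OF that])
      also have "\<dots> = 0" unfolding sum_distrib_right[symmetric] cform_isotropic[OF ab] by simp
      finally show ?thesis .
    qed
    show "L x = 0" if x: "norm x > r + 1" for x
    proof -
      have "\<phi>2 c x = 0" for c
        by (rule has_dir_deriv_eq_0_outside[OF d(2) has_dir_deriv_eq_0_outside[OF d(1) out] x])
      then show ?thesis by (simp add: L_def)
    qed
  qed (fact lap cL out)+
qed

section \<open>The potential determines the exponential moments\<close>

lemma integrable_bounded_support:
  fixes h :: "'a::euclidean_space \<Rightarrow> 'b::euclidean_space"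
  assumes "h \<in> borel_measurable borel" "\<And>x. norm (h x) \<le> B" "\<And>x. norm x > r \<Longrightarrow> h x = 0"
  shows "integrable lborel h"
proof (rule Bochner_Integration.integrable_bound)
  show "integrable lborel (\<lambda>x. B * indicator (cball (0::'a) r) x)"
    using emeasure_bounded_finite[OF bounded_cball, of "0::'a" r]
    by (intro integrable_mult_right integrable_real_indicator) simp_all
  show "AE x in lborel. norm (h x) \<le> norm (B * indicator (cball 0 r) x)"
  proof (rule AE_I2)
    fix x show "norm (h x) \<le> norm (B * indicator (cball 0 r) x)"
      using assms(2)[of x] assms(3)[of x] by (cases "norm x \<le> r") (auto simp: abs_if)
  qed
qed (use assms(1) in simp)

text \<open>
  The kernel is continuous, hence bounded on the product of the supports, so the integrals may be
  exchanged.
\<close>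

lemma fubini_continuous_kernel:
  fixes L :: "'a::euclidean_space \<Rightarrow> complex" and k :: "'a \<Rightarrow> 'a \<Rightarrow> 'a" and F :: "'a \<Rightarrow> 'a"
  assumes L: "continuous_on UNIV L" "\<And>x. norm x > r \<Longrightarrow> L x = 0"
    and k: "continuous_on UNIV (\<lambda>z. k (fst z) (snd z))"
    and F: "F \<in> borel_measurable borel" "\<And>y. norm (F y) \<le> M" "\<And>y. norm y > r \<Longrightarrow> F y = 0"
  shows "(LINT x|lborel. L x * of_real (LINT y|lborel. k x y \<bullet> F y)) =
    (LINT y|lborel. LINT x|lborel. L x * of_real (k x y \<bullet> F y))"
proof -
  define h where "h = (\<lambda>z::'a \<times> 'a. L (fst z) * of_real (k (fst z) (snd z) \<bullet> F (snd z)))"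
  obtain BL where BL: "BL > 0" "\<And>x. norm (L x) \<le> BL"
    using continuous_bounded_support_bound[OF L(1) L(2)] by blast
  have "compact ((\<lambda>z. k (fst z) (snd z)) ` (cball 0 r \<times> cball 0 r))"
    by (intro compact_continuous_image continuous_on_subset[OF k] compact_Times compact_cball) auto
  then have "bounded ((\<lambda>z. k (fst z) (snd z)) ` (cball 0 r \<times> cball 0 r))"
    by (rule compact_imp_bounded)
  then obtain Bk where Bk: "Bk > 0" "\<forall>w\<in>(\<lambda>z. k (fst z) (snd z)) ` (cball 0 r \<times> cball 0 r). norm w \<le> Bk"
    unfolding bounded_pos by blast
  have M: "M \<ge> 0" using order_trans[OF norm_ge_zero F(2)] .
  have supp: "h z = 0" if "z \<notin> cball 0 r \<times> cball 0 r" for z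
    using that L(2)[of "fst z"] F(3)[of "snd z"] by (cases z) (auto simp: h_def)
  have "integrable lborel h"
  proof (rule integrable_bounded_support)
    have "(\<lambda>z. L (fst z)) \<in> borel_measurable borel" "(\<lambda>z. k (fst z) (snd z)) \<in> borel_measurable borel"
      by (auto intro!: borel_measurable_continuous_onI continuous_on_compose2[OF L(1)] continuous_intros k)
    moreover have "(\<lambda>z::'a \<times> 'a. F (snd z)) \<in> borel_measurable borel"
      using F(1) by (rule measurable_compose[rotated]) (auto intro!: borel_measurable_continuous_onI continuous_intros)
    ultimately show "h \<in> borel_measurable borel"
      unfolding h_def
      by (intro borel_measurable_times borel_measurable_inner
          borel_measurable_continuous_on[of complex_of_real]) (auto intro!: continuous_intros)
    show "norm (h z) \<le> BL * (Bk * M)" for z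
    proof (cases "z \<in> cball 0 r \<times> cball 0 r")
      case True
      then have "norm (k (fst z) (snd z)) \<le> Bk" using Bk(2) by blast
      then have "norm (k (fst z) (snd z)) * norm (F (snd z)) \<le> Bk * M"
        using F(2) M by (intro mult_mono) (auto intro: order_trans[OF norm_ge_zero])
      then have "\<bar>k (fst z) (snd z) \<bullet> F (snd z)\<bar> \<le> Bk * M"
        using Cauchy_Schwarz_ineq2 order_trans by blast
      then show ?thesis
        unfolding h_def norm_mult norm_of_real using BL Bk(1) M by (intro mult_mono) auto
    next
      case False
      then show ?thesis using supp[OF False] BL(1) Bk(1) M by simp
    qed
    show "h z = 0" if "norm z > r + r" for z
    proof (rule supp, rule notI)
      assume "z \<in> cball 0 r \<times> cball 0 r"
      then have "norm (fst z) \<le> r" "norm (snd z) \<le> r" by auto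
      moreover have "norm z \<le> norm (fst z) + norm (snd z)"
        by (metis norm_Pair_le prod.collapse)
      ultimately show False using that by linarith
    qed
  qed
  then have "integrable (lborel \<Otimes>\<^sub>M lborel) (\<lambda>(x, y). h (x, y))"
    by (simp add: lborel_prod)
  from lborel_pair.Fubini_integral[OF this]
  have "(LINT y|lborel. LINT x|lborel. h (x, y)) = (LINT x|lborel. LINT y|lborel. h (x, y))" .
  then show ?thesis by (simp add: h_def)
qed

text \<open>
  The real part of \<open>exp (\<zeta> \<cdot> z)\<close> is \<open>exp (a \<bullet> z) cos (b \<bullet> z)\<close>, which is positive as long as
  \<open>\<bar>b \<bullet> z\<bar> \<le> 1\<close>. The smallness of \<open>d\<close> ensures this on the support of the weight.
\<close>

lemma integral_radial_exp_cform_neq_0: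
  fixes a b :: "'a::euclidean_space"
  assumes q: "continuous_on UNIV q" "\<And>s. s \<ge> d \<Longrightarrow> q s = 0" "\<And>s. s < d \<Longrightarrow> q s > 0"
    and d: "d > 0" "(norm b)\<^sup>2 * d \<le> 1"
  shows "(LINT z|lborel. of_real (q (z \<bullet> z)) * exp (cform a b z)) \<noteq> 0"
proof -
  let ?h = "\<lambda>z. of_real (q (z \<bullet> z)) * exp (cform a b z)"
  have cq: "continuous_on UNIV (\<lambda>z::'a. q (z \<bullet> z))"
    by (intro continuous_on_compose2[OF q(1)] continuous_intros) auto
  have supp: "?h z = 0" if "norm z > sqrt d" for z
  proof -
    have "z \<bullet> z \<ge> d" using that d(1)
      by (metis norm_eq_sqrt_inner order_less_imp_le real_sqrt_less_iff)
    then show ?thesis using q(2) by simp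
  qed
  have ch: "continuous_on UNIV ?h" by (intro continuous_intros cq)
  have int: "integrable lborel ?h"
    by (rule integrable_continuous_bounded_support[OF ch supp])
  have pos: "Re (?h z) \<ge> 0" "z \<bullet> z < d \<Longrightarrow> Re (?h z) > 0" for z
  proof -
    have *: "Re (?h z) = q (z \<bullet> z) * (exp (a \<bullet> z) * cos (b \<bullet> z))"
      by (simp add: Re_exp cform_def)
    have c: "cos (b \<bullet> z) > 0" if z: "z \<bullet> z < d"
    proof -
      have "\<bar>b \<bullet> z\<bar>\<^sup>2 \<le> (norm b * norm z)\<^sup>2"
        by (intro power_mono Cauchy_Schwarz_ineq2) simp
      also have "\<dots> = (norm b)\<^sup>2 * (z \<bullet> z)" by (simp add: power_mult_distrib power2_norm_eq_inner)
      also have "\<dots> \<le> (norm b)\<^sup>2 * d" using z by (intro mult_left_mono) auto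
      finally have "\<bar>b \<bullet> z\<bar>\<^sup>2 \<le> 1\<^sup>2" using d(2) by simp
      then have "\<bar>b \<bullet> z\<bar> \<le> 1" by (rule power2_le_imp_le) simp
      then show ?thesis using pi_gt3 by (intro cos_gt_zero_pi) auto
    qed
    show "z \<bullet> z < d \<Longrightarrow> Re (?h z) > 0" unfolding * using c q(3) by simp
    then show "Re (?h z) \<ge> 0"
      by (cases "z \<bullet> z < d") (auto intro: less_imp_le simp: q(2) not_less simp del: Re_complex_of_real times_complex.sel)
  qed
  have "(LINT z|lborel. Re (?h z)) \<noteq> 0"
  proof
    assume "(LINT z|lborel. Re (?h z)) = 0"
    then have "AE z in lborel. Re (?h z) = 0"
      by (subst (asm) integral_nonneg_eq_0_iff_AE) (use int pos(1) in \<open>auto intro!: integrable_Re simp del: times_complex.sel\<close>)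
    then have "AE z in lborel. z \<notin> ball (0::'a) (sqrt d)"
    proof eventually_elim
      case (elim z)
      have "\<not> z \<bullet> z < d" using elim pos(2)[of z] by auto
      then show ?case by (simp add: norm_eq_sqrt_inner)
    qed
    then have "AE z in lebesgue. z \<notin> ball (0::'a) (sqrt d)" by (rule AE_completion)
    then have "negligible (ball (0::'a) (sqrt d))"
      by (simp add: negligible_iff_null_sets AE_iff_null_sets)
    then show False using open_not_negligible[of "ball (0::'a) (sqrt d)"] d(1) by simp
  qed
  then show ?thesis using integral_Re[OF int] by auto
qed

text \<open>
  The dipole kernel \<open>norm z powr (- n) z\<close> is smoothed inside the ball of squared radius \<open>d \<le> 1\<close>. The
  cutoff exponential \<open>\<phi>\<close> agrees with \<open>exp (\<zeta> \<cdot> x)\<close> on the ball of radius \<open>r + 1\<close>. For \<open>y\<close> in the ball of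
  radius \<open>r\<close>, the smoothing does not affect the kernel on the support of \<open>L = \<Delta>\<phi>\<close>, which has distance at
  least 1 from \<open>y\<close>, and the cutoff does not affect \<open>\<phi>\<close> where the smoothed kernel fails to be harmonic.
  Green's identity then gives the representation \<open>rep\<close>, in which \<open>C\<close> is the Laplace transform of the
  smoothed charge.
\<close>

lemma exp_moment_eq_0_if_potential_eq_0:
  fixes F :: "'a::euclidean_space \<Rightarrow> 'a"
  assumes F: "F \<in> borel_measurable borel" "\<And>y. norm (F y) \<le> M" "\<And>y. norm y > r \<Longrightarrow> F y = 0"
    and pot: "\<And>x. norm x > r + 1 \<Longrightarrow>
      (LINT y|lborel. norm (x - y) powr - real DIM('a) *\<^sub>R (x - y) \<bullet> F y) = 0"
    and r: "r \<ge> 0" and ab: "a \<bullet> b = 0" "norm a = norm b"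
  shows "(LINT y|lborel. cform a b (F y) * exp (cform a b y)) = 0"
proof -
  let ?u = "\<lambda>x. exp (cform a b x)" and ?Z = "cform a b"
  \<comment> \<open>Small enough for the smoothing to stay in the unit ball and for \<open>C\<close> to be nonzero.\<close>
  define d where "d = 1 / (1 + (norm b)\<^sup>2)"
  have d: "d > 0" "d \<le> 1" "(norm b)\<^sup>2 * d \<le> 1"
    by (auto simp: d_def field_simps add_pos_nonneg)
  have n: "real DIM('a) > 0" by simp
  obtain p p' p'' :: "real \<Rightarrow> real" and K where p:
    "\<And>s. (p has_real_derivative p' s) (at s)"
    "\<And>s. (p' has_real_derivative p'' s) (at s)"
    "continuous_on UNIV p''"
    "\<And>s. s \<ge> d \<Longrightarrow> p s = s powr (- real DIM('a) / 2)"
    "\<And>s. s \<ge> d \<Longrightarrow> 2 * s * p'' s + (2 + real DIM('a)) * p' s = 0"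
    "\<And>s. 2 * s * p' s + real DIM('a) * p s = (if s < d then K * (s / d - 1)\<^sup>2 else 0)" "K > 0"
    by (rule exists_regularized_power[OF n d(1)]) (rule that, assumption+)
  have cp: "continuous_on UNIV p" "continuous_on UNIV p'"
    by (rule DERIV_continuous_on[OF has_field_derivative_at_within[OF p(1)]],
        rule DERIV_continuous_on[OF has_field_derivative_at_within[OF p(2)]])
  note ci = continuous_intros continuous_on_compose2[OF cp(1)] continuous_on_compose2[OF cp(2)]
    continuous_on_compose2[OF p(3)]
  define q where "q = (\<lambda>s. 2 * s * p' s + real DIM('a) * p s)"
  define q' where "q' = (\<lambda>s. 2 * s * p'' s + (2 + real DIM('a)) * p' s)"
  have dq: "(q has_real_derivative q' s) (at s)" for s
    unfolding q_def q'_def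
    by (rule DERIV_cong, rule DERIV_add[OF DERIV_mult[OF DERIV_cmult[OF DERIV_ident, of 2] p(2)] DERIV_cmult[OF p(1)]])
       (simp add: algebra_simps)
  have q0: "q s = 0" "q' s = 0" if "s \<ge> d" for s
    using p(5,6)[of s] that by (auto simp: q_def q'_def)
  have cq: "continuous_on UNIV q" "continuous_on UNIV q'"
    unfolding q_def q'_def by (auto intro!: ci)
  define C where "C = (LINT z|lborel. of_real (q (z \<bullet> z)) * ?u z)"
  have "C \<noteq> 0" unfolding C_def
  proof (rule integral_radial_exp_cform_neq_0[OF cq(1) q0(1) _ d(1,3)])
    show "q s > 0" if "s < d" for s
      using that p(6)[of s] p(7) d(1) by (simp add: q_def)
  qed
  have r1: "r + 1 \<ge> 0" using r by simp
  obtain \<phi> L r' where \<phi>: "has_laplacian \<phi> L" "continuous_on UNIV L"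
    "\<And>x. norm x \<le> r + 1 \<Longrightarrow> \<phi> x = ?u x" "\<And>x. norm x \<le> r + 1 \<Longrightarrow> L x = 0"
    "\<And>x. norm x > r' \<Longrightarrow> \<phi> x = 0" "\<And>x. norm x > r' \<Longrightarrow> L x = 0"
    by (rule exists_cutoff_exp[OF ab r1]) (rule that, assumption+)
  define k where "k = (\<lambda>x y :: 'a. p ((x - y) \<bullet> (x - y)) *\<^sub>R (x - y))"
  have ck: "continuous_on UNIV (\<lambda>z. k (fst z) (snd z))" "continuous_on UNIV (\<lambda>x. k x y)" for y
    unfolding k_def by (auto intro!: ci)

  have moment: "(LINT z|lborel. of_real (2 * (z \<bullet> c) * q' (z \<bullet> z)) * ?u z) = - (?Z c * C)" for c
  proof -
    have deriv: "has_dir_deriv c (\<lambda>z. of_real (q (z \<bullet> z)) * ?u z)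
        (\<lambda>z. of_real (q (z \<bullet> z)) * (?Z c * ?u z) + of_real (2 * (z \<bullet> c) * q' (z \<bullet> z)) * ?u z)"
      by (intro has_dir_deriv_mult has_dir_deriv_of_real has_dir_deriv_radial has_dir_deriv_exp_cform dq)
    have supp: "z \<bullet> z \<ge> d" if "norm z > 1" for z :: 'a
    proof -
      have "1\<^sup>2 \<le> (norm z)\<^sup>2" using that by (intro power_mono) auto
      then show ?thesis using d(2) by (simp add: power2_norm_eq_inner)
    qed
    have "(LINT z|lborel. of_real (q (z \<bullet> z)) * (?Z c * ?u z) + of_real (2 * (z \<bullet> c) * q' (z \<bullet> z)) * ?u z) = 0"
      by (rule integral_dir_deriv_eq_0[OF deriv, where r=1])
         (auto intro!: continuous_intros continuous_on_compose2[OF cq(1)] continuous_on_compose2[OF cq(2)] simp: q0 supp)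
    moreover have "integrable lborel (\<lambda>z. of_real (q (z \<bullet> z)) * ?u z)"
      by (rule integrable_continuous_bounded_support[where r=1])
         (auto intro!: continuous_intros continuous_on_compose2[OF cq(1)] simp: q0 supp)
    moreover have "integrable lborel (\<lambda>z. of_real (2 * (z \<bullet> c) * q' (z \<bullet> z)) * ?u z)"
      by (rule integrable_continuous_bounded_support[where r=1])
         (auto intro!: continuous_intros continuous_on_compose2[OF cq(2)] simp: q0 supp)
    ultimately have "?Z c * C + (LINT z|lborel. of_real (2 * (z \<bullet> c) * q' (z \<bullet> z)) * ?u z) = 0"
      by (simp add: C_def mult.left_commute[of _ "?Z c"])
    then show ?thesis by (simp add: eq_neg_iff_add_eq_0 add.commute)
  qed
  have rep: "(LINT x|lborel. of_real (k x y \<bullet> c) * L x) = - (?Z c * ?u y * C)"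
    if y: "norm y \<le> r" and c: "c \<in> Basis" for y c
  proof -
    let ?g = "\<lambda>z. complex_of_real (2 * (z \<bullet> c) * q' (z \<bullet> z))"
    have "has_laplacian (\<lambda>x. of_real (k x y \<bullet> c)) (\<lambda>x. ?g (x - y))"
      using has_laplacian_mult_radial[OF c p(1-3), of y]
      unfolding k_def q'_def inner_scaleR_left by (simp only: mult.commute[of "p _"])
    then have "(LINT x|lborel. of_real (k x y \<bullet> c) * L x) = (LINT x|lborel. ?g (x - y) * \<phi> x)"
      by (rule green_identity[OF _ \<phi>(1) \<phi>(5)])
    also have "\<dots> = (LINT x|lborel. ?g (x - y) * ?u x)"
    proof (intro Bochner_Integration.integral_cong refl)
      fix x
      show "?g (x - y) * \<phi> x = ?g (x - y) * ?u x"
      proof (cases "norm x \<le> r + 1")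
        case False
        have "norm x \<le> norm (x - y) + norm y"
          by (metis diff_add_cancel norm_triangle_ineq)
        then have "1 \<le> norm (x - y)" using False y by linarith
        then have "1\<^sup>2 \<le> (norm (x - y))\<^sup>2" by (intro power_mono) auto
        then have "(x - y) \<bullet> (x - y) \<ge> d" using d(2) by (simp add: power2_norm_eq_inner)
        then show ?thesis by (simp add: q0)
      qed (simp add: \<phi>)
    qed
    also have "\<dots> = (LINT z|lborel. ?g (z + y - y) * ?u (z + y))"
    proof -
      have "distr lborel borel (\<lambda>x. x + y) = lborel"
        using lborel_distr_plus[of y] by (subst add.commute) simp
      moreover have "(\<lambda>x. ?g (x - y) * ?u x) \<in> borel_measurable borel"
        by (intro borel_measurable_continuous_onI continuous_intros continuous_on_compose2[OF cq(2)]) auto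
      ultimately show ?thesis
        using integral_distr[of "\<lambda>x. x + y" lborel borel "\<lambda>x. ?g (x - y) * ?u x"] by simp
    qed
    also have "\<dots> = (LINT z|lborel. (?g z * ?u z) * ?u y)"
      by (simp add: linear_add[OF linear_cform] exp_add mult.assoc)
    also have "\<dots> = - (?Z c * C) * ?u y" by (simp only: integral_mult_left_zero moment)
    finally show ?thesis by (simp add: mult_ac)
  qed
  have "(LINT x|lborel. L x * of_real (LINT y|lborel. k x y \<bullet> F y)) = 0"
  proof (rule integral_eq_zero_AE, rule AE_I2)
    fix x
    show "L x * of_real (LINT y|lborel. k x y \<bullet> F y) = 0"
    proof (cases "norm x \<le> r + 1")
      case False
      have "k x y \<bullet> F y = norm (x - y) powr - real DIM('a) *\<^sub>R (x - y) \<bullet> F y" for y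
      proof (cases "norm y \<le> r")
        case True
        have "norm x \<le> norm (x - y) + norm y"
          by (metis diff_add_cancel norm_triangle_ineq)
        then have "1 \<le> norm (x - y)" using False True by linarith
        then have "1\<^sup>2 \<le> (norm (x - y))\<^sup>2" by (intro power_mono) auto
        then have "p ((x - y) \<bullet> (x - y)) = ((norm (x - y))\<^sup>2) powr (- real DIM('a) / 2)"
          using d(2) by (simp add: p(4) power2_norm_eq_inner)
        also have "\<dots> = norm (x - y) powr - real DIM('a)"
          using \<open>1 \<le> norm (x - y)\<close> by (simp add: powr_numeral[symmetric] powr_powr del: powr_numeral)
        finally show ?thesis by (simp add: k_def)
      qed (use F(3) in simp)
      then show ?thesis using pot[of x] False by simp
    qed (simp add: \<phi>)
  qed
  moreover have "(LINT x|lborel. L x * of_real (LINT y|lborel. k x y \<bullet> F y)) =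
      (LINT y|lborel. LINT x|lborel. L x * of_real (k x y \<bullet> F y))"
    by (rule fubini_continuous_kernel[where r="max r r'" and M=M]) (use \<phi> ck F in auto)
  moreover have "(LINT x|lborel. L x * of_real (k x y \<bullet> F y)) = - C * (?Z (F y) * ?u y)" for y
  proof (cases "norm y \<le> r")
    case True
    have "L x * of_real (k x y \<bullet> F y) = (\<Sum>c\<in>Basis. of_real (F y \<bullet> c) * (of_real (k x y \<bullet> c) * L x))" for x
      by (subst euclidean_inner) (simp add: sum_distrib_left sum_distrib_right mult_ac)
    then have "(LINT x|lborel. L x * of_real (k x y \<bullet> F y)) =
        (LINT x|lborel. (\<Sum>c\<in>Basis. of_real (F y \<bullet> c) * (of_real (k x y \<bullet> c) * L x)))"
      by simp
    also have "\<dots> = (\<Sum>c\<in>Basis. LINT x|lborel. of_real (F y \<bullet> c) * (of_real (k x y \<bullet> c) * L x))"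
      by (intro Bochner_Integration.integral_sum integrable_mult_right
          integrable_continuous_bounded_support[where r=r'] continuous_intros ck \<phi>(2)) (simp add: \<phi>)
    also have "\<dots> = (\<Sum>c\<in>Basis. of_real (F y \<bullet> c) * - (?Z c * ?u y * C))"
      by (intro sum.cong refl) (simp only: integral_mult_right_zero rep[OF True])
    also have "\<dots> = - C * (?Z (F y) * ?u y)"
      by (subst cform_expand[of a b "F y"]) (simp add: sum_distrib_left sum_distrib_right sum_negf mult_ac)
    finally show ?thesis .
  next
    case False
    then show ?thesis by (simp add: F(3) linear_0[OF linear_cform])
  qed
  ultimately have "- C * (LINT y|lborel. ?Z (F y) * ?u y) = 0"
    by (simp only: integral_mult_right_zero)
  with \<open>C \<noteq> 0\<close> show ?thesis by simp
qed

section \<open>Smooth functions and cutoffs by test functions\<close>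

text \<open>
  Smoothness is the largest class of differentiable functions that is closed under partial
  derivatives, which spares explicit formulas for iterated derivatives.
\<close>

lemma smooth_coinduct:
  assumes "u \<in> S" "\<And>v. v \<in> S \<Longrightarrow> v differentiable_on UNIV"
    "\<And>v b. v \<in> S \<Longrightarrow> b \<in> Basis \<Longrightarrow> partial b v \<in> S"
  shows "smooth u"
proof -
  have "foldr partial bs u \<in> S" if "bs \<in> lists Basis" for bs
    using that
  proof induction
    case Nil
    then show ?case by (simp add: assms(1))
  next
    case (Cons b bs)
    then show ?case using assms(3) by simp
  qed
  then show ?thesis unfolding smooth_def using assms(2) by blast
qed

lemma smooth_iterated:
  assumes "smooth u" "bs \<in> lists Basis"
  shows "foldr partial bs u differentiable_on UNIV"
  using assms by (simp only: smooth_def)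

lemma smooth_differentiable: "smooth u \<Longrightarrow> u differentiable at x"
  using smooth_iterated[of u "[]"] by (simp add: differentiable_on_def)

lemma smooth_partial:
  assumes "smooth u" "b \<in> Basis"
  shows "smooth (partial b u)"
proof -
  have "foldr partial (bs @ [b]) u differentiable_on UNIV" if "bs \<in> lists Basis" for bs
    using assms that by (intro smooth_iterated) auto
  then show ?thesis by (simp add: smooth_def)
qed

lemma partial_eq: "(u has_derivative D) (at x) \<Longrightarrow> partial b u x = D b"
  by (simp add: partial_def frechet_derivative_at[symmetric])

lemma differentiable_partial:
  assumes "u differentiable at x"
  shows "(u has_derivative (\<lambda>b. partial b u x)) (at x)"
  using assms unfolding partial_def by (simp add: frechet_derivative_works)

lemma smooth_has_derivative: "smooth u \<Longrightarrow> (u has_derivative (\<lambda>b. partial b u x)) (at x)"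
  by (intro differentiable_partial smooth_differentiable)

lemma smooth_continuous_on: "smooth u \<Longrightarrow> continuous_on UNIV u"
  by (meson continuous_at_imp_continuous_on differentiable_imp_continuous_within smooth_differentiable)

lemma smooth_const: "smooth (\<lambda>x. c)"
proof (rule smooth_coinduct[where S="range (\<lambda>c x. c)"])
  fix v :: "'a \<Rightarrow> 'b" and b :: 'a assume "v \<in> range (\<lambda>c x. c)"
  then obtain c where v: "v = (\<lambda>x. c)" by auto
  show "v differentiable_on UNIV" by (simp add: v)
  have "partial b v = (\<lambda>x. 0)" unfolding v by (rule ext, rule partial_eq) (rule has_derivative_const)
  then show "partial b v \<in> range (\<lambda>c x. c)" by auto
qed auto

lemma smooth_add:
  assumes "smooth u" "smooth v"
  shows "smooth (\<lambda>x. u x + v x)"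
proof (rule smooth_coinduct[where S="{\<lambda>x. u x + v x |u v. smooth u \<and> smooth v}"])
  fix w :: "'a \<Rightarrow> 'b" and b :: 'a assume "w \<in> {\<lambda>x. u x + v x |u v. smooth u \<and> smooth v}"
  then obtain u v where w: "w = (\<lambda>x. u x + v x)" and uv: "smooth u" "smooth v" by auto
  have d: "(w has_derivative (\<lambda>b. partial b u x + partial b v x)) (at x)" for x
    unfolding w by (intro has_derivative_add smooth_has_derivative uv)
  then show "w differentiable_on UNIV" by (auto simp: differentiable_on_def differentiable_def)
  assume "b \<in> Basis"
  then show "partial b w \<in> {\<lambda>x. u x + v x |u v. smooth u \<and> smooth v}"
    using partial_eq[OF d] smooth_partial uv by (auto intro!: exI ext)
qed (use assms in auto)

text \<open>
  Products of smooth functions are not closed under partial derivatives, but sums of products are.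
\<close>

inductive_set product_sums :: "('a::euclidean_space \<Rightarrow> real) set" where
  mult: "smooth u \<Longrightarrow> smooth v \<Longrightarrow> (\<lambda>x. u x * v x) \<in> product_sums"
| add: "f \<in> product_sums \<Longrightarrow> g \<in> product_sums \<Longrightarrow> (\<lambda>x. f x + g x) \<in> product_sums"

lemma smooth_mult:
  fixes u v :: "'a::euclidean_space \<Rightarrow> real"
  assumes "smooth u" "smooth v"
  shows "smooth (\<lambda>x. u x * v x)"
proof -
  have *: "f differentiable_on UNIV \<and> (\<forall>b\<in>Basis. partial b f \<in> product_sums)"
    if "f \<in> product_sums" for f :: "'a \<Rightarrow> real"
    using that
  proof induction
    case (mult u v)
    have d: "((\<lambda>x. u x * v x) has_derivative (\<lambda>b. u x * partial b v x + partial b u x * v x)) (at x)" for x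
      by (intro has_derivative_mult smooth_has_derivative mult)
    have "partial b (\<lambda>x. u x * v x) = (\<lambda>x. u x * partial b v x + partial b u x * v x)" for b
      by (rule ext) (rule partial_eq[OF d])
    moreover have "(\<lambda>x. u x * partial b v x + partial b u x * v x) \<in> product_sums" if "b \<in> Basis" for b
      using mult that by (intro product_sums.intros smooth_partial)
    ultimately show ?case
      using d by (auto simp: differentiable_on_def differentiable_def)
  next
    case (add f g)
    have d: "((\<lambda>x. f x + g x) has_derivative (\<lambda>b. partial b f x + partial b g x)) (at x)" for x
      using add.IH by (intro has_derivative_add differentiable_partial) (auto simp: differentiable_on_def)
    have "partial b (\<lambda>x. f x + g x) = (\<lambda>x. partial b f x + partial b g x)" for b
      by (rule ext) (rule partial_eq[OF d])
    then show ?case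
      using d add.IH by (auto simp: differentiable_on_def differentiable_def intro!: product_sums.add)
  qed
  show ?thesis
    by (rule smooth_coinduct[where S=product_sums]) (use * assms in \<open>auto intro: product_sums.mult\<close>)
qed

lemma smooth_prod:
  fixes u :: "'i \<Rightarrow> 'a::euclidean_space \<Rightarrow> real"
  assumes "\<And>i. i \<in> I \<Longrightarrow> smooth (u i)"
  shows "smooth (\<lambda>x. \<Prod>i\<in>I. u i x)"
proof (cases "finite I")
  case True
  then show ?thesis using assms
    by induction (auto intro: smooth_const smooth_mult)
qed (simp add: smooth_const)

lemma smooth_one_minus: "smooth (\<lambda>x. 1 - u x :: real)" if "smooth u"
  using smooth_add[OF smooth_const[of 1] smooth_mult[OF smooth_const[of "-1"] that]] by simp

text \<open>
  For \<open>P = 1\<close> this is the smooth function \<open>exp (- 1 / t)\<close> that is flat at 0; the polynomial factors in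
  \<open>1 / t\<close> are those that its derivatives produce.
\<close>

definition flat_exp :: "real poly \<Rightarrow> real \<Rightarrow> real" where
  "flat_exp P t = (if t > 0 then poly P (inverse t) * exp (- inverse t) else 0)"

lemma tendsto_poly_mult_exp_neg:
  "((\<lambda>w::real. poly P w * exp (- w)) \<longlongrightarrow> 0) at_top"
proof -
  have "((\<lambda>w::real. \<Sum>i\<le>degree P. coeff P i * (w ^ i / exp w)) \<longlongrightarrow> (\<Sum>i\<le>degree P. coeff P i * 0)) at_top"
    by (intro tendsto_sum tendsto_mult tendsto_const tendsto_power_div_exp_0)
  then show ?thesis by (simp add: poly_altdef exp_minus sum_divide_distrib divide_inverse[symmetric])
qed

text \<open>
  For \<open>t > 0\<close> both factors contribute \<open>1 / t\<^sup>2\<close> by the chain rule. At 0 the decay of the exponential beats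
  every polynomial in \<open>1 / t\<close>.
\<close>

lemma has_derivative_flat_exp:
  "(flat_exp P has_real_derivative flat_exp ([:0, 0, 1:] * (P - pderiv P)) t) (at t)"
proof -
  consider "t > 0" | "t < 0" | "t = 0" by linarith
  then show ?thesis
  proof cases
    case 1
    have "((\<lambda>t. poly P (inverse t) * exp (- inverse t)) has_real_derivative
        flat_exp ([:0, 0, 1:] * (P - pderiv P)) t) (at t)"
      using 1 by (auto intro!: derivative_eq_intros simp: flat_exp_def power2_eq_square algebra_simps)
    then show ?thesis
      by (rule has_field_derivative_transform_within_open[where S="{0<..}"]) (use 1 in \<open>auto simp: flat_exp_def\<close>)
  next
    case 2
    have "((\<lambda>t. 0) has_real_derivative flat_exp ([:0, 0, 1:] * (P - pderiv P)) t) (at t)"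
      using 2 by (auto simp: flat_exp_def)
    then show ?thesis
      by (rule has_field_derivative_transform_within_open[where S="{..<0}"]) (use 2 in \<open>auto simp: flat_exp_def\<close>)
  next
    case 3
    have "((\<lambda>h. flat_exp P h / h) \<longlongrightarrow> 0) (at_right 0)"
    proof -
      have "((\<lambda>h::real. poly (pCons 0 P) (inverse h) * exp (- inverse h)) \<longlongrightarrow> 0) (at_right 0)"
        by (rule filterlim_compose[OF tendsto_poly_mult_exp_neg filterlim_inverse_at_top_right])
      then show ?thesis
        by (rule Lim_transform_eventually)
           (auto simp: eventually_at_right_field flat_exp_def field_simps intro!: exI[of _ 1])
    qed
    moreover have "((\<lambda>h. flat_exp P h / h) \<longlongrightarrow> 0) (at_left 0)"
      by (rule Lim_transform_eventually[OF tendsto_const])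
         (auto simp: eventually_at_left_field flat_exp_def intro!: exI[of _ "-1"])
    ultimately have "((\<lambda>h. flat_exp P h / h) \<longlongrightarrow> 0) (at 0)"
      by (simp add: filterlim_split_at)
    then show ?thesis using 3 by (simp add: DERIV_def flat_exp_def)
  qed
qed

lemma smooth_flat_exp_affine:
  fixes k :: "'a::euclidean_space"
  shows "smooth (\<lambda>x. flat_exp P (s * (x \<bullet> k) + m))"
proof (rule smooth_coinduct[where S="range (\<lambda>(c, P) (x::'a). c * flat_exp P (s * (x \<bullet> k) + m))"])
  show "(\<lambda>x::'a. flat_exp P (s * (x \<bullet> k) + m)) \<in> range (\<lambda>(c, P) x. c * flat_exp P (s * (x \<bullet> k) + m))"
    by (rule range_eqI[of _ _ "(1, P)"]) simp
next
  fix v :: "'a \<Rightarrow> real" and b :: 'a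
  assume "v \<in> range (\<lambda>(c, P) x. c * flat_exp P (s * (x \<bullet> k) + m))"
  then obtain c P where v: "v = (\<lambda>x. c * flat_exp P (s * (x \<bullet> k) + m))" by auto
  let ?Q = "[:0, 0, 1:] * (P - pderiv P)"
  have d: "(v has_derivative (\<lambda>b. c * (s * (b \<bullet> k) * flat_exp ?Q (s * (x \<bullet> k) + m)))) (at x)" for x
  proof -
    have "((\<lambda>x. s * (x \<bullet> k) + m) has_derivative (\<lambda>b. s * (b \<bullet> k))) (at x)"
      by (auto intro!: derivative_eq_intros)
    then have "((\<lambda>x. flat_exp P (s * (x \<bullet> k) + m)) has_derivative
        (\<lambda>b. s * (b \<bullet> k) * flat_exp ?Q (s * (x \<bullet> k) + m))) (at x)"
      by (rule DERIV_compose_FDERIV[OF has_derivative_flat_exp])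
    then show ?thesis unfolding v by (rule has_derivative_mult_right)
  qed
  then show "v differentiable_on UNIV" by (auto simp: differentiable_on_def differentiable_def)
  have "partial b v = (\<lambda>x. (c * s * (b \<bullet> k)) * flat_exp ?Q (s * (x \<bullet> k) + m))"
    by (rule ext, subst partial_eq[OF d]) (simp add: mult_ac)
  then show "partial b v \<in> range (\<lambda>(c, P) x. c * flat_exp P (s * (x \<bullet> k) + m))"
    by (intro range_eqI[of _ _ "(c * s * (b \<bullet> k), ?Q)"]) simp
qed

definition box_bump :: "'a::euclidean_space \<Rightarrow> 'a \<Rightarrow> 'a \<Rightarrow> real" where
  "box_bump l u x = (\<Prod>k\<in>Basis. flat_exp 1 (x \<bullet> k - l \<bullet> k) * flat_exp 1 (u \<bullet> k - x \<bullet> k))"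

lemma smooth_box_bump: "smooth (box_bump l u)"
proof -
  have "smooth (\<lambda>x. \<Prod>k\<in>Basis. flat_exp 1 (1 * (x \<bullet> k) + (- (l \<bullet> k))) * flat_exp 1 ((-1) * (x \<bullet> k) + u \<bullet> k))"
    by (intro smooth_prod smooth_mult smooth_flat_exp_affine)
  also have "(\<lambda>x. \<Prod>k\<in>Basis. flat_exp 1 (1 * (x \<bullet> k) + (- (l \<bullet> k))) * flat_exp 1 ((-1) * (x \<bullet> k) + u \<bullet> k)) = box_bump l u"
    by (simp add: box_bump_def fun_eq_iff)
  finally show ?thesis .
qed

lemma flat_exp_1: "0 \<le> flat_exp 1 t" "flat_exp 1 t \<le> 1" "t > 0 \<Longrightarrow> flat_exp 1 t > 0" "t \<le> 0 \<Longrightarrow> flat_exp 1 t = 0"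
  by (auto simp: flat_exp_def)

lemma box_bump_bounds: "0 \<le> box_bump l u x" "box_bump l u x \<le> 1"
  unfolding box_bump_def
  by (auto intro!: prod_nonneg prod_le_1 mult_nonneg_nonneg mult_le_one flat_exp_1)

lemma box_bump_pos: "x \<in> box l u \<Longrightarrow> box_bump l u x > 0"
  unfolding box_bump_def by (intro prod_pos mult_pos_pos flat_exp_1) (auto simp: box_def)

lemma box_bump_eq_0: 
  assumes "x \<notin> box l u" shows "box_bump l u x = 0"
proof -
  obtain k where "k \<in> Basis" "x \<bullet> k \<le> l \<bullet> k \<or> u \<bullet> k \<le> x \<bullet> k"
    using assms by (force simp: box_def)
  then show ?thesis unfolding box_bump_def by (intro prod_zero bexI[of _ k]) (auto simp: flat_exp_1)
qed

text \<open>
  Cover \<open>\<Omega>\<close> by countably many boxes whose closures lie in \<open>\<Omega>\<close>. The \<open>n\<close>-th cutoff is one minus the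
  product over the first \<open>n\<close> boxes of \<open>(1 - bump) ^ n\<close>: the power drives every factor with a positive
  bump to zero.
\<close>

lemma exists_test_function_cutoffs:
  fixes \<Omega> :: "'a::euclidean_space set"
  assumes "open \<Omega>"
  obtains \<eta> :: "nat \<Rightarrow> 'a \<Rightarrow> real" where "\<And>n. \<eta> n \<in> test_functions \<Omega>"
    "\<And>n x. 0 \<le> \<eta> n x" "\<And>n x. \<eta> n x \<le> 1" "\<And>x. x \<in> \<Omega> \<Longrightarrow> (\<lambda>n. \<eta> n x) \<longlonglongrightarrow> 1"
proof (cases "\<Omega> = {}")
  case True
  show ?thesis
    by (rule that[of "\<lambda>n x. 0"]) (auto simp: True test_functions_def smooth_const)
next
  case False
  let ?D = "{(l, u). cbox l u \<subseteq> \<Omega>}"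
  have "open (case_prod box p)" for p :: "'a \<times> 'a" by (cases p) (simp add: open_box)
  then obtain \<F> where \<F>: "\<F> \<subseteq> case_prod box ` ?D" "countable \<F>" "\<Union>\<F> = \<Union>(case_prod box ` ?D)"
    by (rule_tac \<F>="case_prod box ` ?D" in Lindelof) auto
  have un: "\<Union>\<F> = \<Omega>"
  proof -
    have s1: "\<Union>(case_prod box ` ?D) \<subseteq> \<Omega>" using box_subset_cbox by fastforce
    have s2: "\<Omega> \<subseteq> \<Union>(case_prod box ` ?D)"
    proof
      fix x assume x: "x \<in> \<Omega>"
      obtain l u where "cbox l u \<subseteq> \<Omega>" "x \<in> box l u"
        using open_contains_cbox[OF assms x] by metis
      then show "x \<in> \<Union>(case_prod box ` ?D)" by blast
    qed
    show ?thesis by (simp only: \<F>(3) subset_antisym[OF s1 s2])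
  qed
  then have "\<F> \<noteq> {}" using False by auto
  have "\<forall>B\<in>\<F>. \<exists>p. B = case_prod box p \<and> case_prod cbox p \<subseteq> \<Omega>" using \<F>(1) by fastforce
  then obtain P where P: "\<And>B. B \<in> \<F> \<Longrightarrow> B = case_prod box (P B) \<and> case_prod cbox (P B) \<subseteq> \<Omega>"
    by metis
  define l where "l = (\<lambda>j. fst (P (from_nat_into \<F> j)))"
  define u where "u = (\<lambda>j. snd (P (from_nat_into \<F> j)))"
  have lu: "from_nat_into \<F> j = box (l j) (u j)" "cbox (l j) (u j) \<subseteq> \<Omega>" for j
    using P[OF from_nat_into[OF \<open>\<F> \<noteq> {}\<close>], of j] by (auto simp: l_def u_def split_beta)
  define \<eta> where "\<eta> = (\<lambda>n x. 1 - (\<Prod>j<n. \<Prod>i<n. 1 - box_bump (l j) (u j) x))"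
  have b: "0 \<le> 1 - box_bump l u x" "1 - box_bump l u x \<le> 1" for l u x :: 'a
    using box_bump_bounds[of l u x] by auto
  have supp: "closure {x. \<eta> n x \<noteq> 0} \<subseteq> (\<Union>j<n. cbox (l j) (u j))" for n
  proof (rule closure_minimal)
    show "{x. \<eta> n x \<noteq> 0} \<subseteq> (\<Union>j<n. cbox (l j) (u j))"
    proof (rule subsetI, rule ccontr)
      fix x assume x: "x \<in> {x. \<eta> n x \<noteq> 0}" "x \<notin> (\<Union>j<n. cbox (l j) (u j))"
      then have "box_bump (l j) (u j) x = 0" if "j < n" for j
        using that box_subset_cbox by (intro box_bump_eq_0) fastforce
      then show False using x(1) by (simp add: \<eta>_def)
    qed
  qed (auto intro: closed_UN)
  show ?thesis
  proof (rule that[of \<eta>])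
    show "\<eta> n \<in> test_functions \<Omega>" for n
    proof -
      have "smooth (\<eta> n)"
        unfolding \<eta>_def by (intro smooth_one_minus smooth_prod smooth_box_bump)
      moreover have "compact (closure {x. \<eta> n x \<noteq> 0})"
        using compact_Int_closed[OF compact_UN[of "{..<n}" "\<lambda>j. cbox (l j) (u j)"] closed_closure, of "{x. \<eta> n x \<noteq> 0}"]
        by (simp add: inf_absorb2[OF supp])
      moreover have "closure {x. \<eta> n x \<noteq> 0} \<subseteq> \<Omega>"
        using supp[of n] lu(2) by blast
      ultimately show ?thesis by (simp add: test_functions_def)
    qed
    show "0 \<le> \<eta> n x" "\<eta> n x \<le> 1" for n x
      using b by (auto simp: \<eta>_def intro!: prod_le_1 prod_nonneg power_le_one)
    show "(\<lambda>n. \<eta> n x) \<longlonglongrightarrow> 1" if x: "x \<in> \<Omega>" for x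
    proof -
      obtain B where B: "B \<in> \<F>" "x \<in> B" using un x by auto
      then obtain j where j: "B = from_nat_into \<F> j"
        using from_nat_into_surj[OF \<F>(2)] by metis
      let ?c = "1 - box_bump (l j) (u j) x"
      have c: "0 \<le> ?c" "?c < 1" using box_bump_pos[of x "l j" "u j"] b B j lu(1) by auto
      have "(\<lambda>n. \<Prod>j<n. \<Prod>i<n. 1 - box_bump (l j) (u j) x) \<longlonglongrightarrow> 0"
      proof (rule tendsto_sandwich[OF _ _ tendsto_const LIMSEQ_realpow_zero[OF c]])
        show "\<forall>\<^sub>F n in sequentially. 0 \<le> (\<Prod>j<n. \<Prod>i<n. 1 - box_bump (l j) (u j) x)"
          using b by (intro always_eventually allI prod_nonneg) auto
        show "\<forall>\<^sub>F n in sequentially. (\<Prod>j<n. \<Prod>i<n. 1 - box_bump (l j) (u j) x) \<le> ?c ^ n"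
          using eventually_gt_at_top[of j]
        proof eventually_elim
          case (elim n)
          have "(\<Prod>j<n. \<Prod>i<n. 1 - box_bump (l j) (u j) x) =
              (\<Prod>i<n. ?c) * (\<Prod>j\<in>{..<n} - {j}. \<Prod>i<n. 1 - box_bump (l j) (u j) x)"
            using elim by (subst prod.remove[of _ j]) auto
          also have "\<dots> \<le> (\<Prod>i<n. ?c) * 1"
            using b by (intro mult_left_mono prod_le_1 prod_nonneg) (auto intro!: power_le_one)
          finally show ?case by simp
        qed
      qed
      from tendsto_diff[OF tendsto_const[of 1] this] show ?thesis by (simp add: \<eta>_def)
    qed
  qed
qed

section \<open>Square integrable fields on bounded open sets\<close>

lemma continuous_on_bound:
  fixes w :: "'a::euclidean_space \<Rightarrow> 'b::real_normed_vector"
  assumes "continuous_on UNIV w" "bounded \<Omega>"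
  obtains B where "B > 0" "\<And>x. x \<in> \<Omega> \<Longrightarrow> norm (w x) \<le> B"
proof -
  have "compact (w ` closure \<Omega>)"
    using assms by (intro compact_continuous_image) (auto intro: continuous_on_subset)
  then have "bounded (w ` closure \<Omega>)" by (rule compact_imp_bounded)
  then obtain B where B: "B > 0" "\<forall>y\<in>w ` closure \<Omega>. norm y \<le> B"
    unfolding bounded_pos by blast
  show ?thesis
  proof (rule that[OF B(1)])
    show "norm (w x) \<le> B" if "x \<in> \<Omega>" for x
      using B(2) closure_subset[of \<Omega>] that by blast
  qed
qed

lemma continuous_measurable_lebesgue:
  fixes w :: "'a::euclidean_space \<Rightarrow> 'b::euclidean_space"
  shows "continuous_on UNIV w \<Longrightarrow> w \<in> borel_measurable lebesgue"
  by (intro measurable_completion) (simp add: borel_measurable_continuous_onI)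

lemma integrable_indicator_bounded_open:
  fixes \<Omega> :: "'a::euclidean_space set"
  assumes "open \<Omega>" "bounded \<Omega>"
  shows "integrable lebesgue (\<lambda>x. indicator \<Omega> x :: real)"
  using assms emeasure_bounded_finite[of \<Omega>] by (intro integrable_real_indicator) auto

lemma L2D:
  assumes "v \<in> L2 \<Omega>"
  shows "(\<lambda>x. indicator \<Omega> x *\<^sub>R v x) \<in> borel_measurable lebesgue"
    and "integrable lebesgue (\<lambda>x. indicator \<Omega> x *\<^sub>R (norm (v x))\<^sup>2)"
  using assms by (auto simp: L2_def set_borel_measurable_def set_integrable_def)

lemma continuous_in_L2:
  fixes w :: "'a::euclidean_space \<Rightarrow> 'b::euclidean_space"
  assumes \<Omega>: "open \<Omega>" "bounded \<Omega>" and w: "continuous_on UNIV w"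
  shows "w \<in> L2 \<Omega>"
proof -
  obtain B where B: "B > 0" "\<And>x. x \<in> \<Omega> \<Longrightarrow> norm (w x) \<le> B"
    using continuous_on_bound[OF w \<Omega>(2)] by blast
  have m: "w \<in> borel_measurable lebesgue" using w by (rule continuous_measurable_lebesgue)
  have \<Omega>m: "\<Omega> \<in> sets lebesgue" using \<Omega>(1) by auto
  have "integrable lebesgue (\<lambda>x. indicator \<Omega> x *\<^sub>R (norm (w x))\<^sup>2)"
  proof (rule Bochner_Integration.integrable_bound)
    show "integrable lebesgue (\<lambda>x. B\<^sup>2 * indicator \<Omega> x)"
      by (intro integrable_mult_right integrable_indicator_bounded_open \<Omega>)
    show "AE x in lebesgue. norm (indicator \<Omega> x *\<^sub>R (norm (w x))\<^sup>2) \<le> norm (B\<^sup>2 * indicator \<Omega> x)"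
      using B by (intro AE_I2) (auto simp: indicator_def power_mono)
  qed (intro borel_measurable_scaleR borel_measurable_power measurable_compose[OF _ borel_measurable_norm] m borel_measurable_indicator \<Omega>m)
  moreover have "(\<lambda>x. indicator \<Omega> x *\<^sub>R w x) \<in> borel_measurable lebesgue"
    by (intro borel_measurable_scaleR m borel_measurable_indicator \<Omega>m)
  ultimately show ?thesis by (simp add: L2_def set_borel_measurable_def set_integrable_def)
qed

lemma integrable_inner_L2:
  fixes w v :: "'a::euclidean_space \<Rightarrow> 'b::euclidean_space"
  assumes \<Omega>: "open \<Omega>" "bounded \<Omega>" and w: "continuous_on UNIV w" and v: "v \<in> L2 \<Omega>"
  shows "integrable lebesgue (\<lambda>x. indicator \<Omega> x *\<^sub>R (w x \<bullet> v x))"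
proof -
  obtain B where B: "B > 0" "\<And>x. x \<in> \<Omega> \<Longrightarrow> norm (w x) \<le> B"
    using continuous_on_bound[OF w \<Omega>(2)] by blast
  show ?thesis
  proof (rule Bochner_Integration.integrable_bound)
    show "integrable lebesgue (\<lambda>x. B * (indicator \<Omega> x + indicator \<Omega> x *\<^sub>R (norm (v x))\<^sup>2))"
      by (intro integrable_mult_right Bochner_Integration.integrable_add integrable_indicator_bounded_open \<Omega> L2D v)
    have "(\<lambda>x. w x \<bullet> (indicator \<Omega> x *\<^sub>R v x)) \<in> borel_measurable lebesgue"
      by (intro borel_measurable_inner continuous_measurable_lebesgue w L2D v)
    then show "(\<lambda>x. indicator \<Omega> x *\<^sub>R (w x \<bullet> v x)) \<in> borel_measurable lebesgue" by simp
    show "AE x in lebesgue. norm (indicator \<Omega> x *\<^sub>R (w x \<bullet> v x)) \<le>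
        norm (B * (indicator \<Omega> x + indicator \<Omega> x *\<^sub>R (norm (v x))\<^sup>2))"
    proof (intro AE_I2)
      fix x
      have t: "t \<le> 1 + t\<^sup>2" for t :: real
        using zero_le_power2[of "t - 1/2"] by (simp add: power2_eq_square algebra_simps)
      have "norm (w x \<bullet> v x) \<le> B * (1 + (norm (v x))\<^sup>2)" if "x \<in> \<Omega>"
      proof -
        have "norm (w x \<bullet> v x) \<le> norm (w x) * norm (v x)" by (simp add: Cauchy_Schwarz_ineq2)
        also have "\<dots> \<le> B * (1 + (norm (v x))\<^sup>2)" using B(1) B(2)[OF that] t by (intro mult_mono) auto
        finally show ?thesis .
      qed
      then show "norm (indicator \<Omega> x *\<^sub>R (w x \<bullet> v x)) \<le> norm (B * (indicator \<Omega> x + indicator \<Omega> x *\<^sub>R (norm (v x))\<^sup>2))"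
        using B(1) by (cases "x \<in> \<Omega>") auto
    qed
  qed
qed

text \<open>
  With \<open>B\<close> a bound for \<open>w\<close>, the estimate \<open>B s \<le> t B\<^sup>2 / 2 + s\<^sup>2 / (2 t)\<close> for \<open>s = norm (V n x - v x)\<close>
  bounds the limit integral by \<open>t\<close> times a constant plus a term that tends to zero, and \<open>t\<close> is
  arbitrary.
\<close>

lemma L2_limit_orthogonal:
  fixes w v :: "'a::euclidean_space \<Rightarrow> 'b::euclidean_space"
  assumes \<Omega>: "open \<Omega>" "bounded \<Omega>" and w: "continuous_on UNIV w" and v: "v \<in> L2 \<Omega>"
    and V: "\<And>n. V n \<in> L2 \<Omega>" and lim: "L2_tendsto \<Omega> V v"
    and orth: "\<And>n. (LINT x:\<Omega>|lebesgue. w x \<bullet> V n x) = 0"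
  shows "(LINT x:\<Omega>|lebesgue. w x \<bullet> v x) = 0"
proof -
  obtain B where B: "B > 0" "\<And>x. x \<in> \<Omega> \<Longrightarrow> norm (w x) \<le> B"
    using continuous_on_bound[OF w \<Omega>(2)] by blast
  define I where "I = \<bar>LINT x:\<Omega>|lebesgue. w x \<bullet> v x\<bar>"
  define m where "m = B\<^sup>2 * (LINT x|lebesgue. indicator \<Omega> x)"
  define D where "D = (\<lambda>n. LINT x:\<Omega>|lebesgue. (norm (V n x - v x))\<^sup>2)"
  have m: "m \<ge> 0" unfolding m_def by (intro mult_nonneg_nonneg Bochner_Integration.integral_nonneg) auto
  have intD: "integrable lebesgue (\<lambda>x. indicator \<Omega> x *\<^sub>R (norm (V n x - v x))\<^sup>2)" for n
  proof (rule Bochner_Integration.integrable_bound)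
    show "integrable lebesgue (\<lambda>x. 2 * (indicator \<Omega> x *\<^sub>R (norm (V n x))\<^sup>2) + 2 * (indicator \<Omega> x *\<^sub>R (norm (v x))\<^sup>2))"
      by (intro integrable_mult_right Bochner_Integration.integrable_add L2D v V)
    have "(\<lambda>x. (norm (indicator \<Omega> x *\<^sub>R V n x - indicator \<Omega> x *\<^sub>R v x))\<^sup>2) \<in> borel_measurable lebesgue"
      by (intro borel_measurable_power measurable_compose[OF _ borel_measurable_norm] borel_measurable_diff L2D v V)
    also have "(\<lambda>x. (norm (indicator \<Omega> x *\<^sub>R V n x - indicator \<Omega> x *\<^sub>R v x))\<^sup>2) =
        (\<lambda>x. indicator \<Omega> x *\<^sub>R (norm (V n x - v x))\<^sup>2)"
      by (auto simp: indicator_def fun_eq_iff)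
    finally show "(\<lambda>x. indicator \<Omega> x *\<^sub>R (norm (V n x - v x))\<^sup>2) \<in> borel_measurable lebesgue" .
    have "(norm (p - q))\<^sup>2 \<le> 2 * (norm p)\<^sup>2 + 2 * (norm q)\<^sup>2" for p q :: 'b
    proof -
      have "(norm (p - q))\<^sup>2 \<le> (norm p + norm q)\<^sup>2" by (intro power_mono norm_triangle_ineq4) auto
      also have "\<dots> \<le> 2 * (norm p)\<^sup>2 + 2 * (norm q)\<^sup>2"
        using zero_le_power2[of "norm p - norm q"] by (simp add: power2_eq_square algebra_simps)
      finally show ?thesis .
    qed
    then show "AE x in lebesgue. norm (indicator \<Omega> x *\<^sub>R (norm (V n x - v x))\<^sup>2) \<le>
        norm (2 * (indicator \<Omega> x *\<^sub>R (norm (V n x))\<^sup>2) + 2 * (indicator \<Omega> x *\<^sub>R (norm (v x))\<^sup>2))"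
      by (intro AE_I2) (auto simp: indicator_def)
  qed
  have bound: "I \<le> t * m / 2 + D n / (2 * t)" if t: "t > 0" for t n
  proof -
    have iv: "integrable lebesgue (\<lambda>x. indicator \<Omega> x *\<^sub>R (w x \<bullet> v x))"
      "integrable lebesgue (\<lambda>x. indicator \<Omega> x *\<^sub>R (w x \<bullet> V n x))"
      by (intro integrable_inner_L2 \<Omega> w v V)+
    have eq: "(LINT x:\<Omega>|lebesgue. w x \<bullet> v x) = (LINT x|lebesgue. indicator \<Omega> x *\<^sub>R (w x \<bullet> v x) - indicator \<Omega> x *\<^sub>R (w x \<bullet> V n x))"
      using iv orth[of n] by (simp add: set_lebesgue_integral_def)
    have "I \<le> (LINT x|lebesgue. norm (indicator \<Omega> x *\<^sub>R (w x \<bullet> v x) - indicator \<Omega> x *\<^sub>R (w x \<bullet> V n x)))"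
      unfolding I_def eq real_norm_def[symmetric] by (rule integral_norm_bound)
    also have "\<dots> \<le> (LINT x|lebesgue. t * B\<^sup>2 / 2 * indicator \<Omega> x + 1 / (2 * t) * (indicator \<Omega> x *\<^sub>R (norm (V n x - v x))\<^sup>2))"
    proof (rule integral_mono)
      show "integrable lebesgue (\<lambda>x. norm (indicator \<Omega> x *\<^sub>R (w x \<bullet> v x) - indicator \<Omega> x *\<^sub>R (w x \<bullet> V n x)))"
        using iv by (intro integrable_norm Bochner_Integration.integrable_diff)
      show "integrable lebesgue (\<lambda>x. t * B\<^sup>2 / 2 * indicator \<Omega> x + 1 / (2 * t) * (indicator \<Omega> x *\<^sub>R (norm (V n x - v x))\<^sup>2))"
        by (intro integrable_mult_right Bochner_Integration.integrable_add intD integrable_indicator_bounded_open \<Omega>)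
      fix x
      have "norm (w x \<bullet> v x - w x \<bullet> V n x) \<le> t * B\<^sup>2 / 2 + 1 / (2 * t) * (norm (V n x - v x))\<^sup>2" if "x \<in> \<Omega>"
      proof -
        let ?s = "norm (V n x - v x)"
        have "norm (w x \<bullet> v x - w x \<bullet> V n x) = \<bar>w x \<bullet> (V n x - v x)\<bar>"
          by (simp add: inner_diff_right abs_minus_commute)
        also have "\<dots> \<le> B * ?s"
          using Cauchy_Schwarz_ineq2[of "w x" "V n x - v x"] mult_right_mono[OF B(2)[OF that], of ?s] by simp
        also have "\<dots> \<le> t * B\<^sup>2 / 2 + 1 / (2 * t) * ?s\<^sup>2"
        proof -
          have "0 \<le> (t * B - ?s)\<^sup>2 / (2 * t)" using t by simp
          also have "\<dots> = t * B\<^sup>2 / 2 + 1 / (2 * t) * ?s\<^sup>2 - B * ?s"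
            using t by (simp add: power2_eq_square field_simps)
          finally show ?thesis by simp
        qed
        finally show ?thesis .
      qed
      then show "norm (indicator \<Omega> x *\<^sub>R (w x \<bullet> v x) - indicator \<Omega> x *\<^sub>R (w x \<bullet> V n x)) \<le>
          t * B\<^sup>2 / 2 * indicator \<Omega> x + 1 / (2 * t) * (indicator \<Omega> x *\<^sub>R (norm (V n x - v x))\<^sup>2)"
        by (cases "x \<in> \<Omega>") auto
    qed
    also have "\<dots> = t * m / 2 + D n / (2 * t)"
      using intD[of n] integrable_indicator_bounded_open[OF \<Omega>]
      by (simp add: m_def D_def set_lebesgue_integral_def)
    finally show ?thesis .
  qed
  have bound': "I \<le> t * m / 2" if t: "t > 0" for t
  proof (rule LIMSEQ_le_const)
    have "(\<lambda>n. t * m / 2 + D n / (2 * t)) \<longlonglongrightarrow> t * m / 2 + 0 / (2 * t)"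
      using lim t unfolding D_def L2_tendsto_def by (intro tendsto_intros) auto
    then show "(\<lambda>n. t * m / 2 + D n / (2 * t)) \<longlonglongrightarrow> t * m / 2" by simp
  qed (use bound[OF t] in auto)
  have "I \<le> 0"
  proof (rule ccontr)
    assume I: "\<not> I \<le> 0"
    define X where "X = I / (m + 1) * m"
    have "I \<le> X / 2" unfolding X_def using I m by (intro bound') auto
    moreover have "X \<le> I" unfolding X_def using I m by (simp add: field_simps)
    ultimately show False using I by linarith
  qed
  then show ?thesis by (simp add: I_def)
qed

section \<open>Fields orthogonal to gradients of harmonic functions\<close>

lemma smooth_has_dir_deriv:
  assumes "smooth u"
  shows "has_dir_deriv b u (partial b u)"
  unfolding has_dir_deriv_def
proof
  fix x
  have "((\<lambda>t. x + t *\<^sub>R b) has_derivative (\<lambda>t. t *\<^sub>R b)) (at (0::real))"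
    by (auto intro!: derivative_eq_intros)
  moreover have u: "(u has_derivative (\<lambda>b. partial b u x)) (at x)"
    by (rule smooth_has_derivative[OF assms])
  ultimately have "((\<lambda>t. u (x + t *\<^sub>R b)) has_derivative (\<lambda>t. partial (t *\<^sub>R b) u x)) (at 0)"
    using has_derivative_compose[of "\<lambda>t. x + t *\<^sub>R b" "\<lambda>t. t *\<^sub>R b" 0 UNIV u "\<lambda>b. partial b u x"] by simp
  moreover have "partial (t *\<^sub>R b) u x = t *\<^sub>R partial b u x" for t
    by (rule linear_scale[OF has_derivative_linear[OF u]])
  ultimately show "((\<lambda>t. u (x + t *\<^sub>R b)) has_vector_derivative partial b u x) (at 0)"
    by (simp add: has_vector_derivative_def)
qed

lemma test_function_outside:
  assumes "\<phi> \<in> test_functions \<Omega>" "x \<notin> \<Omega>"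
  shows "\<phi> x = 0" "partial b \<phi> x = 0"
proof -
  let ?S = "closure {x. \<phi> x \<noteq> 0}"
  have x: "x \<in> - ?S" using assms by (auto simp: test_functions_def)
  have z: "\<phi> y = 0" if "y \<in> - ?S" for y
    using that closure_subset[of "{x. \<phi> x \<noteq> 0}"] by blast
  show "\<phi> x = 0" using z[OF x] .
  have "(\<phi> has_derivative (\<lambda>b. 0)) (at x)"
  proof (rule has_derivative_transform_within_open[OF has_derivative_const[where c=0] _ x])
    show "open (- ?S)" by (intro open_Compl closed_closure)
    show "0 = \<phi> y" if "y \<in> - ?S" for y using z[OF that] by (rule sym)
  qed
  then show "partial b \<phi> x = 0" by (rule partial_eq)
qed

lemma test_function_bounded_support:
  assumes "\<phi> \<in> test_functions \<Omega>"
  obtains r where "\<And>x :: 'a::euclidean_space. norm x > r \<Longrightarrow> \<phi> x = 0"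
proof -
  have "bounded (closure {x. \<phi> x \<noteq> 0})"
    using assms by (auto simp: test_functions_def compact_imp_bounded)
  then obtain r where r: "\<forall>x\<in>closure {x. \<phi> x \<noteq> 0}. norm x \<le> r" by (auto simp: bounded_iff)
  show ?thesis
  proof (rule that[of r])
    fix x :: 'a assume "norm x > r"
    then have "x \<notin> closure {x. \<phi> x \<noteq> 0}" using r by auto
    then show "\<phi> x = 0" using closure_subset[of "{x. \<phi> x \<noteq> 0}"] by blast
  qed
qed

lemma grad_inner_Basis: "b \<in> Basis \<Longrightarrow> grad w x \<bullet> b = partial b w x"
  by (simp add: grad_def inner_sum_left inner_Basis sum.delta' if_distrib cong: if_cong)

lemma continuous_on_grad: "smooth w \<Longrightarrow> continuous_on UNIV (grad w)"
  unfolding grad_def by (intro continuous_intros smooth_continuous_on smooth_partial)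

lemma set_lebesgue_integral_eq_lborel:
  fixes h :: "'a::euclidean_space \<Rightarrow> real"
  assumes "continuous_on UNIV h" "\<And>x. x \<notin> \<Omega> \<Longrightarrow> h x = 0"
  shows "(LINT x:\<Omega>|lebesgue. h x) = (LINT x|lborel. h x)"
proof -
  have "(\<lambda>x. indicator \<Omega> x *\<^sub>R h x) = h" using assms(2) by (auto simp: fun_eq_iff indicator_def)
  then show ?thesis
    using assms(1) unfolding set_lebesgue_integral_def
    by (simp add: integral_completion borel_measurable_continuous_onI)
qed

lemma integral_sum_dir_deriv_eq_0:
  fixes F D :: "'a::euclidean_space \<Rightarrow> 'a \<Rightarrow> real"
  assumes "\<And>b. b \<in> Basis \<Longrightarrow> has_dir_deriv b (F b) (D b)"
    and "\<And>b. b \<in> Basis \<Longrightarrow> continuous_on UNIV (F b)" "\<And>b. b \<in> Basis \<Longrightarrow> continuous_on UNIV (D b)"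
    and supp: "\<And>b x. b \<in> Basis \<Longrightarrow> norm x > r \<Longrightarrow> F b x = 0"
  shows "(LINT x|lborel. (\<Sum>b\<in>Basis. D b x)) = 0"
proof -
  have int: "integrable lborel (D b)" if b: "b \<in> Basis" for b
  proof (rule integrable_continuous_bounded_support[OF assms(3)[OF b]])
    show "D b x = 0" if "norm x > r" for x
      by (rule has_dir_deriv_eq_0_outside[OF assms(1)[OF b] supp[OF b] that])
  qed
  have "(LINT x|lborel. (\<Sum>b\<in>Basis. D b x)) = (\<Sum>b\<in>Basis. LINT x|lborel. D b x)"
    by (rule Bochner_Integration.integral_sum) (rule int)
  also have "\<dots> = 0"
  proof (rule sum.neutral, rule ballI)
    fix b :: 'a assume b: "b \<in> Basis"
    show "(LINT x|lborel. D b x) = 0"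
      by (rule integral_dir_deriv_eq_0[OF assms(1-3)[OF b] supp[OF b]])
  qed
  finally show ?thesis .
qed

text \<open>
  Integrating by parts moves the second gradient onto the first one and produces the Laplacian of
  \<open>w\<close>.
\<close>

lemma integral_grad_harmonic_inner_grad_test:
  fixes w \<phi> :: "'a::euclidean_space \<Rightarrow> real"
  assumes w: "smooth w" "\<And>x. laplacian w x = 0" and \<phi>: "\<phi> \<in> test_functions \<Omega>"
  shows "(LINT x:\<Omega>|lebesgue. grad w x \<bullet> grad \<phi> x) = 0"
proof -
  have s\<phi>: "smooth \<phi>" using \<phi> by (simp add: test_functions_def)
  obtain r where r: "\<And>x. norm x > r \<Longrightarrow> \<phi> x = 0"
    by (rule test_function_bounded_support[OF \<phi>]) (rule that, assumption+)
  have "(LINT x|lborel. (\<Sum>b\<in>Basis. partial b w x * partial b \<phi> x + partial b (partial b w) x * \<phi> x)) = 0"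
  proof (rule integral_sum_dir_deriv_eq_0[where F="\<lambda>b x. partial b w x * \<phi> x" and r=r])
    fix b :: 'a assume b: "b \<in> Basis"
    have "((\<lambda>t. partial b w (x + t *\<^sub>R b) * \<phi> (x + t *\<^sub>R b)) has_vector_derivative
        partial b w x * partial b \<phi> x + partial b (partial b w) x * \<phi> x) (at 0)" for x
      using has_vector_derivative_mult[of "\<lambda>t. partial b w (x + t *\<^sub>R b)" "partial b (partial b w) x" 0 UNIV
          "\<lambda>t. \<phi> (x + t *\<^sub>R b)" "partial b \<phi> x"]
        smooth_has_dir_deriv[OF s\<phi>, of b] smooth_has_dir_deriv[OF smooth_partial[OF w(1) b], of b]
      by (simp add: has_dir_deriv_def)
    then show "has_dir_deriv b (\<lambda>x. partial b w x * \<phi> x)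
        (\<lambda>x. partial b w x * partial b \<phi> x + partial b (partial b w) x * \<phi> x)"
      by (simp add: has_dir_deriv_def)
    show "continuous_on UNIV (\<lambda>x. partial b w x * \<phi> x)"
      "continuous_on UNIV (\<lambda>x. partial b w x * partial b \<phi> x + partial b (partial b w) x * \<phi> x)"
      by (intro continuous_intros smooth_continuous_on[OF w(1)] smooth_continuous_on[OF s\<phi>]
          smooth_continuous_on[OF smooth_partial[OF w(1) b]] smooth_continuous_on[OF smooth_partial[OF s\<phi> b]]
          smooth_continuous_on[OF smooth_partial[OF smooth_partial[OF w(1) b] b]])+
    show "partial b w x * \<phi> x = 0" if "norm x > r" for x
      using r[OF that] by simp
  qed
  moreover have "(\<Sum>b\<in>Basis. partial b w x * partial b \<phi> x + partial b (partial b w) x * \<phi> x) = grad w x \<bullet> grad \<phi> x" for x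
  proof -
    have "(\<Sum>b\<in>Basis. partial b (partial b w) x * \<phi> x) = 0"
      using w(2)[of x] by (simp add: sum_distrib_right[symmetric] laplacian_def)
    moreover have "grad w x \<bullet> grad \<phi> x = (\<Sum>b\<in>Basis. partial b w x * partial b \<phi> x)"
      by (subst euclidean_inner) (simp add: grad_inner_Basis)
    ultimately show ?thesis by (simp add: sum.distrib)
  qed
  ultimately have "(LINT x|lborel. grad w x \<bullet> grad \<phi> x) = 0" by simp
  moreover have "(LINT x:\<Omega>|lebesgue. grad w x \<bullet> grad \<phi> x) = (LINT x|lborel. grad w x \<bullet> grad \<phi> x)"
    by (rule set_lebesgue_integral_eq_lborel)
       (intro continuous_on_inner continuous_on_grad w(1) s\<phi>,
        simp add: grad_def[of \<phi>] test_function_outside[OF \<phi>])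
  ultimately show ?thesis by simp
qed

text \<open>
  Integrating by parts moves the gradient off \<open>w\<close> and produces the divergence of \<open>\<phi>\<close>.
\<close>

lemma integral_grad_inner_div_free_test:
  fixes w :: "'a::euclidean_space \<Rightarrow> real" and \<phi> :: "'a \<Rightarrow> 'a"
  assumes w: "smooth w" and \<phi>: "\<phi> \<in> test_functions \<Omega>" "\<And>x. divergence \<phi> x = 0"
  shows "(LINT x:\<Omega>|lebesgue. grad w x \<bullet> \<phi> x) = 0"
proof -
  have s\<phi>: "smooth \<phi>" using \<phi> by (simp add: test_functions_def)
  obtain r where r: "\<And>x. norm x > r \<Longrightarrow> \<phi> x = 0"
    by (rule test_function_bounded_support[OF \<phi>(1)]) (rule that, assumption+)
  have "(LINT x|lborel. (\<Sum>b\<in>Basis. w x * (partial b \<phi> x \<bullet> b) + partial b w x * (\<phi> x \<bullet> b))) = 0"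
  proof (rule integral_sum_dir_deriv_eq_0[where F="\<lambda>b x. w x * (\<phi> x \<bullet> b)" and r=r])
    fix b :: 'a assume b: "b \<in> Basis"
    have "((\<lambda>t. w (x + t *\<^sub>R b) * (\<phi> (x + t *\<^sub>R b) \<bullet> b)) has_vector_derivative
        w x * (partial b \<phi> x \<bullet> b) + partial b w x * (\<phi> x \<bullet> b)) (at 0)" for x
    proof -
      have "((\<lambda>t. \<phi> (x + t *\<^sub>R b) \<bullet> b) has_vector_derivative partial b \<phi> x \<bullet> b) (at 0)"
        using smooth_has_dir_deriv[OF s\<phi>, of b]
        by (intro bounded_linear.has_vector_derivative[OF bounded_linear_inner_left]) (simp add: has_dir_deriv_def)
      then show ?thesis
        using has_vector_derivative_mult[of "\<lambda>t. w (x + t *\<^sub>R b)" "partial b w x" 0 UNIV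
            "\<lambda>t. \<phi> (x + t *\<^sub>R b) \<bullet> b" "partial b \<phi> x \<bullet> b"]
          smooth_has_dir_deriv[OF w, of b]
        by (simp add: has_dir_deriv_def)
    qed
    then show "has_dir_deriv b (\<lambda>x. w x * (\<phi> x \<bullet> b)) (\<lambda>x. w x * (partial b \<phi> x \<bullet> b) + partial b w x * (\<phi> x \<bullet> b))"
      by (simp add: has_dir_deriv_def)
    show "continuous_on UNIV (\<lambda>x. w x * (\<phi> x \<bullet> b))"
      "continuous_on UNIV (\<lambda>x. w x * (partial b \<phi> x \<bullet> b) + partial b w x * (\<phi> x \<bullet> b))"
      by (intro continuous_intros smooth_continuous_on[OF w] smooth_continuous_on[OF s\<phi>]
          smooth_continuous_on[OF smooth_partial[OF w b]] smooth_continuous_on[OF smooth_partial[OF s\<phi> b]])+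
    show "w x * (\<phi> x \<bullet> b) = 0" if "norm x > r" for x
      using r[OF that] by simp
  qed
  moreover have "(\<Sum>b\<in>Basis. w x * (partial b \<phi> x \<bullet> b) + partial b w x * (\<phi> x \<bullet> b)) = grad w x \<bullet> \<phi> x" for x
  proof -
    have "(\<Sum>b\<in>Basis. w x * (partial b \<phi> x \<bullet> b)) = 0"
      using \<phi>(2)[of x] by (simp add: sum_distrib_left[symmetric] divergence_def)
    moreover have "grad w x \<bullet> \<phi> x = (\<Sum>b\<in>Basis. partial b w x * (\<phi> x \<bullet> b))"
      by (subst euclidean_inner) (simp add: grad_inner_Basis)
    ultimately show ?thesis by (simp add: sum.distrib)
  qed
  ultimately have "(LINT x|lborel. grad w x \<bullet> \<phi> x) = 0" by simp
  moreover have "(LINT x:\<Omega>|lebesgue. grad w x \<bullet> \<phi> x) = (LINT x|lborel. grad w x \<bullet> \<phi> x)"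
    by (rule set_lebesgue_integral_eq_lborel)
       (auto simp: test_function_outside[OF \<phi>(1)] intro!: continuous_on_inner smooth_continuous_on[OF s\<phi>] continuous_on_grad w)
  ultimately show ?thesis by simp
qed

text \<open>
  Weak gradients of the same function have equal integrals against test functions. The cutoffs extend
  this to smooth functions that do not vanish near the boundary. It is needed because the weak gradient
  in \<^const>\<open>gradients\<close> and the limit of gradients in \<^const>\<open>H1_0\<close> may be different representatives.
\<close>

lemma weak_gradient_unique_smooth:
  fixes g G :: "'a::euclidean_space \<Rightarrow> 'a"
  assumes \<Omega>: "open \<Omega>" "bounded \<Omega>" and g: "g \<in> L2 \<Omega>" "weak_gradient \<Omega> u g"
    and G: "G \<in> L2 \<Omega>" "weak_gradient \<Omega> u G" and \<psi>: "smooth \<psi>" and b: "b \<in> Basis"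
  shows "(LINT x:\<Omega>|lebesgue. (g x \<bullet> b) * \<psi> x) = (LINT x:\<Omega>|lebesgue. (G x \<bullet> b) * \<psi> x)"
proof -
  obtain \<eta> :: "nat \<Rightarrow> 'a \<Rightarrow> real" where \<eta>: "\<And>n. \<eta> n \<in> test_functions \<Omega>"
    "\<And>n x. 0 \<le> \<eta> n x" "\<And>n x. \<eta> n x \<le> 1" "\<And>x. x \<in> \<Omega> \<Longrightarrow> (\<lambda>n. \<eta> n x) \<longlonglongrightarrow> 1"
    by (rule exists_test_function_cutoffs[OF \<Omega>(1)]) (rule that, assumption+)
  have s\<eta>: "smooth (\<eta> n)" for n using \<eta>(1)[of n] by (simp add: test_functions_def)
  have test: "(\<lambda>x. \<eta> n x * \<psi> x) \<in> test_functions \<Omega>" for n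
  proof -
    have sub: "closure {x. \<eta> n x * \<psi> x \<noteq> 0} \<subseteq> closure {x. \<eta> n x \<noteq> 0}"
      by (intro closure_mono) auto
    have c: "compact (closure {x. \<eta> n x \<noteq> 0})" "closure {x. \<eta> n x \<noteq> 0} \<subseteq> \<Omega>"
      using \<eta>(1)[of n] by (auto simp: test_functions_def)
    have "compact (closure {x. \<eta> n x * \<psi> x \<noteq> 0})"
      using compact_Int_closed[OF c(1) closed_closure, of "{x. \<eta> n x * \<psi> x \<noteq> 0}"] by (simp only: inf_absorb2[OF sub])
    then show ?thesis
      using sub c(2) smooth_mult[OF s\<eta> \<psi>] by (simp add: test_functions_def)
  qed
  have lim: "(\<lambda>n. LINT x:\<Omega>|lebesgue. (v x \<bullet> b) * (\<eta> n x * \<psi> x)) \<longlonglongrightarrow> (LINT x:\<Omega>|lebesgue. (v x \<bullet> b) * \<psi> x)"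
    if v: "v \<in> L2 \<Omega>" for v
    unfolding set_lebesgue_integral_def
  proof (rule integral_dominated_convergence[where w="\<lambda>x. norm (indicator \<Omega> x *\<^sub>R ((\<psi> x *\<^sub>R b) \<bullet> v x))"])
    have int: "integrable lebesgue (\<lambda>x. indicator \<Omega> x *\<^sub>R ((\<psi> x *\<^sub>R b) \<bullet> v x))"
      by (intro integrable_inner_L2 \<Omega> v continuous_intros smooth_continuous_on \<psi>)
    then show "integrable lebesgue (\<lambda>x. norm (indicator \<Omega> x *\<^sub>R ((\<psi> x *\<^sub>R b) \<bullet> v x)))"
      by (rule integrable_norm)
    have eq: "(\<lambda>x. indicator \<Omega> x *\<^sub>R ((\<psi> x *\<^sub>R b) \<bullet> v x)) = (\<lambda>x. indicator \<Omega> x *\<^sub>R ((v x \<bullet> b) * \<psi> x))"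
      by (simp add: fun_eq_iff inner_commute)
    show "(\<lambda>x. indicator \<Omega> x *\<^sub>R ((v x \<bullet> b) * \<psi> x)) \<in> borel_measurable lebesgue"
      using borel_measurable_integrable[OF int] unfolding eq .
    have "integrable lebesgue (\<lambda>x. indicator \<Omega> x *\<^sub>R (((\<eta> n x * \<psi> x) *\<^sub>R b) \<bullet> v x))" for n
      by (intro integrable_inner_L2 \<Omega> v continuous_intros smooth_continuous_on \<psi> s\<eta>)
    from borel_measurable_integrable[OF this]
    show "(\<lambda>x. indicator \<Omega> x *\<^sub>R ((v x \<bullet> b) * (\<eta> n x * \<psi> x))) \<in> borel_measurable lebesgue" for n
      by (simp add: inner_commute mult_ac)
    show "AE x in lebesgue. (\<lambda>n. indicator \<Omega> x *\<^sub>R ((v x \<bullet> b) * (\<eta> n x * \<psi> x))) \<longlonglongrightarrow> indicator \<Omega> x *\<^sub>R ((v x \<bullet> b) * \<psi> x)"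
    proof (rule AE_I2)
      fix x
      show "(\<lambda>n. indicator \<Omega> x *\<^sub>R ((v x \<bullet> b) * (\<eta> n x * \<psi> x))) \<longlonglongrightarrow> indicator \<Omega> x *\<^sub>R ((v x \<bullet> b) * \<psi> x)"
      proof (cases "x \<in> \<Omega>")
        case True
        have "(\<lambda>n. (v x \<bullet> b) * (\<eta> n x * \<psi> x)) \<longlonglongrightarrow> (v x \<bullet> b) * (1 * \<psi> x)"
          by (intro tendsto_intros \<eta>(4) True)
        then show ?thesis using True by simp
      qed simp
    qed
    show "AE x in lebesgue. norm (indicator \<Omega> x *\<^sub>R ((v x \<bullet> b) * (\<eta> n x * \<psi> x))) \<le>
        norm (indicator \<Omega> x *\<^sub>R ((\<psi> x *\<^sub>R b) \<bullet> v x))" for n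
    proof (rule AE_I2)
      fix x
      have "\<bar>\<eta> n x\<bar> * (\<bar>v x \<bullet> b\<bar> * \<bar>\<psi> x\<bar>) \<le> 1 * (\<bar>v x \<bullet> b\<bar> * \<bar>\<psi> x\<bar>)"
        using \<eta>(2,3)[of n x] by (intro mult_right_mono) auto
      then show "norm (indicator \<Omega> x *\<^sub>R ((v x \<bullet> b) * (\<eta> n x * \<psi> x))) \<le>
          norm (indicator \<Omega> x *\<^sub>R ((\<psi> x *\<^sub>R b) \<bullet> v x))"
        by (simp add: indicator_def abs_mult inner_commute mult_ac)
    qed
  qed
  have "(LINT x:\<Omega>|lebesgue. (g x \<bullet> b) * (\<eta> n x * \<psi> x)) = (LINT x:\<Omega>|lebesgue. (G x \<bullet> b) * (\<eta> n x * \<psi> x))" for n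
  proof -
    have "(LINT x:\<Omega>|lebesgue. u x * partial b (\<lambda>x. \<eta> n x * \<psi> x) x) = - (LINT x:\<Omega>|lebesgue. (v x \<bullet> b) * (\<eta> n x * \<psi> x))"
      if "weak_gradient \<Omega> u v" for v
      by (rule that[unfolded weak_gradient_def, THEN bspec, OF test, THEN bspec, OF b])
    from this[OF g(2)] this[OF G(2)] show ?thesis by simp
  qed
  with lim[OF g(1)] have "(\<lambda>n. LINT x:\<Omega>|lebesgue. (G x \<bullet> b) * (\<eta> n x * \<psi> x)) \<longlonglongrightarrow> (LINT x:\<Omega>|lebesgue. (g x \<bullet> b) * \<psi> x)"
    by simp
  from LIMSEQ_unique[OF this lim[OF G(1)]] show ?thesis .
qed

lemma integral_grad_inner_eq_sum:
  fixes w :: "'a::euclidean_space \<Rightarrow> real"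
  assumes \<Omega>: "open \<Omega>" "bounded \<Omega>" and w: "smooth w" and v: "v \<in> L2 \<Omega>"
  shows "(LINT x:\<Omega>|lebesgue. grad w x \<bullet> v x) = (\<Sum>b\<in>Basis. LINT x:\<Omega>|lebesgue. (v x \<bullet> b) * partial b w x)"
proof -
  have "(\<lambda>x. indicator \<Omega> x *\<^sub>R (grad w x \<bullet> v x)) =
      (\<lambda>x. \<Sum>b\<in>Basis. indicator \<Omega> x *\<^sub>R ((partial b w x *\<^sub>R b) \<bullet> v x))"
    by (simp add: grad_def inner_sum_left sum_distrib_left fun_eq_iff)
  then have "(LINT x:\<Omega>|lebesgue. grad w x \<bullet> v x) =
      (LINT x|lebesgue. (\<Sum>b\<in>Basis. indicator \<Omega> x *\<^sub>R ((partial b w x *\<^sub>R b) \<bullet> v x)))"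
    by (simp add: set_lebesgue_integral_def)
  also have "\<dots> = (\<Sum>b\<in>Basis. LINT x|lebesgue. indicator \<Omega> x *\<^sub>R ((partial b w x *\<^sub>R b) \<bullet> v x))"
    by (intro Bochner_Integration.integral_sum integrable_inner_L2 \<Omega> v continuous_intros
        smooth_continuous_on smooth_partial w)
  finally show ?thesis by (simp add: set_lebesgue_integral_def inner_commute mult_ac)
qed

lemma integral_grad_harmonic_eq_0_if_no_harmonic_component:
  fixes w :: "'a::euclidean_space \<Rightarrow> real" and f :: "'a \<Rightarrow> 'a"
  assumes \<Omega>: "open \<Omega>" "bounded \<Omega>" and w: "smooth w" "\<And>x. laplacian w x = 0"
    and dec: "helmholtz_hodge_decomposition \<Omega> f g h v"
    and h: "AE x in lebesgue. x \<in> \<Omega> \<longrightarrow> h x = 0"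
    and f: "f \<in> borel_measurable lebesgue"
  shows "(LINT x:\<Omega>|lebesgue. grad w x \<bullet> f x) = 0"
proof -
  note cg = continuous_on_grad[OF w(1)]
  have "g \<in> gradients \<Omega> (H1_0 \<Omega>)" using dec by (simp add: helmholtz_hodge_decomposition_def)
  then obtain u where gL: "g \<in> L2 \<Omega>" and u: "u \<in> H1_0 \<Omega>" and wg: "weak_gradient \<Omega> u g"
    unfolding gradients_def by blast
  from u obtain G \<phi> where GL: "G \<in> L2 \<Omega>" and wG: "weak_gradient \<Omega> u G"
    and \<phi>: "range \<phi> \<subseteq> test_functions \<Omega>" and lim: "L2_tendsto \<Omega> (\<lambda>n. grad (\<phi> n)) G"
    unfolding H1_0_def by blast
  have \<phi>n: "\<phi> n \<in> test_functions \<Omega>" for n using \<phi> by auto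
  have "(LINT x:\<Omega>|lebesgue. grad w x \<bullet> G x) = 0"
  proof (rule L2_limit_orthogonal[OF \<Omega> cg GL _ lim])
    show "grad (\<phi> n) \<in> L2 \<Omega>" for n
      using \<phi>n[of n] by (intro continuous_in_L2 \<Omega> continuous_on_grad) (simp add: test_functions_def)
    show "(LINT x:\<Omega>|lebesgue. grad w x \<bullet> grad (\<phi> n) x) = 0" for n
      by (rule integral_grad_harmonic_inner_grad_test[OF w \<phi>n])
  qed
  moreover have "(LINT x:\<Omega>|lebesgue. grad w x \<bullet> g x) = (LINT x:\<Omega>|lebesgue. grad w x \<bullet> G x)"
    unfolding integral_grad_inner_eq_sum[OF \<Omega> w(1) gL] integral_grad_inner_eq_sum[OF \<Omega> w(1) GL]
    by (intro sum.cong refl weak_gradient_unique_smooth[OF \<Omega> gL wg GL wG] smooth_partial w(1))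
  ultimately have g0: "(LINT x:\<Omega>|lebesgue. grad w x \<bullet> g x) = 0" by simp
  have "v \<in> H_div_0 \<Omega>" using dec by (simp add: helmholtz_hodge_decomposition_def)
  then obtain \<psi> where vL: "v \<in> L2 \<Omega>" and \<psi>: "range \<psi> \<subseteq> test_functions \<Omega>"
    and div: "\<And>n x. divergence (\<psi> n) x = 0" and lim: "L2_tendsto \<Omega> \<psi> v"
    unfolding H_div_0_def by blast
  have \<psi>n: "\<psi> n \<in> test_functions \<Omega>" for n using \<psi> by auto
  have v0: "(LINT x:\<Omega>|lebesgue. grad w x \<bullet> v x) = 0"
  proof (rule L2_limit_orthogonal[OF \<Omega> cg vL _ lim])
    show "\<psi> n \<in> L2 \<Omega>" for n
      using \<psi>n[of n] by (intro continuous_in_L2 \<Omega> smooth_continuous_on) (simp add: test_functions_def)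
    show "(LINT x:\<Omega>|lebesgue. grad w x \<bullet> \<psi> n x) = 0" for n
      by (rule integral_grad_inner_div_free_test[OF w(1) \<psi>n div])
  qed
  have i: "integrable lebesgue (\<lambda>x. indicator \<Omega> x *\<^sub>R (grad w x \<bullet> g x))"
    "integrable lebesgue (\<lambda>x. indicator \<Omega> x *\<^sub>R (grad w x \<bullet> v x))"
    by (intro integrable_inner_L2 \<Omega> cg gL vL)+
  have "AE x in lebesgue. x \<in> \<Omega> \<longrightarrow> f x = g x + h x + v x"
    using dec by (simp add: helmholtz_hodge_decomposition_def)
  then have "AE x in lebesgue. indicator \<Omega> x *\<^sub>R (grad w x \<bullet> f x) =
      indicator \<Omega> x *\<^sub>R (grad w x \<bullet> g x) + indicator \<Omega> x *\<^sub>R (grad w x \<bullet> v x)"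
    using h by eventually_elim (auto simp: indicator_def inner_add_right)
  then have "(LINT x:\<Omega>|lebesgue. grad w x \<bullet> f x) =
      (LINT x|lebesgue. indicator \<Omega> x *\<^sub>R (grad w x \<bullet> g x) + indicator \<Omega> x *\<^sub>R (grad w x \<bullet> v x))"
    unfolding set_lebesgue_integral_def
  proof (rule integral_cong_AE[rotated 2])
    show "(\<lambda>x. indicator \<Omega> x *\<^sub>R (grad w x \<bullet> f x)) \<in> borel_measurable lebesgue"
      using \<Omega>(1) by (intro borel_measurable_scaleR borel_measurable_inner f continuous_measurable_lebesgue cg
          borel_measurable_indicator) auto
    show "(\<lambda>x. indicator \<Omega> x *\<^sub>R (grad w x \<bullet> g x) + indicator \<Omega> x *\<^sub>R (grad w x \<bullet> v x)) \<in> borel_measurable lebesgue"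
      using i by (intro borel_measurable_add borel_measurable_integrable)
  qed
  then show ?thesis using i g0 v0 by (simp add: set_lebesgue_integral_def)
qed

section \<open>Essential support and Newton kernel\<close>

text \<open>
  The complement of the essential support is a union of open sets on which the function is zero almost
  everywhere, and by the Lindeloef property countably many of them suffice.
\<close>

lemma AE_eq_0_outside_ess_supp: "AE x in lebesgue. x \<notin> ess_supp f \<longrightarrow> f x = 0"
  for f :: "'a::euclidean_space \<Rightarrow> 'b::zero"
proof -
  let ?\<U> = "{U. open U \<and> (AE y in lebesgue. y \<in> U \<longrightarrow> f y = 0)}"
  have opn: "open U" if "U \<in> ?\<U>" for U using that by simp
  obtain \<F> where \<F>: "\<F> \<subseteq> ?\<U>" "countable \<F>" "\<Union>\<F> = \<Union>?\<U>"
    by (rule Lindelof[of ?\<U>]) (erule opn, rule that, assumption+)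
  have "AE y in lebesgue. \<forall>U\<in>\<F>. y \<in> U \<longrightarrow> f y = 0"
    using \<F>(1,2) by (subst AE_ball_countable) auto
  then show ?thesis
  proof eventually_elim
    case (elim y)
    show ?case
    proof
      assume "y \<notin> ess_supp f"
      then have "y \<in> \<Union>?\<U>" unfolding ess_supp_def by blast
      then obtain U where "U \<in> \<F>" "y \<in> U" unfolding \<F>(3)[symmetric] by blast
      then show "f y = 0" using elim by blast
    qed
  qed
qed

lemma ess_supp_subset_closed:
  assumes "closed S" "AE x in lebesgue. x \<notin> S \<longrightarrow> f x = 0"
  shows "ess_supp f \<subseteq> S"
proof
  fix x assume x: "x \<in> ess_supp f"
  show "x \<in> S"
  proof (rule ccontr)
    assume "x \<notin> S"
    then have "open (- S) \<and> x \<in> - S" using assms(1) by auto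
    moreover have "AE y in lebesgue. y \<in> - S \<longrightarrow> f y = 0" using assms(2) by simp
    ultimately show False using x unfolding ess_supp_def by blast
  qed
qed

lemma grad_newton_kernel:
  fixes z :: "'a::euclidean_space"
  assumes d: "DIM('a) \<ge> 3" and z: "z \<noteq> 0"
  shows "grad newton_kernel z =
    (- 1 / (real DIM('a) * unit_ball_vol (real DIM('a)))) *\<^sub>R (norm z powr - real DIM('a) *\<^sub>R z)"
proof -
  let ?n = "real DIM('a)"
  define \<omega> where "\<omega> = ?n * unit_ball_vol ?n"
  have \<omega>: "\<omega> \<noteq> 0" using d by (simp add: \<omega>_def unit_ball_vol_def Gamma_real_pos[THEN less_imp_neq, symmetric] )
  have n2: "?n - 2 \<noteq> 0" using d by simp
  have "((\<lambda>x. norm x powr (2 - ?n)) has_derivative (\<lambda>h. (h \<bullet> sgn z) * ((2 - ?n) * norm z powr (2 - ?n - 1)))) (at z)"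
    using z by (intro DERIV_compose_FDERIV[OF has_real_derivative_powr] has_derivative_norm) auto
  then have "((\<lambda>x. norm x powr (2 - ?n) / ((?n - 2) * \<omega>)) has_derivative
      (\<lambda>h. (h \<bullet> sgn z) * ((2 - ?n) * norm z powr (2 - ?n - 1)) / ((?n - 2) * \<omega>))) (at z)"
    by (rule bounded_linear.has_derivative[OF bounded_linear_divide])
  then have "(newton_kernel has_derivative
      (\<lambda>h. (h \<bullet> sgn z) * ((2 - ?n) * norm z powr (2 - ?n - 1)) / ((?n - 2) * \<omega>))) (at z)"
    unfolding newton_kernel_def[abs_def] \<omega>_def .
  then have "partial b newton_kernel z = (b \<bullet> sgn z) * ((2 - ?n) * norm z powr (2 - ?n - 1)) / ((?n - 2) * \<omega>)" for b
    by (rule partial_eq)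
  moreover have "(b \<bullet> sgn z) * ((2 - ?n) * norm z powr (2 - ?n - 1)) / ((?n - 2) * \<omega>) =
      (- 1 / \<omega>) * (norm z powr - ?n * (z \<bullet> b))" for b
  proof -
    have "norm z powr (2 - ?n - 1) = norm z * norm z powr - ?n"
    proof -
      have "norm z * norm z powr - ?n = norm z powr (1 + - ?n)" by (rule powr_mult_base) simp
      moreover have "2 - ?n - 1 = 1 + - ?n" by simp
      ultimately show ?thesis by simp
    qed
    moreover have "b \<bullet> sgn z = (z \<bullet> b) / norm z"
      by (simp add: sgn_div_norm inner_commute divide_inverse mult.commute)
    moreover have "(2 - ?n) / ((?n - 2) * \<omega>) = - 1 / \<omega>"
      using n2 \<omega> by (simp add: divide_simps)
    moreover have "(b \<bullet> sgn z) * ((2 - ?n) * p) / ((?n - 2) * \<omega>) = (2 - ?n) / ((?n - 2) * \<omega>) * ((b \<bullet> sgn z) * p)" for p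
      by simp
    ultimately show ?thesis using z by (simp only:) (simp add: field_simps)
  qed
  ultimately have "grad newton_kernel z = (\<Sum>b\<in>Basis. ((- 1 / \<omega>) * (norm z powr - ?n * (z \<bullet> b))) *\<^sub>R b)"
    by (simp only: grad_def)
  also have "\<dots> = (- 1 / \<omega>) *\<^sub>R (norm z powr - ?n *\<^sub>R (\<Sum>b\<in>Basis. (z \<bullet> b) *\<^sub>R b))"
    by (simp only: scaleR_sum_right scaleR_scaleR)
  finally show ?thesis by (simp add: euclidean_representation \<omega>_def)
qed

lemma box_field_bounds:
  fixes v l u :: "nat \<Rightarrow> 'a::euclidean_space"
  obtains r M where "r \<ge> 0" "\<And>y. norm y > r \<Longrightarrow> box_field N v l u y = 0"
    "\<And>y. norm (box_field N v l u y) \<le> M" "box_field N v l u \<in> borel_measurable borel"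
proof -
  have "bounded (\<Union>i<N. box (l i) (u i))" by (intro bounded_UN) auto
  then obtain r where r: "r > 0" "\<forall>x\<in>(\<Union>i<N. box (l i) (u i)). norm x \<le> r"
    unfolding bounded_pos by blast
  show ?thesis
  proof
    show "r \<ge> 0" using r(1) by simp
    show "box_field N v l u y = 0" if "norm y > r" for y
      unfolding box_field_def using r(2) that by (intro sum.neutral) (force simp: indicator_def)
    show "norm (box_field N v l u y) \<le> (\<Sum>i<N. norm (v i))" for y
      unfolding box_field_def by (rule sum_norm_le) (auto simp: indicator_def)
    show "box_field N v l u \<in> borel_measurable borel"
      unfolding box_field_def[abs_def] by measurable
  qed
qed

section \<open>Real and imaginary parts of harmonic exponentials\<close>

text \<open>
  The complex factor \<open>\<gamma>\<close> makes the family closed under partial derivatives; \<open>\<gamma> = 1\<close> and \<open>\<gamma> = -i\<close> give the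
  real and the imaginary part of the exponential.
\<close>

lemma smooth_Re_exp_cform: "smooth (\<lambda>x. Re (\<gamma> * exp (cform a b x)))"
  and partial_Re_exp_cform: "partial c (\<lambda>x. Re (\<gamma> * exp (cform a b x))) = (\<lambda>x. Re ((\<gamma> * cform a b c) * exp (cform a b x)))"
proof -
  have bl: "bounded_linear (cform a b)"
    using linear_cform by (simp add: linear_conv_bounded_linear)
  have d: "((\<lambda>x. Re (\<gamma> * exp (cform a b x))) has_derivative (\<lambda>c. Re ((\<gamma> * cform a b c) * exp (cform a b x)))) (at x)" for \<gamma> x
  proof -
    have "(exp has_derivative (\<lambda>h. h * exp (cform a b x))) (at (cform a b x))"
      using DERIV_exp[of "cform a b x", unfolded has_field_derivative_def]
      by (rule has_derivative_eq_rhs) (simp add: fun_eq_iff mult.commute)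
    then have "((\<lambda>x. exp (cform a b x)) has_derivative (\<lambda>c. cform a b c * exp (cform a b x))) (at x)"
      using has_derivative_compose[OF bounded_linear_imp_has_derivative[OF bl], of exp "\<lambda>h. h * exp (cform a b x)" x UNIV]
      by simp
    from bounded_linear.has_derivative[OF bounded_linear_Re has_derivative_mult_right[OF this, of \<gamma>]]
    show ?thesis by (simp only: mult.assoc)
  qed
  have p: "partial c (\<lambda>x. Re (\<gamma> * exp (cform a b x))) = (\<lambda>x. Re ((\<gamma> * cform a b c) * exp (cform a b x)))" for c \<gamma>
    by (rule ext, rule partial_eq[OF d])
  show "partial c (\<lambda>x. Re (\<gamma> * exp (cform a b x))) = (\<lambda>x. Re ((\<gamma> * cform a b c) * exp (cform a b x)))"
    by (rule p)
  show "smooth (\<lambda>x. Re (\<gamma> * exp (cform a b x)))"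
  proof (rule smooth_coinduct[where S="range (\<lambda>\<gamma> x. Re (\<gamma> * exp (cform a b x)))"])
    fix w c assume "w \<in> range (\<lambda>\<gamma> x. Re (\<gamma> * exp (cform a b x)))"
    then obtain \<gamma> where w: "w = (\<lambda>x. Re (\<gamma> * exp (cform a b x)))" by blast
    show "w differentiable_on UNIV"
      unfolding w using d by (auto simp only: differentiable_on_def differentiable_def)
    show "partial c w \<in> range (\<lambda>\<gamma> x. Re (\<gamma> * exp (cform a b x)))"
      unfolding w p by (rule rangeI)
  qed (rule rangeI)
qed

lemma laplacian_Re_exp_cform:
  assumes "a \<bullet> b = 0" "norm a = norm b"
  shows "laplacian (\<lambda>x. Re (\<gamma> * exp (cform a b x))) x = 0"
proof -
  have "laplacian (\<lambda>x. Re (\<gamma> * exp (cform a b x))) x = (\<Sum>c\<in>Basis. Re ((\<gamma> * cform a b c * cform a b c) * exp (cform a b x)))"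
    unfolding laplacian_def partial_Re_exp_cform ..
  also have "\<dots> = Re (\<gamma> * (\<Sum>c\<in>Basis. cform a b c * cform a b c) * exp (cform a b x))"
    by (simp only: Re_sum[symmetric] sum_distrib_left sum_distrib_right mult.assoc)
  finally show ?thesis by (simp add: cform_isotropic[OF assms])
qed

lemma grad_Re_exp_cform_inner:
  "grad (\<lambda>x. Re (\<gamma> * exp (cform a b x))) x \<bullet> y = Re (\<gamma> * (cform a b y * exp (cform a b x)))"
proof -
  have Re_mult: "Re (of_real r * z) = r * Re z" for r z by simp
  have "grad (\<lambda>x. Re (\<gamma> * exp (cform a b x))) x \<bullet> y =
      (\<Sum>c\<in>Basis. Re ((\<gamma> * cform a b c) * exp (cform a b x)) * (y \<bullet> c))"
    by (subst euclidean_inner) (simp only: grad_inner_Basis partial_Re_exp_cform cong: sum.cong)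
  also have "\<dots> = (\<Sum>c\<in>Basis. Re (of_real (y \<bullet> c) * ((\<gamma> * cform a b c) * exp (cform a b x))))"
    by (intro sum.cong refl) (simp only: Re_mult mult.commute)
  also have "\<dots> = Re (\<gamma> * ((\<Sum>c\<in>Basis. of_real (y \<bullet> c) * cform a b c) * exp (cform a b x)))"
    by (simp only: Re_sum[symmetric] sum_distrib_left sum_distrib_right mult_ac)
  finally show ?thesis by (simp only: cform_expand[symmetric])
qed

section \<open>Non-vanishing of the potential and of the harmonic component\<close>

theorem theorem4p3:
  fixes f :: "real ^ 'n \<Rightarrow> real ^ 'n"
  assumes "CARD('n) \<ge> 3"
    and "box_simple f"
    and "\<not> (AE x in lebesgue. f x = 0)"
  shows "(\<exists>x \<in> - closure (ess_supp f). magnetic_potential f x \<noteq> 0) \<and>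
    (\<forall>\<Omega> g h w.
       lipschitz_domain \<Omega> \<and> bounded \<Omega> \<and> connected \<Omega> \<and> simply_connected \<Omega> \<and> ess_supp f \<subseteq> \<Omega> \<and>
       helmholtz_hodge_decomposition \<Omega> f g h w \<longrightarrow>
       \<not> (AE x in lebesgue. x \<in> \<Omega> \<longrightarrow> h x = 0))"
proof -
  let ?n = "real DIM(real ^ 'n)"
  have dim: "DIM(real ^ 'n) \<ge> 3" using assms(1) by simp
  obtain N and v l u :: "nat \<Rightarrow> real ^ 'n" where ne: "\<forall>i<N. v i \<noteq> 0 \<and> box (l i) (u i) \<noteq> {}"
    and f: "AE x in lebesgue. f x = (\<Sum>i<N. indicator (box (l i) (u i)) x *\<^sub>R v i)"
    using assms(2) unfolding box_simple_def by blast
  define F where "F = box_field N v l u"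
  have fF: "AE x in lebesgue. f x = F x" using f by (simp add: F_def box_field_def)
  have lu: "l i \<bullet> k \<le> u i \<bullet> k" if "i < N" "k \<in> Basis" for i k
    using ne that by (auto simp: box_ne_empty less_imp_le)
  \<comment> \<open>Both conclusions are proved by contradiction: their negation makes all moments vanish.\<close>
  have no_moments: False
    if "\<And>a b. a \<bullet> b = 0 \<Longrightarrow> norm a = norm b \<Longrightarrow> (LINT y|lborel. cform a b (F y) * exp (cform a b y)) = 0"
  proof -
    have "AE y in lborel. F y = 0"
      unfolding F_def
      by (rule box_field_eq_0_if_exp_moments_0) (use dim lu that[unfolded F_def] in auto)
    then have "AE y in lebesgue. F y = 0" by (rule AE_completion)
    with fF have "AE y in lebesgue. f y = 0" by eventually_elim simp
    with assms(3) show False by blast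
  qed
  obtain r M where r: "r \<ge> 0" "\<And>y. norm y > r \<Longrightarrow> F y = 0"
    and M: "\<And>y. norm (F y) \<le> M" and Fm: "F \<in> borel_measurable borel"
    by (rule box_field_bounds[of N v l u, folded F_def]) (rule that, assumption+)
  have "AE x in lebesgue. x \<notin> cball 0 r \<longrightarrow> f x = 0"
    using fF by eventually_elim (simp add: r)
  then have sub: "ess_supp f \<subseteq> cball 0 r" by (intro ess_supp_subset_closed) auto
  then have csub: "closure (ess_supp f) \<subseteq> cball 0 r" by (intro closure_minimal) auto
  have out: "AE x in lebesgue. x \<notin> ess_supp f \<longrightarrow> F x = 0"
    using AE_eq_0_outside_ess_supp[of f] fF by eventually_elim auto
  show ?thesis
  proof (intro conjI allI impI)
    show "\<exists>x \<in> - closure (ess_supp f). magnetic_potential f x \<noteq> 0"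
    proof (rule ccontr)
      assume "\<not> (\<exists>x \<in> - closure (ess_supp f). magnetic_potential f x \<noteq> 0)"
      then have zero: "magnetic_potential f x = 0" if "x \<in> - closure (ess_supp f)" for x
        using that by blast
      have pot: "(LINT y|lborel. norm (x - y) powr - ?n *\<^sub>R (x - y) \<bullet> F y) = 0" if x: "norm x > r + 1" for x
      proof -
        define \<kappa> where "\<kappa> = - 1 / (?n * unit_ball_vol ?n)"
        have \<kappa>: "\<kappa> \<noteq> 0" 
        proof -
          have "?n * unit_ball_vol ?n > 0" using dim by (intro mult_pos_pos unit_ball_vol_pos) auto
          then show ?thesis unfolding \<kappa>_def by (metis divide_eq_0_iff less_irrefl neg_equal_0_iff_equal zero_neq_one)
        qed
        let ?h = "\<lambda>y. \<kappa> * (norm (x - y) powr - ?n *\<^sub>R (x - y) \<bullet> F y)"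
        note Fm[measurable]
        have hm: "?h \<in> borel_measurable borel" by measurable
        have ae: "AE y in lebesgue. indicator (ess_supp f) y *\<^sub>R (grad newton_kernel (x - y) \<bullet> f y) = ?h y"
          using fF out
        proof eventually_elim
          case (elim y)
          show ?case
          proof (cases "y \<in> ess_supp f")
            case True
            then have "x - y \<noteq> 0" using sub x r(1) by auto
            from grad_newton_kernel[OF dim this] show ?thesis using True elim(1)
              by (simp add: \<kappa>_def)
          next
            case False
            then show ?thesis using elim(2) by simp
          qed
        qed
        have hl: "?h \<in> borel_measurable lebesgue" using hm by (intro measurable_completion) simp
        have "magnetic_potential f x = (LINT y|lebesgue. ?h y)"
          unfolding magnetic_potential_def set_lebesgue_integral_def
        proof (rule integral_cong_AE)
          show "(\<lambda>y. indicator (ess_supp f) y *\<^sub>R (grad newton_kernel (x - y) \<bullet> f y)) \<in> borel_measurable lebesgue"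
            by (rule borel_measurable_AE[OF hl]) (use ae in eventually_elim, simp)
        qed (use hl ae in auto)
        also have "\<dots> = (LINT y|lborel. ?h y)" using hm by (intro integral_completion) simp
        also have "\<dots> = \<kappa> * (LINT y|lborel. norm (x - y) powr - ?n *\<^sub>R (x - y) \<bullet> F y)"
          by (rule integral_mult_right_zero)
        finally have eq: "magnetic_potential f x =
            \<kappa> * (LINT y|lborel. norm (x - y) powr - ?n *\<^sub>R (x - y) \<bullet> F y)" .
        have "x \<in> - closure (ess_supp f)" using csub x by auto
        from zero[OF this] show ?thesis unfolding eq using \<kappa> by simp
      qed
      show False
      proof (rule no_moments)
        fix a b :: "real ^ 'n" assume "a \<bullet> b = 0" "norm a = norm b"
        then show "(LINT y|lborel. cform a b (F y) * exp (cform a b y)) = 0"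
          by (intro exp_moment_eq_0_if_potential_eq_0[OF Fm M r(2) pot r(1)])
      qed
    qed
  next
    fix \<Omega> :: "(real ^ 'n) set" and g h w
    assume *: "lipschitz_domain \<Omega> \<and> bounded \<Omega> \<and> connected \<Omega> \<and> simply_connected \<Omega> \<and> ess_supp f \<subseteq> \<Omega> \<and>
       helmholtz_hodge_decomposition \<Omega> f g h w"
    then have \<Omega>: "open \<Omega>" "bounded \<Omega>" "ess_supp f \<subseteq> \<Omega>" by (auto simp: lipschitz_domain_def)
    have "AE x in lebesgue. x \<in> \<Omega> \<longrightarrow> f x = g x + h x + w x"
      using * by (simp add: helmholtz_hodge_decomposition_def)
    then have "AE x in lebesgue. x \<in> \<Omega> \<longrightarrow> F x = g x + h x + w x"
      using fF by eventually_elim simp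
    then have dec: "helmholtz_hodge_decomposition \<Omega> F g h w"
      using * by (simp add: helmholtz_hodge_decomposition_def)
    have Fl: "F \<in> borel_measurable lebesgue" using Fm by (intro measurable_completion) simp
    show "\<not> (AE x in lebesgue. x \<in> \<Omega> \<longrightarrow> h x = 0)"
    proof
      assume h: "AE x in lebesgue. x \<in> \<Omega> \<longrightarrow> h x = 0"
      show False
      proof (rule no_moments)
        fix a b :: "real ^ 'n" assume ab: "a \<bullet> b = 0" "norm a = norm b"
        let ?I = "\<lambda>y. cform a b (F y) * exp (cform a b y)"
        have Re0: "(LINT y|lborel. Re (\<gamma> * ?I y)) = 0" for \<gamma>
        proof -
          define W where "W = (\<lambda>x. Re (\<gamma> * exp (cform a b x)))"
          have W: "smooth W" "laplacian W x = 0" "grad W x \<bullet> y = Re (\<gamma> * (cform a b y * exp (cform a b x)))" for x y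
            unfolding W_def by (rule smooth_Re_exp_cform laplacian_Re_exp_cform[OF ab] grad_Re_exp_cform_inner)+
          have m: "(\<lambda>y. grad W y \<bullet> F y) \<in> borel_measurable borel"
            by (intro borel_measurable_inner borel_measurable_continuous_onI[OF continuous_on_grad[OF W(1)]] Fm)
          then have ml: "(\<lambda>y. grad W y \<bullet> F y) \<in> borel_measurable lebesgue" by (intro measurable_completion) simp
          have "(LINT y|lborel. Re (\<gamma> * ?I y)) = (LINT y|lborel. grad W y \<bullet> F y)" by (simp only: W(3))
          also have "\<dots> = (LINT y|lebesgue. grad W y \<bullet> F y)"
            using m by (intro integral_completion[symmetric]) simp
          also have "\<dots> = (LINT y:\<Omega>|lebesgue. grad W y \<bullet> F y)"
            unfolding set_lebesgue_integral_def
          proof (rule integral_cong_AE)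
            show "(\<lambda>y. indicator \<Omega> y *\<^sub>R (grad W y \<bullet> F y)) \<in> borel_measurable lebesgue"
              using \<Omega>(1) ml by (intro borel_measurable_scaleR borel_measurable_indicator) auto
            show "AE y in lebesgue. grad W y \<bullet> F y = indicator \<Omega> y *\<^sub>R (grad W y \<bullet> F y)"
              using out by eventually_elim (use \<Omega>(3) in \<open>auto simp: indicator_def\<close>)
          qed (rule ml)
          also have "\<dots> = 0"
            by (rule integral_grad_harmonic_eq_0_if_no_harmonic_component[OF \<Omega>(1,2) W(1,2) dec h Fl])
          finally show ?thesis .
        qed
        show "(LINT y|lborel. ?I y) = 0"
        proof (cases "integrable lborel ?I")
          case True
          have R: "Re (\<gamma> * (LINT y|lborel. ?I y)) = 0" for \<gamma>
            using Re0[of \<gamma>] integral_Re[OF integrable_mult_right[OF True, of \<gamma>]]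
            by (simp only: integral_mult_right_zero)
          \<comment> \<open>The factor \<open>-\<i>\<close> turns the imaginary part of the moment into a real part.\<close>
          from R[of 1] R[of "- \<i>"] show ?thesis by (simp add: complex_eq_iff)
        qed (rule not_integrable_integral_eq)
      qed
    qed
  qed
qed

end
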